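(* There are no zero divisors in $\mathcal{S}_{\mathrm{fin}}$ in the following sense: if $0\neq Y\in\mathcal{S}_{\mathrm{fin}}$ and $u\in\mathcal{S}$ satisfy $Yu=0$, then $u=0$.
   Context: $\mathcal{F}=\bigoplus_{n\ge0}L^2(\mathbb{R}_+)^{\otimes n}$, with $L^2(\mathbb{R}_+)^{\otimes n}\cong L^2(\mathbb{R}_+^n)$, is the full Fock space over $L^2(\mathbb{R}_+)$ with vacuum $\Omega$. For $h\in L^2(\mathbb{R}_+)$, $l(h)$ is the creation operator, $l^*(h)$ its adjoint and $X(h)=l(h)+l^*(h)$. $\mathcal{S}$ is the von Neumann algebra generated by $\{X(g):g\in L^2(\mathbb{R}_+,\mathbb{R})\}$, with faithful normal tracial state $\tau(X)=\langle X\Omega,\Omega\rangle$ (it is generated by the free Brownian motion $S_t=X(1_{[0,t]})$). The map $X\mapsto X\Omega$ extends to a unitary $L^2(\mathcal{S},\tau)\to\mathcal{F}$ with inverse $I^S$; $I_n^S(f)$ for $f\in L^2(\mathbb{R}_+^n)$ is $I^S$ of $f$ placed in the $n$-th summand (the multiple Wigner integral $\int f\,dS_{t_1}\cdots dS_{t_n}$), $I_0^S(c)=c1$, and each $I_n^S(f)$ lies in $\mathcal{S}$. The finite Wigner chaos $\mathcal{S}_{\mathrm{fin}}$ is the set of finite sums $\sum_{n=0}^NI_n^S(f_n)$, $f_n\in L^2(\mathbb{R}_+^n)$; it is a $*$-subalgebra of $\mathcal{S}$. *)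

theory Defs
  imports "HOL-Analysis.Analysis"
begin

definition Rplus :: "real measure" where
  "Rplus = restrict_space lborel {0..}"

definition Mn :: "nat \<Rightarrow> (nat \<Rightarrow> real) measure" where
  "Mn n = PiM {..<n} (\<lambda>_. Rplus)"

definition sqint :: "nat \<Rightarrow> ((nat \<Rightarrow> real) \<Rightarrow> complex) \<Rightarrow> bool" where
  "sqint n f \<longleftrightarrow> f \<in> borel_measurable (Mn n) \<and>
     integrable (Mn n) (\<lambda>t. (cmod (f t))\<^sup>2)"

definition sqint1 :: "(real \<Rightarrow> complex) \<Rightarrow> bool" where
  "sqint1 h \<longleftrightarrow> h \<in> borel_measurable Rplus \<and> integrable Rplus (\<lambda>s. (cmod (h s))\<^sup>2)"

text \<open>Representatives of Fock space vectors: the n-th component is a function on R_+^n.\<close>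
type_synonym fockv = "nat \<Rightarrow> (nat \<Rightarrow> real) \<Rightarrow> complex"

definition fnorm2_comp :: "fockv \<Rightarrow> nat \<Rightarrow> real" where
  "fnorm2_comp \<psi> n = (\<integral>t. (cmod (\<psi> n t))\<^sup>2 \<partial>Mn n)"

definition fock :: "fockv \<Rightarrow> bool" where
  "fock \<psi> \<longleftrightarrow> (\<forall>n. sqint n (\<psi> n)) \<and> summable (fnorm2_comp \<psi>)"

definition fnorm :: "fockv \<Rightarrow> real" where
  "fnorm \<psi> = sqrt (\<Sum>n. fnorm2_comp \<psi> n)"

definition feq :: "fockv \<Rightarrow> fockv \<Rightarrow> bool" where
  "feq \<psi> \<phi> \<longleftrightarrow> (\<forall>n. AE t in Mn n. \<psi> n t = \<phi> n t)"

definition fzero :: fockv where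
  "fzero = (\<lambda>n t. 0)"

definition fadd :: "fockv \<Rightarrow> fockv \<Rightarrow> fockv" where
  "fadd \<psi> \<phi> = (\<lambda>n t. \<psi> n t + \<phi> n t)"

definition fscale :: "complex \<Rightarrow> fockv \<Rightarrow> fockv" where
  "fscale a \<psi> = (\<lambda>n t. a * \<psi> n t)"

definition vacuum :: fockv where
  "vacuum = (\<lambda>n t. if n = 0 then 1 else 0)"

definition emb :: "nat \<Rightarrow> ((nat \<Rightarrow> real) \<Rightarrow> complex) \<Rightarrow> fockv" where
  "emb n f = (\<lambda>m t. if m = n then f t else 0)"

text \<open>Creation operator: l(h)(f_1 \<otimes> ... \<otimes> f_n) = h \<otimes> f_1 \<otimes> ... \<otimes> f_n.\<close>
definition lcre :: "(real \<Rightarrow> complex) \<Rightarrow> fockv \<Rightarrow> fockv" where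
  "lcre h \<psi> = (\<lambda>n t. if n = 0 then 0 else h (t 0) * \<psi> (n - 1) (\<lambda>i. t (Suc i)))"

text \<open>Its adjoint, the annihilation operator.\<close>
definition lann :: "(real \<Rightarrow> complex) \<Rightarrow> fockv \<Rightarrow> fockv" where
  "lann h \<psi> = (\<lambda>n t. \<integral>s. cnj (h s) * \<psi> (Suc n) (\<lambda>i. if i = 0 then s else t (i - 1)) \<partial>Rplus)"

definition Xop :: "(real \<Rightarrow> real) \<Rightarrow> fockv \<Rightarrow> fockv" where
  "Xop g = (\<lambda>\<psi>. fadd (lcre (\<lambda>s. complex_of_real (g s)) \<psi>) (lann (\<lambda>s. complex_of_real (g s)) \<psi>))"

text \<open>Bounded linear operators on the Fock space, given by maps on representatives.\<close>
definition bdd_op :: "(fockv \<Rightarrow> fockv) \<Rightarrow> bool" where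
  "bdd_op T \<longleftrightarrow>
     (\<forall>\<psi>. fock \<psi> \<longrightarrow> fock (T \<psi>)) \<and>
     (\<forall>\<psi> \<phi>. fock \<psi> \<longrightarrow> fock \<phi> \<longrightarrow> feq \<psi> \<phi> \<longrightarrow> feq (T \<psi>) (T \<phi>)) \<and>
     (\<forall>\<psi> \<phi> a b. fock \<psi> \<longrightarrow> fock \<phi> \<longrightarrow>
        feq (T (fadd (fscale a \<psi>) (fscale b \<phi>))) (fadd (fscale a (T \<psi>)) (fscale b (T \<phi>)))) \<and>
     (\<exists>C. \<forall>\<psi>. fock \<psi> \<longrightarrow> fnorm (T \<psi>) \<le> C * fnorm \<psi>)"

definition opeq :: "(fockv \<Rightarrow> fockv) \<Rightarrow> (fockv \<Rightarrow> fockv) \<Rightarrow> bool" where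
  "opeq T U \<longleftrightarrow> (\<forall>\<psi>. fock \<psi> \<longrightarrow> feq (T \<psi>) (U \<psi>))"

definition commutant :: "(fockv \<Rightarrow> fockv) set \<Rightarrow> (fockv \<Rightarrow> fockv) set" where
  "commutant A = {T. bdd_op T \<and> (\<forall>U\<in>A. opeq (T \<circ> U) (U \<circ> T))}"

text \<open>The von Neumann algebra generated by the self-adjoint family X(g), g real in L^2,
  i.e. its bicommutant (von Neumann's bicommutant theorem).\<close>
definition Salg :: "(fockv \<Rightarrow> fockv) set" where
  "Salg = commutant (commutant {Xop g | g. sqint1 (\<lambda>s. complex_of_real (g s))})"

text \<open>Multiple Wigner integral I_n^S(f): the element X of S with X \<Omega> = f in the n-th summand.\<close>
definition IS :: "nat \<Rightarrow> ((nat \<Rightarrow> real) \<Rightarrow> complex) \<Rightarrow> (fockv \<Rightarrow> fockv)" where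
  "IS n f = (SOME X. X \<in> Salg \<and> feq (X vacuum) (emb n f))"

definition Sfin :: "(fockv \<Rightarrow> fockv) set" where
  "Sfin = {Y. \<exists>N f. (\<forall>n\<le>N. sqint n (f n)) \<and>
                  opeq Y (\<lambda>\<psi> m t. \<Sum>n\<le>N. IS n (f n) \<psi> m t)}"

definition zero_op :: "fockv \<Rightarrow> fockv" where
  "zero_op = (\<lambda>\<psi>. fzero)"

end

(*
  An orthonormal basis of L^2(R_+) made of real functions identifies the Fock space with l^2 of the
  set of words in the basis letters, and I_n(f) with left multiplication L_f for the Wick product
    (f * a)(w) = sum over w = x y and all words c of f(x c) a(rev(c) y).
  The right multiplications R_i by single letters commute with every L_f, and the right annihilation
  operator r_i satisfies [r_i, L_f] a (w) = sum_c f(w i c) a(rev(c)), a Hilbert-Schmidt operator.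
  Suppose f * a = 0 with f of degree N and a nonzero. Traciality of the vacuum state makes the kernel
  of the adjoint of L_f nonzero as well; by R_i-invariance it contains some z with nonzero vacuum
  component. Pairing [r_i, L_f] a with z kills both terms of the commutator, which means that
  f' * a has vanishing vacuum component for f'(y) = sum_w cnj(z(w)) f(w i y), and by R_i-invariance of
  the kernel f' * a = 0. The degree of f' is at most N - 1, and the vacuum component of z keeps
  the top degree part of f' nonzero for a suitable i, so induction on N gives a = 0.
*)
theory Submission
  imports Defs
begin

section \<open>Square-summable families\<close>

text \<open>The question concerns vectors: \<open>Y u = 0\<close> puts every \<open>u \<psi>\<close>
  into the kernel of one left multiplication, so the core is that a nonzero f of finite degree has
  trivial kernel on the whole space. The obstacle is that kernel vectors may have infinite degree,
  and a product of two such vectors need not be square-summable. Associativity and the adjoint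
  formula are therefore first reached through words and the right multiplications
  \<open>Rop i\<close>, then extended by boundedness and density. Commuting L_f with the right
  annihilation operator, instead of with \<open>Rop i\<close>, produces a kind of free difference
  quotient of f; this is what lowers the degree. Its top coefficient survives because, for a word
  \<open>i # y0\<close> of maximal length, every nonempty w makes \<open>w @ i # y0\<close> too long
  for f, so that f'(y0) = cnj (z []) f(i y0). The kernels of L_f and of its adjoint are compared by
  iterating two contractions with equal traces, in place of a polar decomposition. The basis is real
  so that each letter is self-adjoint and \<open>star\<close> only reverses words and conjugates
  coefficients.\<close>

definition square_summable :: "('a \<Rightarrow> complex) \<Rightarrow> bool" where
  "square_summable f \<longleftrightarrow> (\<lambda>x. (cmod (f x))\<^sup>2) summable_on UNIV"

lemma square_summable_prod:
  assumes "square_summable f" "square_summable g"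
  shows "(\<lambda>x. cmod (f x * g x)) summable_on UNIV"
proof (rule summable_on_comparison_test)
  show "(\<lambda>x. (cmod (f x))\<^sup>2 + (cmod (g x))\<^sup>2) summable_on UNIV"
    using assms by (auto simp: square_summable_def intro: summable_on_add)
  fix x
  have "2 * (cmod (f x) * cmod (g x)) \<le> (cmod (f x))\<^sup>2 + (cmod (g x))\<^sup>2"
    using sum_squares_bound[of "cmod (f x)" "cmod (g x)"] by simp
  then show "cmod (f x * g x) \<le> (cmod (f x))\<^sup>2 + (cmod (g x))\<^sup>2"
    using mult_nonneg_nonneg[OF norm_ge_zero norm_ge_zero, of "f x" "g x"]
    unfolding norm_mult by linarith
qed auto

lemma square_summable_add:
  assumes "square_summable f" "square_summable g"
  shows "square_summable (\<lambda>x. f x + g x)"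
  unfolding square_summable_def
proof (rule summable_on_comparison_test)
  show "(\<lambda>x. 2 * (cmod (f x))\<^sup>2 + 2 * (cmod (g x))\<^sup>2) summable_on UNIV"
    using assms by (auto simp: square_summable_def intro!: summable_on_add summable_on_cmult_right)
  fix x
  have "(cmod (f x + g x))\<^sup>2 \<le> (cmod (f x) + cmod (g x))\<^sup>2"
    by (simp add: norm_triangle_ineq power_mono)
  also have "\<dots> \<le> 2 * (cmod (f x))\<^sup>2 + 2 * (cmod (g x))\<^sup>2"
    using sum_squares_bound[of "cmod (f x)" "cmod (g x)"] by (simp add: power2_sum)
  finally show "(cmod (f x + g x))\<^sup>2 \<le> 2 * (cmod (f x))\<^sup>2 + 2 * (cmod (g x))\<^sup>2" .
qed auto

lemma square_summable_cmult:
  "square_summable f \<Longrightarrow> square_summable (\<lambda>x. c * f x)"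
  unfolding square_summable_def norm_mult power_mult_distrib by (rule summable_on_cmult_right)

lemma square_summable_cong_norm:
  assumes "square_summable f" "\<And>x. cmod (g x) \<le> cmod (f x)"
  shows "square_summable g"
  using assms(1) unfolding square_summable_def
  by (rule summable_on_comparison_test) (use assms(2) in \<open>auto intro: power_mono\<close>)

lemma square_summable_inj:
  assumes "square_summable f" "inj j"
  shows "square_summable (\<lambda>x. f (j x))"
proof -
  have "(\<lambda>x. (cmod (f x))\<^sup>2) summable_on range j"
    using assms(1) unfolding square_summable_def by (rule summable_on_subset) auto
  then show ?thesis
    unfolding square_summable_def
    by (subst (asm) summable_on_reindex) (use assms(2) in \<open>auto simp: o_def\<close>)
qed

text \<open>The type classes used below supply the real structure only: \<open>inner\<close> is the
  real part of the complex inner product \<open>cip\<close>, and complex scalars act through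
  \<open>cscale\<close>.\<close>

typedef 'a ell2 = "{f :: 'a \<Rightarrow> complex. square_summable f}"
  morphisms coord Ell2
  by (rule exI[of _ "\<lambda>_. 0"]) (simp add: square_summable_def)

lemma square_summable_coord [simp]: "square_summable (coord a)"
  using coord[of a] by simp

lemma coord_Ell2 [simp]: "square_summable f \<Longrightarrow> coord (Ell2 f) = f"
  by (simp add: Ell2_inverse)

lemma ell2_eqI: "(\<And>x. coord a x = coord b x) \<Longrightarrow> a = b"
  by (rule coord_inject[THEN iffD1]) (rule ext)

definition cscale :: "complex \<Rightarrow> 'a ell2 \<Rightarrow> 'a ell2" where
  "cscale c a = Ell2 (\<lambda>x. c * coord a x)"

lemma coord_cscale [simp]: "coord (cscale c a) x = c * coord a x"
  unfolding cscale_def by (subst coord_Ell2) (auto intro: square_summable_cmult)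

lemma summable_inner_ell2: "(\<lambda>x. Re (coord a x * cnj (coord b x))) summable_on UNIV"
proof -
  have "(\<lambda>x. coord a x * cnj (coord b x)) summable_on UNIV"
    by (rule abs_summable_summable[OF square_summable_prod])
      (auto intro: square_summable_cong_norm[OF square_summable_coord[of b]])
  then show ?thesis by (rule summable_on_Re)
qed

instantiation ell2 :: (type) real_inner
begin

definition "0 = Ell2 (\<lambda>_. 0)"
definition "a + b = Ell2 (\<lambda>x. coord a x + coord b x)"
definition "- a = Ell2 (\<lambda>x. - coord a x)"
definition "a - b = Ell2 (\<lambda>x. coord a x - coord b x)"
definition "r *\<^sub>R a = Ell2 (\<lambda>x. r *\<^sub>R coord a x)"
definition "inner a b = (\<Sum>\<^sub>\<infinity>x. Re (coord a x * cnj (coord b x)))"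
definition "norm a = sqrt (inner a (a :: 'a ell2))"
definition "dist a b = norm (a - b :: 'a ell2)"
definition "sgn a = inverse (norm a) *\<^sub>R (a :: 'a ell2)"
definition [code del]:
  "(uniformity :: ('a ell2 \<times> 'a ell2) filter) = (INF e\<in>{0 <..}. principal {(x, y). dist x y < e})"
definition [code del]:
  "open (U :: 'a ell2 set) \<longleftrightarrow> (\<forall>x\<in>U. eventually (\<lambda>(x', y). x' = x \<longrightarrow> y \<in> U) uniformity)"

lemma coord_zero: "coord (0 :: 'a ell2) = (\<lambda>_. 0)"
  unfolding zero_ell2_def by (rule coord_Ell2) (simp add: square_summable_def)

lemma coord_add: "coord (a + b :: 'a ell2) = (\<lambda>x. coord a x + coord b x)"
  unfolding plus_ell2_def by (intro coord_Ell2 square_summable_add square_summable_coord)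

lemma coord_uminus: "coord (- a :: 'a ell2) = (\<lambda>x. - coord a x)"
  unfolding uminus_ell2_def
  by (intro coord_Ell2 square_summable_cong_norm[OF square_summable_coord[of a]]) simp

lemma coord_minus: "coord (a - b :: 'a ell2) = (\<lambda>x. coord a x - coord b x)"
  using coord_add[of a "- b"] unfolding minus_ell2_def plus_ell2_def coord_uminus by simp

lemma coord_scaleR: "coord (r *\<^sub>R a :: 'a ell2) = (\<lambda>x. r *\<^sub>R coord a x)"
  unfolding scaleR_ell2_def scaleR_conv_of_real
  by (intro coord_Ell2 square_summable_cmult square_summable_coord)

instance
proof
  fix a b c :: "'a ell2" and r s :: real
  note [simp] = coord_zero coord_add coord_uminus coord_minus coord_scaleR
  show "a + b + c = a + (b + c)" by (intro ell2_eqI) simp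
  show "a + b = b + a" by (intro ell2_eqI) simp
  show "0 + a = a" by (intro ell2_eqI) simp
  show "- a + a = 0" by (intro ell2_eqI) simp
  show "a - b = a + - b" by (intro ell2_eqI) simp
  show "r *\<^sub>R (a + b) = r *\<^sub>R a + r *\<^sub>R b" by (intro ell2_eqI) (simp add: algebra_simps)
  show "(r + s) *\<^sub>R a = r *\<^sub>R a + s *\<^sub>R a" by (intro ell2_eqI) (simp add: algebra_simps)
  show "r *\<^sub>R s *\<^sub>R a = (r * s) *\<^sub>R a" by (intro ell2_eqI) simp
  show "1 *\<^sub>R a = a" by (intro ell2_eqI) simp
  show "dist a b = norm (a - b)" by (simp add: dist_ell2_def)
  show "sgn a = inverse (norm a) *\<^sub>R a" by (simp add: sgn_ell2_def)
  show "(uniformity :: ('a ell2 \<times> 'a ell2) filter) = (INF e\<in>{0 <..}. principal {(x, y). dist x y < e})"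
    by (simp add: uniformity_ell2_def)
  show "open U \<longleftrightarrow> (\<forall>x\<in>U. eventually (\<lambda>(x', y). x' = x \<longrightarrow> y \<in> U) uniformity)" for U :: "'a ell2 set"
    by (simp add: open_ell2_def)
  show "inner a b = inner b a"
    unfolding inner_ell2_def by (rule infsum_cong) simp
  show "inner (a + b) c = inner a c + inner b c"
    unfolding inner_ell2_def coord_add ring_distribs plus_complex.sel
    by (intro infsum_add summable_inner_ell2)
  show "inner (r *\<^sub>R a) b = r * inner a b"
  proof -
    have "Re (r *\<^sub>R coord a x * cnj (coord b x)) = r * Re (coord a x * cnj (coord b x))" for x
      by simp
    then show ?thesis
      unfolding inner_ell2_def coord_scaleR by (simp only: infsum_cmult_right')
  qed
  have *: "Re (coord a x * cnj (coord a x)) = (cmod (coord a x))\<^sup>2" for x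
    by (simp only: complex_norm_square[symmetric] Re_complex_of_real)
  show "0 \<le> inner a a"
    unfolding inner_ell2_def * by (rule infsum_nonneg) simp
  show "inner a a = 0 \<longleftrightarrow> a = 0"
  proof
    assume "inner a a = 0"
    then have "(cmod (coord a x))\<^sup>2 = 0" for x
      using summable_inner_ell2[of a a] nonneg_infsum_le_0D[of "\<lambda>x. (cmod (coord a x))\<^sup>2" UNIV x]
      unfolding inner_ell2_def * by simp
    then show "a = 0" by (intro ell2_eqI) simp
  qed (simp add: inner_ell2_def)
  show "norm a = sqrt (inner a a)" by (simp add: norm_ell2_def)
qed

end

lemmas coord_ell2_simps [simp] = coord_zero coord_add coord_uminus coord_minus coord_scaleR

lemma coord_sum [simp]: "coord (sum f A) x = (\<Sum>i\<in>A. coord (f i) x)"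
  by (induction A rule: infinite_finite_induct) auto

lemma norm_ell2_sq: "(norm (a :: 'a ell2))\<^sup>2 = (\<Sum>\<^sub>\<infinity>x. (cmod (coord a x))\<^sup>2)"
proof -
  have "Re (coord a x * cnj (coord a x)) = (cmod (coord a x))\<^sup>2" for x
    by (simp only: complex_norm_square[symmetric] Re_complex_of_real)
  then show ?thesis
    by (simp add: power2_norm_eq_inner inner_ell2_def)
qed

lemma summable_norm_sq: "(\<lambda>x. (cmod (coord a x))\<^sup>2) summable_on A"
  using square_summable_coord[of a] unfolding square_summable_def by (rule summable_on_subset) auto

lemma infsum_norm_sq_le: "(\<Sum>\<^sub>\<infinity>x\<in>A. (cmod (coord a x))\<^sup>2) \<le> (norm a)\<^sup>2"
  unfolding norm_ell2_sq by (rule infsum_mono_neutral) (auto intro: summable_norm_sq)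

lemma sum_norm_sq_le: "(\<Sum>x\<in>A. (cmod (coord a x))\<^sup>2) \<le> (norm a)\<^sup>2"
proof (cases "finite A")
  case True
  then show ?thesis using infsum_norm_sq_le[of a A] by simp
qed simp

lemma coord_le_norm: "cmod (coord a x) \<le> norm a"
  using sum_norm_sq_le[of a "{x}"] by (simp add: power2_le_iff_abs_le)

lemma square_summableI_finite:
  assumes "\<And>F. finite F \<Longrightarrow> (\<Sum>x\<in>F. (cmod (f x))\<^sup>2) \<le> K"
  shows "square_summable f"
  unfolding square_summable_def
  by (rule nonneg_bdd_above_summable_on) (use assms in \<open>auto intro!: bdd_aboveI[of _ K]\<close>)

lemma norm_ell2_le_finite:
  assumes "\<And>F. finite F \<Longrightarrow> (\<Sum>x\<in>F. (cmod (coord a x))\<^sup>2) \<le> K\<^sup>2" "0 \<le> K"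
  shows "norm a \<le> K"
proof -
  have "(norm a)\<^sup>2 \<le> K\<^sup>2"
    unfolding norm_ell2_sq by (rule infsum_le_finite_sums) (use assms in \<open>auto intro: summable_norm_sq\<close>)
  then show ?thesis using assms(2) by (simp add: power2_le_iff_abs_le)
qed

text \<open>Passing to the moduli, cut off outside A, removes phases and the set A, so that the real
  Cauchy-Schwarz inequality of the type \<open>ell2\<close> applies.\<close>

lemma Cauchy_Schwarz_infsum:
  assumes "square_summable f" "square_summable g"
  shows "(cmod (\<Sum>\<^sub>\<infinity>x\<in>A. f x * g x))\<^sup>2 \<le> (\<Sum>\<^sub>\<infinity>x\<in>A. (cmod (f x))\<^sup>2) * (\<Sum>\<^sub>\<infinity>x\<in>A. (cmod (g x))\<^sup>2)"
proof -
  define a where "a = Ell2 (\<lambda>x. if x \<in> A then of_real (cmod (f x)) else 0)"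
  define b where "b = Ell2 (\<lambda>x. if x \<in> A then of_real (cmod (g x)) else 0)"
  have a: "coord a = (\<lambda>x. if x \<in> A then of_real (cmod (f x)) else 0)"
    unfolding a_def by (intro coord_Ell2 square_summable_cong_norm[OF assms(1)]) auto
  have b: "coord b = (\<lambda>x. if x \<in> A then of_real (cmod (g x)) else 0)"
    unfolding b_def by (intro coord_Ell2 square_summable_cong_norm[OF assms(2)]) auto
  have "(\<lambda>x. cmod (f x * g x)) summable_on A"
    by (rule summable_on_subset[OF square_summable_prod[OF assms]]) auto
  then have "cmod (\<Sum>\<^sub>\<infinity>x\<in>A. f x * g x) \<le> (\<Sum>\<^sub>\<infinity>x\<in>A. cmod (f x * g x))"
    by (rule norm_infsum_bound)
  also have "\<dots> = inner a b"
    unfolding inner_ell2_def by (rule infsum_cong_neutral) (auto simp: a b norm_mult)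
  also have "\<dots> \<le> norm a * norm b" by (rule norm_cauchy_schwarz)
  finally have "(cmod (\<Sum>\<^sub>\<infinity>x\<in>A. f x * g x))\<^sup>2 \<le> (norm a)\<^sup>2 * (norm b)\<^sup>2"
    unfolding power_mult_distrib[symmetric] by (intro power_mono) auto
  also have "(norm a)\<^sup>2 = (\<Sum>\<^sub>\<infinity>x\<in>A. (cmod (f x))\<^sup>2)"
    unfolding norm_ell2_sq by (rule infsum_cong_neutral) (auto simp: a)
  also have "(norm b)\<^sup>2 = (\<Sum>\<^sub>\<infinity>x\<in>A. (cmod (g x))\<^sup>2)"
    unfolding norm_ell2_sq by (rule infsum_cong_neutral) (auto simp: b)
  finally show ?thesis .
qed

instance ell2 :: (type) complete_space
proof
  fix X :: "nat \<Rightarrow> 'a ell2"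
  assume X: "Cauchy X"
  have "Cauchy (\<lambda>n. coord (X n) x)" for x
  proof (rule CauchyI)
    fix e :: real assume "0 < e"
    then obtain M where "\<forall>m\<ge>M. \<forall>n\<ge>M. norm (X m - X n) < e"
      using X by (auto simp: Cauchy_iff)
    then show "\<exists>M. \<forall>m\<ge>M. \<forall>n\<ge>M. norm (coord (X m) x - coord (X n) x) < e"
      by (metis coord_le_norm coord_minus le_less_trans)
  qed
  then have lim: "(\<lambda>n. coord (X n) x) \<longlonglongrightarrow> lim (\<lambda>n. coord (X n) x)" for x
    by (simp add: Cauchy_convergent_iff convergent_LIMSEQ_iff)
  define l where "l x = lim (\<lambda>n. coord (X n) x)" for x
  note lim = lim[folded l_def]
  \<comment> \<open>The bound is uniform over finite index sets F, where the limit in n passes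
    through the sum; it controls the full norm afterwards.\<close>
  have tail: "\<exists>M. \<forall>m\<ge>M. \<forall>F. finite F \<longrightarrow> (\<Sum>x\<in>F. (cmod (l x - coord (X m) x))\<^sup>2) \<le> e\<^sup>2" if e: "0 < e" for e
  proof -
    obtain M where M: "\<forall>m\<ge>M. \<forall>n\<ge>M. norm (X n - X m) < e"
      using X e unfolding Cauchy_iff by blast
    have "(\<Sum>x\<in>F. (cmod (l x - coord (X m) x))\<^sup>2) \<le> e\<^sup>2" if "m \<ge> M" "finite F" for m F
    proof (rule tendsto_upperbound)
      show "(\<lambda>n. \<Sum>x\<in>F. (cmod (coord (X n) x - coord (X m) x))\<^sup>2)
          \<longlonglongrightarrow> (\<Sum>x\<in>F. (cmod (l x - coord (X m) x))\<^sup>2)"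
        by (intro tendsto_intros lim)
      show "\<forall>\<^sub>F n in sequentially. (\<Sum>x\<in>F. (cmod (coord (X n) x - coord (X m) x))\<^sup>2) \<le> e\<^sup>2"
        unfolding eventually_sequentially
      proof (intro exI allI impI)
        fix n assume "M \<le> n"
        have "(\<Sum>x\<in>F. (cmod (coord (X n) x - coord (X m) x))\<^sup>2) \<le> (norm (X n - X m))\<^sup>2"
          using sum_norm_sq_le[of "X n - X m" F] by simp
        also have "\<dots> \<le> e\<^sup>2"
          using M that(1) \<open>M \<le> n\<close> by (intro power_mono) (auto intro: less_imp_le)
        finally show "(\<Sum>x\<in>F. (cmod (coord (X n) x - coord (X m) x))\<^sup>2) \<le> e\<^sup>2" .
      qed
    qed simp
    then show ?thesis by blast
  qed
  have "square_summable l"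
  proof -
    obtain M where "\<forall>m\<ge>M. \<forall>F. finite F \<longrightarrow> (\<Sum>x\<in>F. (cmod (l x - coord (X m) x))\<^sup>2) \<le> 1\<^sup>2"
      using tail[of 1] by auto
    then have "square_summable (\<lambda>x. l x - coord (X M) x)"
      by (intro square_summableI_finite[where K = "1\<^sup>2"]) auto
    from square_summable_add[OF this square_summable_coord[of "X M"]] show ?thesis by simp
  qed
  then have l: "coord (Ell2 l) = l" by simp
  have "X \<longlonglongrightarrow> Ell2 l"
  proof (rule LIMSEQ_I)
    fix e :: real assume "0 < e"
    then obtain M where M: "\<forall>m\<ge>M. \<forall>F. finite F \<longrightarrow> (\<Sum>x\<in>F. (cmod (l x - coord (X m) x))\<^sup>2) \<le> (e/2)\<^sup>2"
      using tail[of "e/2"] by auto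
    have "norm (X m - Ell2 l) < e" if "m \<ge> M" for m
    proof -
      have "norm (Ell2 l - X m) \<le> e/2"
        using M that \<open>0 < e\<close> by (intro norm_ell2_le_finite) (auto simp: l)
      then show ?thesis using \<open>0 < e\<close> by (simp add: norm_minus_commute)
    qed
    then show "\<exists>no. \<forall>n\<ge>no. norm (X n - Ell2 l) < e" by blast
  qed
  then show "convergent X" by (auto simp: convergent_def)
qed

section \<open>Unit vectors, the complex inner product and density\<close>

definition unit :: "'a \<Rightarrow> 'a ell2" where
  "unit y = Ell2 (\<lambda>x. if x = y then 1 else 0)"

lemma coord_unit [simp]: "coord (unit y) x = (if x = y then 1 else 0)"
proof -
  have "square_summable (\<lambda>x. if x = y then 1 else 0)"
    unfolding square_summable_def
    by (rule finite_nonzero_values_imp_summable_on) (auto intro: finite_subset[of _ "{y}"])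
  then show ?thesis by (simp add: unit_def)
qed

definition cip :: "'a ell2 \<Rightarrow> 'a ell2 \<Rightarrow> complex" where
  "cip a b = (\<Sum>\<^sub>\<infinity>x. coord a x * cnj (coord b x))"

lemma summable_cip: "(\<lambda>x. coord a x * cnj (coord b x)) summable_on UNIV"
  by (rule abs_summable_summable[OF square_summable_prod])
    (auto intro: square_summable_cong_norm[OF square_summable_coord[of b]])

lemma Re_cip: "Re (cip a b) = inner a b"
  unfolding cip_def inner_ell2_def by (rule infsum_Re[symmetric, OF summable_cip])

lemma cip_add_left: "cip (a + b) c = cip a c + cip b c"
  unfolding cip_def by (simp add: distrib_right infsum_add summable_cip)

lemma cip_cscale_left: "cip (cscale z a) c = z * cip a c"
  unfolding cip_def by (simp add: mult.assoc infsum_cmult_right')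

lemma cip_zero_left [simp]: "cip 0 a = 0" and cip_zero_right [simp]: "cip a 0 = 0"
  by (simp_all add: cip_def)

lemma cnj_cip: "cnj (cip a b) = cip b a"
  unfolding cip_def infsum_cnj[symmetric] by (simp add: mult.commute)

lemma norm_cip_le: "cmod (cip a b) \<le> norm a * norm b"
proof -
  have "square_summable (\<lambda>x. cnj (coord b x))"
    by (rule square_summable_cong_norm[OF square_summable_coord[of b]]) simp
  then have "(cmod (cip a b))\<^sup>2 \<le> (norm a)\<^sup>2 * (norm b)\<^sup>2"
    using Cauchy_Schwarz_infsum[of "coord a" "\<lambda>w. cnj (coord b w)" UNIV]
    by (simp add: cip_def norm_ell2_sq)
  then show ?thesis by (simp add: power_mult_distrib[symmetric] power2_le_iff_abs_le)
qed

definition supported_in :: "'a set \<Rightarrow> 'a ell2 \<Rightarrow> bool" where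
  "supported_in S a \<longleftrightarrow> (\<forall>x. x \<notin> S \<longrightarrow> coord a x = 0)"

lemma ell2_approx:
  fixes a :: "'a ell2"
  assumes "e > 0"
  obtains F where "finite F" "norm (a - (\<Sum>x\<in>F. cscale (coord a x) (unit x))) \<le> e"
proof -
  have "((\<lambda>x. (cmod (coord a x))\<^sup>2) has_sum (norm a)\<^sup>2) UNIV"
    unfolding norm_ell2_sq by (rule has_sum_infsum[OF summable_norm_sq])
  from has_sum_finite_approximation[OF this, of "e\<^sup>2"] assms
  obtain F where F: "finite F" "dist (\<Sum>x\<in>F. (cmod (coord a x))\<^sup>2) ((norm a)\<^sup>2) \<le> e\<^sup>2"
    by auto
  define v where "v = (\<Sum>x\<in>F. cscale (coord a x) (unit x))"
  have cv: "coord v y = (if y \<in> F then coord a y else 0)" for y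
    using F(1) by (simp add: v_def if_distrib cong: if_cong)
  have "norm (a - v) \<le> e"
  proof (rule norm_ell2_le_finite)
    fix G :: "'a set" assume G: "finite G"
    have "(\<Sum>x\<in>G. (cmod (coord (a - v) x))\<^sup>2) = (\<Sum>x\<in>G - F. (cmod (coord a x))\<^sup>2)"
      by (rule sum.mono_neutral_cong_right) (use G in \<open>auto simp: cv\<close>)
    also have "\<dots> = (\<Sum>x\<in>G \<union> F. (cmod (coord a x))\<^sup>2) - (\<Sum>x\<in>F. (cmod (coord a x))\<^sup>2)"
      using sum.subset_diff[of F "G \<union> F" "\<lambda>x. (cmod (coord a x))\<^sup>2"] G F(1)
      by (simp add: Un_Diff)
    also have "\<dots> \<le> (norm a)\<^sup>2 - (\<Sum>x\<in>F. (cmod (coord a x))\<^sup>2)"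
      by (simp add: sum_norm_sq_le)
    also have "\<dots> \<le> e\<^sup>2"
      using F(2) by (simp add: dist_real_def abs_if split: if_splits)
    finally show "(\<Sum>x\<in>G. (cmod (coord (a - v) x))\<^sup>2) \<le> e\<^sup>2" .
  qed (use assms in auto)
  with F(1) show ?thesis using that unfolding v_def by blast
qed

text \<open>The density principle behind all extensions from words to vectors. Scalars are built
  into the hypothesis on unit vectors, so only additivity is asked of \<open>\<Phi>\<close>; the set
  S allows maps that are controlled only on vectors of bounded degree.\<close>

lemma additive_bounded_eq_0:
  fixes \<Phi> :: "'a ell2 \<Rightarrow> 'b :: real_normed_vector"
  assumes add: "\<And>a b. supported_in S a \<Longrightarrow> supported_in S b \<Longrightarrow> \<Phi> (a + b) = \<Phi> a + \<Phi> b"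
    and bdd: "\<And>a. supported_in S a \<Longrightarrow> norm (\<Phi> a) \<le> K * norm a"
    and unit: "\<And>x c. x \<in> S \<Longrightarrow> \<Phi> (cscale c (unit x)) = 0"
    and a: "supported_in S a"
  shows "\<Phi> a = 0"
proof (rule ccontr)
  assume "\<Phi> a \<noteq> 0"
  \<comment> \<open>The term \<open>\<bar>K\<bar> + 1\<close> is positive for every K, and the
    factor 2 leads to the contradiction that the norm is at most half of itself.\<close>
  define e where "e = norm (\<Phi> a) / (2 * (\<bar>K\<bar> + 1))"
  have "e > 0" using \<open>\<Phi> a \<noteq> 0\<close> by (simp add: e_def)
  obtain F where F: "finite F" "norm (a - (\<Sum>x\<in>F. cscale (coord a x) (unit x))) \<le> e"
    by (rule ell2_approx[OF \<open>e > 0\<close>, of a])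
  define v where "v = (\<lambda>F. \<Sum>x\<in>F. cscale (coord a x) (unit x))"
  have sup: "supported_in S (cscale (coord a x) (unit x))" for x
    using a by (auto simp: supported_in_def)
  then have supv: "supported_in S (v G)" for G
    unfolding v_def supported_in_def coord_sum by (intro allI impI sum.neutral) blast
  have "\<Phi> 0 = 0" using add[of 0 0] by (simp add: supported_in_def)
  have *: "\<Phi> (cscale (coord a x) (unit x)) = 0" for x
  proof (cases "x \<in> S")
    case False
    then have "cscale (coord a x) (unit x) = 0" using a by (intro ell2_eqI) (simp add: supported_in_def)
    then show ?thesis using \<open>\<Phi> 0 = 0\<close> by simp
  qed (rule unit)
  have "\<Phi> (v F) = 0"
    using F(1)
  proof induction
    case empty
    then show ?case using \<open>\<Phi> 0 = 0\<close> by (simp add: v_def)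
  next
    case (insert x F)
    have "v (insert x F) = cscale (coord a x) (unit x) + v F" using insert by (simp add: v_def)
    then show ?case using add[OF sup supv] insert * by simp
  qed
  have supd: "supported_in S (a - v F)" using a supv[of F] by (simp add: supported_in_def)
  have "norm (\<Phi> a) = norm (\<Phi> (a - v F) + \<Phi> (v F))"
    using add[OF supd supv[of F]] by simp
  also have "\<dots> \<le> K * norm (a - v F)" using \<open>\<Phi> (v F) = 0\<close> bdd[OF supd] by simp
  also have "\<dots> \<le> (\<bar>K\<bar> + 1) * e"
    using F(2) by (intro mult_mono) (auto simp: v_def)
  also have "\<dots> = norm (\<Phi> a) / 2"
  proof -
    have "\<bar>K\<bar> + 1 \<noteq> 0" by linarith
    then show ?thesis by (simp only: e_def times_divide_eq_right mult.commute[of 2] mult_divide_mult_cancel_left not_False_eq_True)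
  qed
  finally show False using \<open>\<Phi> a \<noteq> 0\<close> by simp
qed

lemma supported_in_UNIV [simp]: "supported_in UNIV a"
  by (simp add: supported_in_def)

section \<open>The Wick product on words\<close>

type_synonym 'i word_ell2 = "'i list ell2"

text \<open>The word c is reversed because contractions are nested: the last letter of f meets the
  first letter of a, and so on inwards.\<close>

definition contract :: "'i word_ell2 \<Rightarrow> 'i word_ell2 \<Rightarrow> 'i list \<Rightarrow> 'i list \<Rightarrow> complex" where
  "contract f a x y = (\<Sum>\<^sub>\<infinity>c. coord f (x @ c) * coord a (rev c @ y))"

text \<open>The product formula for multiple Wigner integrals in coordinates: k is the number of
  letters of w that come from the left factor, and the contraction sums over all numbers of paired
  variables.\<close>

definition wick :: "'i word_ell2 \<Rightarrow> 'i word_ell2 \<Rightarrow> 'i list \<Rightarrow> complex" where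
  "wick f a w = (\<Sum>k\<le>length w. contract f a (take k w) (drop k w))"

(* Ell2 is junk on families that are not square-summable, so wmul f a is meaningful only when one
   factor has finite degree. *)
definition wmul :: "'i word_ell2 \<Rightarrow> 'i word_ell2 \<Rightarrow> 'i word_ell2" where
  "wmul f a = Ell2 (wick f a)"

definition fin_deg :: "nat \<Rightarrow> 'i word_ell2 \<Rightarrow> bool" where
  "fin_deg N f \<longleftrightarrow> (\<forall>w. length w > N \<longrightarrow> coord f w = 0)"

lemma square_summable_append: "square_summable (\<lambda>c. coord f (x @ c))"
  by (rule square_summable_inj) (auto intro: injI)

lemma square_summable_rev_append: "square_summable (\<lambda>c. coord f (rev c @ y))"
  by (rule square_summable_inj[of "coord f" "\<lambda>c. rev c @ y"]) (auto intro: injI)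

lemma summable_contract: "(\<lambda>c. coord f (x @ c) * coord a (rev c @ y)) summable_on UNIV"
  by (rule abs_summable_summable[OF square_summable_prod[OF square_summable_append square_summable_rev_append]])

text \<open>By injectivity the slices do not overlap, so the double sum meets each coefficient of f
  at most once.\<close>

lemma sum_infsum_inj_le:
  assumes "finite X" "inj_on (\<lambda>(x, c). j x c) (X \<times> C)"
  shows "(\<Sum>x\<in>X. \<Sum>\<^sub>\<infinity>c\<in>C. (cmod (coord f (j x c)))\<^sup>2) \<le> (norm f)\<^sup>2"
proof -
  let ?g = "\<lambda>z. (cmod (coord f z))\<^sup>2"
  have "(?g \<circ> (\<lambda>(x, c). j x c)) summable_on X \<times> C"
    using summable_on_reindex[OF assms(2), of ?g] summable_norm_sq[of f] by simp
  then have s: "(\<lambda>(x, c). ?g (j x c)) summable_on X \<times> C"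
    by (simp add: o_def case_prod_unfold)
  have "(\<Sum>x\<in>X. \<Sum>\<^sub>\<infinity>c\<in>C. ?g (j x c)) = (\<Sum>\<^sub>\<infinity>x\<in>X. \<Sum>\<^sub>\<infinity>c\<in>C. ?g (j x c))"
    using assms(1) by simp
  also have "\<dots> = (\<Sum>\<^sub>\<infinity>(x, c)\<in>X \<times> C. ?g (j x c))"
    by (rule infsum_Sigma'_banach[OF s])
  also have "\<dots> = infsum ?g ((\<lambda>(x, c). j x c) ` (X \<times> C))"
    by (subst infsum_reindex[OF assms(2)]) (simp add: o_def case_prod_unfold)
  also have "\<dots> \<le> (norm f)\<^sup>2" by (rule infsum_norm_sq_le)
  finally show ?thesis .
qed

(* The part of L_f with k creation and m annihilation operators. For fixed k and m the splitting of
   the words is unique, so its norm is at most the Hilbert-Schmidt norm of f. *)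
definition wick_part :: "nat \<Rightarrow> nat \<Rightarrow> 'i word_ell2 \<Rightarrow> 'i word_ell2 \<Rightarrow> 'i list \<Rightarrow> complex" where
  "wick_part k m f a w = (if k \<le> length w
     then \<Sum>\<^sub>\<infinity>c\<in>{c. length c = m}. coord f (take k w @ c) * coord a (rev c @ drop k w) else 0)"

lemma wick_part_bound:
  assumes F: "finite F"
  shows "(\<Sum>w\<in>F. (cmod (wick_part k m f a w))\<^sup>2) \<le> (norm f * norm a)\<^sup>2"
proof -
  define C where "C = {c :: 'a list. length c = m}"
  define G where "G = {w\<in>F. k \<le> length w}"
  define X where "X = take k ` G"
  define Y where "Y = drop k ` G"
  define al where "al x = (\<Sum>\<^sub>\<infinity>c\<in>C. (cmod (coord f (x @ c)))\<^sup>2)" for x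
  define be where "be y = (\<Sum>\<^sub>\<infinity>c\<in>C. (cmod (coord a (rev c @ y)))\<^sup>2)" for y
  have fin: "finite X" "finite Y" "finite G" using F by (auto simp: X_def Y_def G_def)
  have al0: "al x \<ge> 0" and be0: "be y \<ge> 0" for x y
    by (auto simp: al_def be_def intro!: infsum_nonneg)
  have inj: "inj_on (\<lambda>w. (take k w, drop k w)) G"
    by (rule inj_onI) (metis append_take_drop_id prod.inject)
  have "(\<Sum>w\<in>F. (cmod (wick_part k m f a w))\<^sup>2) = (\<Sum>w\<in>G. (cmod (wick_part k m f a w))\<^sup>2)"
    by (rule sum.mono_neutral_right) (use F in \<open>auto simp: G_def wick_part_def\<close>)
  also have "\<dots> \<le> (\<Sum>w\<in>G. al (take k w) * be (drop k w))"
  proof (rule sum_mono)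
    fix w assume "w \<in> G"
    then show "(cmod (wick_part k m f a w))\<^sup>2 \<le> al (take k w) * be (drop k w)"
      using Cauchy_Schwarz_infsum[OF square_summable_append square_summable_rev_append]
      by (simp add: wick_part_def G_def al_def be_def C_def)
  qed
  also have "\<dots> = (\<Sum>(x, y)\<in>(\<lambda>w. (take k w, drop k w)) ` G. al x * be y)"
    by (subst sum.reindex[OF inj]) simp
  \<comment> \<open>Enlarging the pairs that occur to a full rectangle lets the sum factor; the two
    factors are bounded separately because prefix lengths and contraction lengths are fixed.\<close>
  also have "\<dots> \<le> (\<Sum>(x, y)\<in>X \<times> Y. al x * be y)"
    by (rule sum_mono2) (use fin al0 be0 in \<open>auto simp: X_def Y_def\<close>)
  also have "\<dots> = sum al X * sum be Y"
    by (simp add: sum_product sum.cartesian_product)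
  also have "\<dots> \<le> (norm f)\<^sup>2 * (norm a)\<^sup>2"
  proof (rule mult_mono)
    show "sum al X \<le> (norm f)\<^sup>2"
      unfolding al_def by (rule sum_infsum_inj_le[OF fin(1)]) (auto simp: inj_on_def C_def X_def G_def append_eq_append_conv)
    show "sum be Y \<le> (norm a)\<^sup>2"
      unfolding be_def
      by (rule sum_infsum_inj_le[OF fin(2), where j = "\<lambda>y c. rev c @ y"]) (auto simp: inj_on_def C_def)
  qed (auto intro!: sum_nonneg be0)
  finally show ?thesis by (simp add: power_mult_distrib)
qed

lemma square_summable_wick_part: "square_summable (wick_part k m f a)"
  by (rule square_summableI_finite[OF wick_part_bound])

lemma infsum_by_length:
  assumes "f summable_on UNIV" "\<And>c. length c > N \<Longrightarrow> f c = 0"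
  shows "infsum f UNIV = (\<Sum>m\<le>N. infsum f {c :: 'i list. length c = m} :: complex)"
proof -
  have "(\<Sum>m\<le>N. infsum f {c :: 'i list. length c = m}) = infsum f (\<Union>m\<le>N. {c. length c = m})"
    by (rule sum_infsum) (use assms(1) in \<open>auto intro: summable_on_subset\<close>)
  also have "\<dots> = infsum f UNIV"
    by (rule infsum_cong_neutral) (use assms(2) in \<open>auto simp: not_le[symmetric]\<close>)
  finally show ?thesis by simp
qed

text \<open>Degree at most N kills the parts with k > N or m > N, and \<open>wick_part\<close> is 0
  by convention for k beyond the length of w. The ranges thus become independent of w.\<close>

lemma wick_eq_parts:
  assumes "fin_deg N f"
  shows "wick f a w = (\<Sum>k\<le>N. \<Sum>m\<le>N. wick_part k m f a w)"
proof -
  have c: "contract f a (take k w) (drop k w) = (\<Sum>m\<le>N. wick_part k m f a w)" if "k \<le> length w" for k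
    unfolding contract_def
    by (subst infsum_by_length[OF summable_contract, of N])
      (use assms that in \<open>auto simp: fin_deg_def wick_part_def\<close>)
  have z: "(\<Sum>m\<le>N. wick_part k m f a w) = 0" if "k > N" "k \<le> length w" for k
    using assms that by (auto simp: fin_deg_def wick_part_def intro!: sum.neutral infsum_0)
  then have z': "k \<le> N" if "(\<Sum>m\<le>N. wick_part k m f a w) \<noteq> 0" "k \<le> length w" for k
    using that by (meson not_le)
  have "wick f a w = (\<Sum>k\<le>length w. \<Sum>m\<le>N. wick_part k m f a w)"
    unfolding wick_def by (rule sum.cong) (auto simp: c)
  also have "\<dots> = (\<Sum>k | k \<le> N \<and> k \<le> length w. \<Sum>m\<le>N. wick_part k m f a w)"
    by (rule sum.mono_neutral_right) (auto dest: z')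
  also have "\<dots> = (\<Sum>k\<le>N. \<Sum>m\<le>N. wick_part k m f a w)"
    by (rule sum.mono_neutral_left) (auto simp: wick_part_def)
  finally show ?thesis .
qed

text \<open>The family \<open>wick f a\<close> is exhibited as the coordinates of a finite sum of
  genuine vectors; this makes the use of \<open>Ell2\<close> in \<open>wmul\<close>
  legitimate.\<close>

lemma wmul_eq_parts:
  assumes "fin_deg N f"
  shows "wmul f a = (\<Sum>k\<le>N. \<Sum>m\<le>N. Ell2 (wick_part k m f a))"
    and "coord (wmul f a) = wick f a"
proof -
  have *: "coord (\<Sum>k\<le>N. \<Sum>m\<le>N. Ell2 (wick_part k m f a)) = wick f a"
    by (auto simp: wick_eq_parts[OF assms] square_summable_wick_part)
  show "coord (wmul f a) = wick f a"
    unfolding wmul_def using coord[of "\<Sum>k\<le>N. \<Sum>m\<le>N. Ell2 (wick_part k m f a)"]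
    by (simp only: * coord_Ell2 mem_Collect_eq)
  then show "wmul f a = (\<Sum>k\<le>N. \<Sum>m\<le>N. Ell2 (wick_part k m f a))"
    by (intro ell2_eqI) (simp only: *)
qed

text \<open>The constant counts the parts: k and m range over N + 1 values each, and every part has
  norm at most \<open>norm f * norm a\<close>.\<close>

lemma norm_wmul_le:
  assumes "fin_deg N f"
  shows "norm (wmul f a) \<le> (real N + 1)\<^sup>2 * norm f * norm a"
proof -
  have p: "norm (Ell2 (wick_part k m f a)) \<le> norm f * norm a" for k m
    by (rule norm_ell2_le_finite) (simp_all add: square_summable_wick_part wick_part_bound)
  have "norm (wmul f a) \<le> (\<Sum>k\<le>N. \<Sum>m\<le>N. norm f * norm a)"
    unfolding wmul_eq_parts(1)[OF assms] by (intro sum_norm_le p)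
  then show ?thesis by (simp add: power2_eq_square algebra_simps)
qed

section \<open>Reversal and conjugation; products with a right factor of finite degree\<close>

definition flip :: "'i word_ell2 \<Rightarrow> 'i word_ell2" where
  "flip a = Ell2 (\<lambda>w. coord a (rev w))"

definition conj_vec :: "'i word_ell2 \<Rightarrow> 'i word_ell2" where
  "conj_vec a = Ell2 (\<lambda>w. cnj (coord a w))"

lemma coord_flip [simp]: "coord (flip a) w = coord a (rev w)"
  unfolding flip_def using square_summable_inj[of "coord a" rev] by (simp add: inj_on_def)

lemma coord_conj_vec [simp]: "coord (conj_vec a) w = cnj (coord a w)"
  unfolding conj_vec_def using square_summable_cong_norm[of "coord a" "\<lambda>w. cnj (coord a w)"] by simp

lemma norm_flip [simp]: "norm (flip a) = norm a"
proof -
  have "bij (rev :: 'a list \<Rightarrow> 'a list)" by (rule o_bij[of rev]) auto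
  then have "(norm (flip a))\<^sup>2 = (norm a)\<^sup>2"
    unfolding norm_ell2_sq by (simp add: infsum_reindex_bij_betw[of rev UNIV UNIV "\<lambda>w. (cmod (coord a w))\<^sup>2"])
  then show ?thesis by simp
qed

lemma flip_flip [simp]: "flip (flip a) = a"
  by (intro ell2_eqI) simp

lemma fin_deg_flip [simp]: "fin_deg N (flip a) = fin_deg N a"
  unfolding fin_deg_def by (metis coord_flip length_rev rev_rev_ident)

lemma fin_deg_conj_vec [simp]: "fin_deg N (conj_vec a) = fin_deg N a"
  by (simp add: fin_deg_def)

lemma contract_flip: "contract (flip a) (flip f) (rev y) (rev x) = contract f a x y"
  unfolding contract_def by (simp add: mult.commute)

text \<open>Reversal is an anti-automorphism: the split at k becomes the split at
  \<open>length w - k\<close> with the factors exchanged. It converts every statement on left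
  multiplication into one on right multiplication.\<close>

lemma wick_flip: "wick (flip a) (flip f) (rev w) = wick f a w"
proof -
  have "wick (flip a) (flip f) (rev w) = (\<Sum>k\<le>length w. contract f a (take (length w - k) w) (drop (length w - k) w))"
    unfolding wick_def length_rev by (rule sum.cong) (simp_all add: take_rev drop_rev contract_flip)
  also have "\<dots> = wick f a w"
    unfolding wick_def
    by (rule sum.reindex_bij_witness[of _ "\<lambda>k. length w - k" "\<lambda>k. length w - k"]) auto
  finally show ?thesis .
qed

lemma wick_conj_vec: "wick (conj_vec f) (conj_vec a) w = cnj (wick f a w)"
  by (simp add: wick_def contract_def flip: infsum_cnj)

lemma wick_flip': "wick f a = (\<lambda>w. wick (flip a) (flip f) (rev w))"
  by (simp add: wick_flip)

lemma wmul_right: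
  assumes "fin_deg N f"
  shows "wmul a f = flip (wmul (flip f) (flip a))" "coord (wmul a f) = wick a f"
proof -
  have *: "coord (flip (wmul (flip f) (flip a))) = wick a f"
    using assms by (auto simp: wmul_eq_parts(2) wick_flip)
  show "coord (wmul a f) = wick a f"
    unfolding wmul_def using coord[of "flip (wmul (flip f) (flip a))"]
    by (simp only: * coord_Ell2 mem_Collect_eq)
  then show "wmul a f = flip (wmul (flip f) (flip a))"
    by (intro ell2_eqI) (simp only: *)
qed

lemma norm_wmul_right_le:
  assumes "fin_deg N f"
  shows "norm (wmul a f) \<le> (real N + 1)\<^sup>2 * norm f * norm a"
  using norm_wmul_le[of N "flip f" "flip a"] assms by (simp add: wmul_right(1)[OF assms])

lemma contract_add_left: "contract (f + g) a x y = contract f a x y + contract g a x y"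
  unfolding contract_def by (simp add: distrib_right infsum_add summable_contract)

lemma contract_add_right: "contract f (a + b) x y = contract f a x y + contract f b x y"
  unfolding contract_def by (simp add: distrib_left infsum_add summable_contract)

lemma contract_cscale_left: "contract (cscale c f) a x y = c * contract f a x y"
  unfolding contract_def by (simp add: mult.assoc infsum_cmult_right')

lemma contract_cscale_right: "contract f (cscale c a) x y = c * contract f a x y"
  unfolding contract_def by (simp add: mult.left_commute infsum_cmult_right')

lemma wick_add_left: "wick (f + g) a w = wick f a w + wick g a w"
  and wick_add_right: "wick f (a + b) w = wick f a w + wick f b w"
  and wick_cscale_left: "wick (cscale c f) a w = c * wick f a w"
  and wick_cscale_right: "wick f (cscale c a) w = c * wick f a w"
  by (simp_all add: wick_def contract_add_left contract_add_right contract_cscale_left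
      contract_cscale_right sum.distrib sum_distrib_left)

lemma cscale_of_real: "cscale (of_real r) a = r *\<^sub>R a"
  by (intro ell2_eqI) (simp add: scaleR_conv_of_real)

lemma cscale_minus_one: "cscale (-1) a = - a"
  by (intro ell2_eqI) simp

lemma wick_zero_left [simp]: "wick 0 a w = 0" and wick_zero_right [simp]: "wick f 0 w = 0"
  by (simp_all add: wick_def contract_def)

lemma wick_snoc:
  "wick f a (w @ [i]) = (\<Sum>k\<le>length w. contract f a (take k w) (drop k w @ [i])) + contract f a (w @ [i]) []"
  by (simp add: wick_def)

section \<open>Letters and right multiplication by them\<close>

definition letter :: "'i \<Rightarrow> 'i word_ell2" where "letter i = unit [i]"

lemma fin_deg_letter [simp]: "fin_deg (Suc 0) (letter i)"
  by (simp add: fin_deg_def letter_def)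

lemma fin_deg_unit [simp]: "fin_deg (length w) (unit w)"
  by (auto simp: fin_deg_def)

lemma infsum_single:
  assumes "\<And>x. x \<noteq> i \<Longrightarrow> f x = 0"
  shows "infsum f UNIV = (f i :: complex)"
  using infsum_cong_neutral[of "{i}" UNIV f f] assms by auto

lemma contract_letter:
  "contract a (letter i) x y = (if y = [i] then coord a x else if y = [] then coord a (x @ [i]) else 0)"
proof -
  have *: "rev c @ y = [i] \<longleftrightarrow> c = [] \<and> y = [i] \<or> c = [i] \<and> y = []" for c
    by (cases c) (auto simp: append_eq_Cons_conv)
  consider "y = [i]" | "y = []" | "y \<noteq> [i]" "y \<noteq> []" by blast
  then show ?thesis
  proof cases
    case 1
    then show ?thesis unfolding contract_def letter_def
      by (subst infsum_single[of "[]"]) (auto simp: *)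
  next
    case 2
    then show ?thesis unfolding contract_def letter_def
      by (subst infsum_single[of "[i]"]) (auto simp: *)
  next
    case 3
    then show ?thesis unfolding contract_def letter_def by (auto simp: * intro!: infsum_0)
  qed
qed

lemma wick_letter:
  "wick a (letter i) w = coord a (w @ [i]) + (if w \<noteq> [] \<and> last w = i then coord a (butlast w) else 0)"
proof -
  have 1: "drop k w = [i] \<longleftrightarrow> k = length w - 1 \<and> w \<noteq> [] \<and> last w = i" if "k \<le> length w" for k
  proof
    assume d: "drop k w = [i]"
    then have "length w - k = 1" by (metis One_nat_def length_Cons length_drop list.size(3))
    moreover have "w \<noteq> []" using d by auto
    moreover have "last w = i" using d by (metis append_take_drop_id last_snoc)
    ultimately show "k = length w - 1 \<and> w \<noteq> [] \<and> last w = i" using that by simp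
  next
    assume "k = length w - 1 \<and> w \<noteq> [] \<and> last w = i"
    then show "drop k w = [i]"
      by (metis append_butlast_last_id append_eq_conv_conj length_butlast)
  qed
  have "wick a (letter i) w = (\<Sum>k\<le>length w. (if k = length w - 1 \<and> w \<noteq> [] \<and> last w = i then coord a (take k w) else 0)
      + (if k = length w then coord a (w @ [i]) else 0))"
    unfolding wick_def contract_letter
    by (rule sum.cong) (auto simp: 1 simp flip: length_greater_0_conv)
  also have "\<dots> = (if w \<noteq> [] \<and> last w = i then coord a (take (length w - 1) w) else 0) + coord a (w @ [i])"
    by (auto simp: sum.distrib)
  finally show ?thesis by (simp add: butlast_conv_take)
qed

text \<open>The right-handed counterpart of X(e_i): right creation plus right annihilation by the
  i-th basis vector.\<close>

definition Rop :: "'i \<Rightarrow> 'i word_ell2 \<Rightarrow> 'i word_ell2" where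
  "Rop i a = wmul a (letter i)"

lemma coord_Rop: "coord (Rop i a) w = coord a (w @ [i]) + (if w \<noteq> [] \<and> last w = i then coord a (butlast w) else 0)"
  unfolding Rop_def by (simp add: wmul_right(2)[OF fin_deg_letter] wick_letter)

text \<open>If y is empty, the letter i removed by the creation part can only come from the
  contracted word, so c = i # d. Moving i from c to the end of x gives the boundary term.\<close>

lemma contract_Rop:
  "contract f (Rop i a) x y = contract f a x (y @ [i]) +
    (if y = [] then contract f a (x @ [i]) [] else if last y = i then contract f a x (butlast y) else 0)"
proof -
  let ?r = "\<lambda>c. coord f (x @ c) * (if rev c @ y \<noteq> [] \<and> last (rev c @ y) = i then coord a (butlast (rev c @ y)) else 0)"
  have split: "coord f (x @ c) * coord (Rop i a) (rev c @ y)
      = coord f (x @ c) * coord a (rev c @ y @ [i]) + ?r c" for c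
    by (simp add: coord_Rop algebra_simps)
  have s1: "(\<lambda>c. coord f (x @ c) * coord a (rev c @ y @ [i])) summable_on UNIV"
    by (rule summable_contract)
  \<comment> \<open>The remainder \<open>?r\<close> is not itself of the form of a contraction; it
    is summable as a difference of two that are.\<close>
  have "(\<lambda>c. coord f (x @ c) * coord (Rop i a) (rev c @ y)
      - coord f (x @ c) * coord a (rev c @ y @ [i])) summable_on UNIV"
    using summable_on_add[OF summable_contract[of f x "Rop i a" y] summable_on_uminus[THEN iffD2, OF s1]] by simp
  then have s2: "?r summable_on UNIV" by (simp only: split add_diff_cancel_left')
  have "contract f (Rop i a) x y = contract f a x (y @ [i]) + infsum ?r UNIV"
    unfolding contract_def split by (rule infsum_add[OF s1 s2])
  also have "infsum ?r UNIV = (if y = [] then contract f a (x @ [i]) [] else if last y = i then contract f a x (butlast y) else 0)"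
  proof (cases "y = []")
    case True
    have "infsum ?r UNIV = infsum ?r (range (\<lambda>d. i # d))"
    proof (rule infsum_cong_neutral)
      fix c assume "c \<in> UNIV - range ((#) i)"
      then show "?r c = 0" using True by (cases c) auto
    qed auto
    also have "\<dots> = contract f a (x @ [i]) []"
      by (subst infsum_reindex) (auto simp: contract_def o_def True butlast_append intro: injI)
    finally show ?thesis using True by simp
  next
    case False
    then show ?thesis by (auto simp: contract_def butlast_append intro!: infsum_0)
  qed
  finally show ?thesis .
qed

text \<open>Associativity with a letter as the last factor. The splits of w account for all splits
  of \<open>w @ [i]\<close> but the last one, which the boundary term of \<open>contract_Rop\<close>
  supplies.\<close>

lemma wick_Rop:
  "wick f (Rop i a) w = wick f a (w @ [i]) + (if w \<noteq> [] \<and> last w = i then wick f a (butlast w) else 0)"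
proof (cases w rule: rev_cases)
  case Nil
  then show ?thesis by (simp add: wick_def contract_Rop)
next
  case (snoc v j)
  have "wick f (Rop i a) w = (\<Sum>k\<le>length v. contract f (Rop i a) (take k w) (drop k w)) + contract f (Rop i a) w []"
    using snoc by (simp add: wick_def)
  also have "(\<Sum>k\<le>length v. contract f (Rop i a) (take k w) (drop k w))
      = (\<Sum>k\<le>length v. contract f a (take k w) (drop k w @ [i]) + (if j = i then contract f a (take k v) (drop k v) else 0))"
    by (rule sum.cong) (auto simp: snoc contract_Rop butlast_append)
  finally show ?thesis
    by (simp add: wick_snoc[of f a w] contract_Rop sum.distrib snoc wick_def)
qed

lemma wmul_Rop: "fin_deg N f \<Longrightarrow> wmul f (Rop i a) = Rop i (wmul f a)"
  by (intro ell2_eqI) (simp add: wmul_eq_parts(2) wick_Rop coord_Rop)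

text \<open>The three-term recursion of Chebyshev type: every word vector arises from
  \<open>unit []\<close> by right multiplications and subtraction of shorter words. Inductions on
  words rest on it.\<close>

lemma unit_snoc:
  "unit (w @ [i]) = Rop i (unit w) - (if w \<noteq> [] \<and> last w = i then unit (butlast w) else 0)"
proof (rule ell2_eqI)
  fix v
  have 1: "v @ [i] = w \<longleftrightarrow> w \<noteq> [] \<and> last w = i \<and> v = butlast w"
    by (cases w rule: rev_cases) auto
  have 2: "v \<noteq> [] \<and> last v = i \<and> butlast v = w \<longleftrightarrow> v = w @ [i]"
    by (cases v rule: rev_cases) auto
  show "coord (unit (w @ [i])) v = coord (Rop i (unit w) - (if w \<noteq> [] \<and> last w = i then unit (butlast w) else 0)) v"
    using 1 2 by (auto simp: coord_Rop)
qed

section \<open>Absence of zero divisors for the Wick product\<close>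

lemma fin_deg_supported: "fin_deg N f \<longleftrightarrow> supported_in {w. length w \<le> N} f"
  by (auto simp: fin_deg_def supported_in_def)

lemma cscale_diff: "cscale c (a - b) = cscale c a - cscale c b"
  by (intro ell2_eqI) (simp add: right_diff_distrib)

lemma cscale_0 [simp]: "cscale c 0 = 0"
  by (intro ell2_eqI) simp

lemma cscale_scaleR: "cscale c (r *\<^sub>R a) = r *\<^sub>R cscale c a"
  by (intro ell2_eqI) simp

lemma fin_deg_cscale: "fin_deg N f \<Longrightarrow> fin_deg N (cscale c f)"
  and fin_deg_add: "fin_deg N f \<Longrightarrow> fin_deg N g \<Longrightarrow> fin_deg N (f + g)"
  by (simp_all add: fin_deg_def)

section \<open>Bounded complex-linear operators and those commuting with right
  multiplications\<close>

definition bounded_clinear :: "('a ell2 \<Rightarrow> 'a ell2) \<Rightarrow> bool" where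
  "bounded_clinear T \<longleftrightarrow> bounded_linear T \<and> (\<forall>c a. T (cscale c a) = cscale c (T a))"

lemma bounded_clinearI:
  assumes "\<And>a b. T (a + b) = T a + T b" "\<And>c a. T (cscale c a) = cscale c (T a)" "\<And>a. norm (T a) \<le> K * norm a"
  shows "bounded_clinear T"
proof -
  have "bounded_linear T"
  proof (rule bounded_linear_intro)
    show "T (r *\<^sub>R a) = r *\<^sub>R T a" for r a
      using assms(2)[of "of_real r" a] by (simp add: cscale_of_real)
    show "norm (T a) \<le> norm a * K" for a using assms(3)[of a] by (simp add: mult.commute)
  qed (rule assms(1))
  then show ?thesis by (simp add: bounded_clinear_def assms(2))
qed

lemma bounded_clinearD:
  assumes "bounded_clinear T"
  shows "T (a + b) = T a + T b" "T (cscale c a) = cscale c (T a)" "T (a - b) = T a - T b"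
    "T (r *\<^sub>R a) = r *\<^sub>R T a" "T 0 = 0"
  using assms by (auto simp: bounded_clinear_def linear_simps)

lemma bounded_clinear_bound:
  assumes "bounded_clinear T"
  obtains K where "K > 0" "\<And>a. norm (T a) \<le> K * norm a"
  using assms bounded_linear.pos_bounded[of T] by (auto simp: bounded_clinear_def mult.commute)

lemma bounded_clinear_comp:
  "bounded_clinear T \<Longrightarrow> bounded_clinear U \<Longrightarrow> bounded_clinear (\<lambda>a. T (U a))"
  by (simp add: bounded_clinear_def bounded_linear_compose)

lemma bounded_clinear_diff:
  "bounded_clinear T \<Longrightarrow> bounded_clinear U \<Longrightarrow> bounded_clinear (\<lambda>a. T a - U a)"
  by (simp add: bounded_clinear_def bounded_linear_sub cscale_diff)

lemma bounded_clinear_scaleR: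
  "bounded_clinear T \<Longrightarrow> bounded_clinear (\<lambda>a. r *\<^sub>R T a)"
  by (simp add: bounded_clinear_def bounded_linear_const_scaleR cscale_scaleR)

lemma bounded_clinear_id: "bounded_clinear (\<lambda>a. a)"
  by (simp add: bounded_clinear_def bounded_linear_ident)

lemma bounded_clinear_funpow:
  assumes "bounded_clinear T"
  shows "bounded_clinear (T ^^ n)"
proof (induction n)
  case (Suc n)
  then show ?case using bounded_clinear_comp[OF assms Suc] by (simp add: o_def)
qed (simp add: bounded_clinear_id id_def)

lemma bounded_clinear_wmul:
  assumes "fin_deg N f"
  shows "bounded_clinear (wmul f)"
proof (rule bounded_clinearI)
  show "norm (wmul f a) \<le> ((real N + 1)\<^sup>2 * norm f) * norm a" for a by (rule norm_wmul_le[OF assms])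
qed (auto intro!: ell2_eqI simp: wmul_eq_parts(2)[OF assms] wick_add_right wick_cscale_right)

lemma wmul_add_left:
  assumes "fin_deg N f" "fin_deg N g"
  shows "wmul (f + g) a = wmul f a + wmul g a"
  by (intro ell2_eqI) (simp add: wmul_eq_parts(2)[OF assms(1)] wmul_eq_parts(2)[OF assms(2)]
      wmul_eq_parts(2)[OF fin_deg_add[OF assms]] wick_add_left)

lemma wmul_cscale_left:
  assumes "fin_deg N f"
  shows "wmul (cscale c f) a = cscale c (wmul f a)"
  by (intro ell2_eqI) (simp add: wmul_eq_parts(2)[OF assms] wmul_eq_parts(2)[OF fin_deg_cscale[OF assms]]
      wick_cscale_left)

lemma wmul_add_right_fin:
  assumes "fin_deg N f" "fin_deg N g"
  shows "wmul a (f + g) = wmul a f + wmul a g"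
  by (intro ell2_eqI) (simp add: wmul_right(2)[OF assms(1)] wmul_right(2)[OF assms(2)]
      wmul_right(2)[OF fin_deg_add[OF assms]] wick_add_right)

lemma wmul_cscale_right_fin:
  assumes "fin_deg N f"
  shows "wmul a (cscale c f) = cscale c (wmul a f)"
  by (intro ell2_eqI) (simp add: wmul_right(2)[OF assms] wmul_right(2)[OF fin_deg_cscale[OF assms]]
      wick_cscale_right)

lemma wick_unit_Nil [simp]: "wick a (unit []) w = coord a w"
proof -
  have *: "contract a (unit []) x y = (if y = [] then coord a x else 0)" for x y
    unfolding contract_def by (subst infsum_single[of "[]"]) auto
  have "wick a (unit []) w = (\<Sum>k\<le>length w. if k = length w then coord a w else 0)"
    unfolding wick_def * by (rule sum.cong) auto
  then show ?thesis by simp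
qed

lemma flip_unit_Nil [simp]: "flip (unit []) = unit []"
  by (intro ell2_eqI) simp

lemma conj_vec_unit_Nil [simp]: "conj_vec (unit []) = unit []"
  by (intro ell2_eqI) simp

lemma wick_unit_Nil_left [simp]: "wick (unit []) a w = coord a w"
  by (simp add: wick_flip'[of "unit []"])

lemma wmul_unit_Nil [simp]: "wmul a (unit []) = a" "wmul (unit []) a = a"
proof -
  have "fin_deg 0 (unit ([] :: 'a list))" by (simp add: fin_deg_def)
  then show "wmul a (unit []) = a" "wmul (unit []) a = a"
    by (auto intro!: ell2_eqI simp: wmul_right(2) wmul_eq_parts(2))
qed

lemma bounded_clinear_Rop: "bounded_clinear (Rop i)"
proof (rule bounded_clinearI)
  show "norm (Rop i a) \<le> ((real (Suc 0) + 1)\<^sup>2 * norm (letter i)) * norm a" for a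
    unfolding Rop_def by (rule norm_wmul_right_le[OF fin_deg_letter])
qed (auto intro!: ell2_eqI simp: coord_Rop algebra_simps)

lemma wmul_unit_snoc:
  "wmul a (unit (w @ [i])) = Rop i (wmul a (unit w)) - (if w \<noteq> [] \<and> last w = i then wmul a (unit (butlast w)) else 0)"
proof (rule ell2_eqI)
  fix v
  have "unit (w @ [i]) = Rop i (unit w) + cscale (-1) (if w \<noteq> [] \<and> last w = i then unit (butlast w) else 0)"
    unfolding unit_snoc cscale_minus_one by simp
  then have "wick a (unit (w @ [i])) v
      = wick a (Rop i (unit w)) v - (if w \<noteq> [] \<and> last w = i then wick a (unit (butlast w)) v else 0)"
    by (simp add: wick_add_right wick_cscale_right)
  moreover have "coord (wmul a (unit u)) = wick a (unit u)" for u
    by (rule wmul_right(2)[OF fin_deg_unit])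
  ultimately show "coord (wmul a (unit (w @ [i]))) v
      = coord (Rop i (wmul a (unit w)) - (if w \<noteq> [] \<and> last w = i then wmul a (unit (butlast w)) else 0)) v"
    by (simp add: wick_Rop coord_Rop)
qed

text \<open>An operator commuting with single letters on the right commutes with words by the
  recursion \<open>wmul_unit_snoc\<close>, and with g by density. It is applied to left
  multiplications, to powers in the trace computation and to elements of
  \<open>Salg\<close>.\<close>

lemma Rop_commutant_wmul:
  assumes T: "bounded_clinear T" and comm: "\<And>i a. T (Rop i a) = Rop i (T a)" and g: "fin_deg N g"
  shows "T (wmul a g) = wmul (T a) g"
proof -
  have unit: "T (wmul a (unit w)) = wmul (T a) (unit w)" for w
  proof (induction w rule: length_induct)
    case (1 w)
    show ?case
    proof (cases w rule: rev_cases)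
      case (snoc v i)
      with 1 show ?thesis
        by (auto simp: wmul_unit_snoc bounded_clinearD[OF T] comm)
    qed simp
  qed
  obtain K where K: "K > 0" "\<And>a. norm (T a) \<le> K * norm a" using bounded_clinear_bound[OF T] by blast
  \<comment> \<open>The density argument in g stays within words of length at most N, because the
    bound for right multiplication by g depends on its degree.\<close>
  have "T (wmul a g) - wmul (T a) g = 0"
  proof (rule additive_bounded_eq_0[where S = "{w. length w \<le> N}" and a = g])
    fix f g :: "'a word_ell2"
    assume "supported_in {w. length w \<le> N} f" "supported_in {w. length w \<le> N} g"
    then show "T (wmul a (f + g)) - wmul (T a) (f + g) = T (wmul a f) - wmul (T a) f + (T (wmul a g) - wmul (T a) g)"
      by (simp add: fin_deg_supported[symmetric] wmul_add_right_fin bounded_clinearD[OF T])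
  next
    fix g :: "'a word_ell2"
    assume "supported_in {w. length w \<le> N} g"
    then have g: "fin_deg N g" by (simp add: fin_deg_supported)
    have "norm (T (wmul a g)) \<le> K * ((real N + 1)\<^sup>2 * norm g * norm a)"
      using K(2)[of "wmul a g"] mult_left_mono[OF norm_wmul_right_le[OF g, of a], of K] K(1) by linarith
    moreover have "norm (wmul (T a) g) \<le> (real N + 1)\<^sup>2 * norm g * norm (T a)"
      by (rule norm_wmul_right_le[OF g])
    ultimately show "norm (T (wmul a g) - wmul (T a) g)
        \<le> (K * (real N + 1)\<^sup>2 * norm a + (real N + 1)\<^sup>2 * norm (T a)) * norm g"
      using norm_triangle_ineq4[of "T (wmul a g)" "wmul (T a) g"] by (simp add: algebra_simps)
  next
    fix w :: "'a list" and c
    show "T (wmul a (cscale c (unit w))) - wmul (T a) (cscale c (unit w)) = 0"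
      by (simp add: wmul_cscale_right_fin[OF fin_deg_unit] bounded_clinearD[OF T] unit)
  qed (use g in \<open>simp add: fin_deg_supported\<close>)
  then show ?thesis by simp
qed

text \<open>Left multiplication by f commutes with every \<open>Rop i\<close>, hence with right
  multiplication by g. The middle factor may have infinite degree.\<close>

lemma wmul_assoc:
  assumes "fin_deg M f" "fin_deg N g"
  shows "wmul f (wmul a g) = wmul (wmul f a) g"
  by (rule Rop_commutant_wmul[OF bounded_clinear_wmul[OF assms(1)] wmul_Rop[OF assms(1)] assms(2)])

section \<open>Involution, trace and adjoints\<close>

definition star :: "'i word_ell2 \<Rightarrow> 'i word_ell2" where
  "star f = conj_vec (flip f)"

lemma coord_star [simp]: "coord (star f) w = cnj (coord f (rev w))"
  by (simp add: star_def)

lemma fin_deg_star [simp]: "fin_deg N (star f) = fin_deg N f"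
  by (simp add: star_def)

lemma star_star [simp]: "star (star f) = f"
  by (intro ell2_eqI) simp

lemma wick_Nil: "wick a b [] = (\<Sum>\<^sub>\<infinity>c. coord a c * coord b (rev c))"
  by (simp add: wick_def contract_def)

lemma cip_wick: "cip a b = wick a (star b) []"
  by (simp add: cip_def wick_Nil)

text \<open>Traciality of the vacuum state: the coefficient at the empty word pairs c with
  \<open>rev c\<close>, and reversing the summation variable exchanges the two factors.\<close>

lemma wick_Nil_commute: "wick a b [] = wick b a []"
proof -
  have "bij (rev :: 'a list \<Rightarrow> 'a list)" by (rule o_bij[of rev]) auto
  then show ?thesis
    unfolding wick_Nil
    using infsum_reindex_bij_betw[of rev UNIV UNIV "\<lambda>c. coord a c * coord b (rev c)"]
    by (simp add: mult.commute)
qed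

lemma star_wmul:
  assumes "fin_deg N g"
  shows "star (wmul f g) = wmul (star g) (star f)"
proof (rule ell2_eqI)
  fix w
  show "coord (star (wmul f g)) w = coord (wmul (star g) (star f)) w"
    using assms
    by (simp add: wmul_right(2) wmul_eq_parts(2)) (simp add: star_def wick_conj_vec wick_flip'[of f])
qed

text \<open>The inner product is the trace of a product with a \<open>star\<close>. The identity
  then follows from associativity, traciality and the antimultiplicativity of \<open>star\<close>;
  finite degrees make all the intermediate products meaningful.\<close>

lemma cip_adjoint_fin:
  assumes "fin_deg L f" "fin_deg M a" "fin_deg N b"
  shows "cip (wmul f a) b = cip a (wmul (star f) b)"
proof -
  have "cip (wmul f a) b = coord (wmul (wmul f a) (star b)) []"
    using assms by (simp add: cip_wick wmul_right(2)[of N])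
  also have "\<dots> = wick f (wmul a (star b)) []"
    using assms by (simp add: wmul_assoc[symmetric, of L _ N] wmul_eq_parts(2)[of L])
  also have "\<dots> = cnj (wick (star f) (star (wmul a (star b))) [])"
    using wick_flip[of f "wmul a (star b)" "[]"] by (simp add: star_def wick_conj_vec wick_Nil_commute[of f])
  also have "star (wmul a (star b)) = wmul b (star a)"
    using assms by (simp add: star_wmul[of N])
  also have "wick (star f) (wmul b (star a)) [] = coord (wmul (wmul (star f) b) (star a)) []"
    using assms by (simp add: wmul_assoc[symmetric, of L _ M] wmul_eq_parts(2)[of L])
  also have "\<dots> = cip (wmul (star f) b) a"
    using assms by (simp add: cip_wick wmul_right(2)[of M])
  finally show ?thesis by (simp add: cnj_cip)
qed

text \<open>Two density arguments: a becomes arbitrary while b has finite degree, and then b does.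
  Joint boundedness of the difference supports both.\<close>

lemma cip_adjoint:
  assumes f: "fin_deg N f"
  shows "cip (wmul f a) b = cip a (wmul (star f) b)"
proof -
  have f': "fin_deg N (star f)" using f by simp
  note lin = bounded_clinearD[OF bounded_clinear_wmul[OF f]] bounded_clinearD[OF bounded_clinear_wmul[OF f']]
  have cip_right: "cip x (y + z) = cip x y + cip x z" for x y z :: "'a word_ell2"
    using cip_add_left[of y z x] cnj_cip by (metis complex_cnj_add)
  have bnd: "cmod (cip (wmul f a) b - cip a (wmul (star f) b)) \<le>
      ((real N + 1)\<^sup>2 * norm f + (real N + 1)\<^sup>2 * norm (star f)) * norm a * norm b" for a b
  proof -
    have "cmod (cip (wmul f a) b) \<le> ((real N + 1)\<^sup>2 * norm f * norm a) * norm b"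
      using norm_cip_le[of "wmul f a" b] mult_right_mono[OF norm_wmul_le[OF f, of a], of "norm b"] by simp
    moreover have "cmod (cip a (wmul (star f) b)) \<le> norm a * ((real N + 1)\<^sup>2 * norm (star f) * norm b)"
      using norm_cip_le[of a "wmul (star f) b"] mult_left_mono[OF norm_wmul_le[OF f', of b], of "norm a"] by simp
    ultimately show ?thesis
      using norm_triangle_ineq4[of "cip (wmul f a) b" "cip a (wmul (star f) b)"] by (simp add: algebra_simps)
  qed
  have unit: "fin_deg (length w) (cscale c (unit w))" for w :: "'a list" and c
    by (rule fin_deg_cscale[OF fin_deg_unit])
  have 1: "cip (wmul f a) b - cip a (wmul (star f) b) = 0" if "fin_deg M b" for a b M
  proof (rule additive_bounded_eq_0[where S = UNIV and a = a and \<Phi> = "\<lambda>a. cip (wmul f a) b - cip a (wmul (star f) b)"])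
    show "norm (cip (wmul f a) b - cip a (wmul (star f) b)) \<le>
      (((real N + 1)\<^sup>2 * norm f + (real N + 1)\<^sup>2 * norm (star f)) * norm b) * norm a" for a
      using bnd[of a b] by (simp add: mult_ac)
  qed (use cip_adjoint_fin[OF f unit that] in \<open>auto simp: lin cip_add_left\<close>)
  have "cip (wmul f a) b - cip a (wmul (star f) b) = 0"
  proof (rule additive_bounded_eq_0[where S = UNIV and a = b and \<Phi> = "\<lambda>b. cip (wmul f a) b - cip a (wmul (star f) b)"])
    show "norm (cip (wmul f a) b - cip a (wmul (star f) b)) \<le>
      (((real N + 1)\<^sup>2 * norm f + (real N + 1)\<^sup>2 * norm (star f)) * norm a) * norm b" for b
      using bnd[of a b] by (simp add: mult_ac)
  qed (use 1[OF unit] in \<open>auto simp: lin cip_right\<close>)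
  then show ?thesis by simp
qed

lemma inner_adjoint:
  assumes "fin_deg N f"
  shows "inner (wmul f a) b = inner a (wmul (star f) b)"
  by (simp add: cip_adjoint[OF assms] flip: Re_cip)

text \<open>The coefficient of a at \<open>v @ [i]\<close> is that of \<open>Rop i a\<close> at v,
  up to a coefficient at a shorter word. All coefficients are therefore controlled by vacuum
  coefficients of members of K.\<close>

lemma Rop_invariant_eq_0:
  assumes inv: "\<And>i a. a \<in> K \<Longrightarrow> Rop i a \<in> K" and vac: "\<And>a. a \<in> K \<Longrightarrow> coord a [] = 0" and "a \<in> K"
  shows "a = 0"
proof -
  have "\<forall>a\<in>K. coord a w = 0" for w
  proof (induction w rule: length_induct)
    case (1 w)
    show ?case
    proof (cases w rule: rev_cases)
      case (snoc v i)
      show ?thesis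
      proof
        fix a assume "a \<in> K"
        have "coord (Rop i a) v = 0" "v \<noteq> [] \<Longrightarrow> coord a (butlast v) = 0"
          using 1 snoc inv[OF \<open>a \<in> K\<close>] \<open>a \<in> K\<close> by auto
        then show "coord a w = 0" by (auto simp: coord_Rop snoc split: if_splits)
      qed
    qed (use vac in simp)
  qed
  then show ?thesis using \<open>a \<in> K\<close> by (intro ell2_eqI) simp
qed

text \<open>Powers of a positive contraction converge strongly to the projection onto its fixed
  vectors, here 0. In place of spectral calculus, the moments \<open>a k\<close> decrease to a limit
  and determine all distances between the iterates.\<close>

lemma funpow_tendsto_0:
  fixes P :: "'a :: {real_inner, complete_space} \<Rightarrow> 'a"
  assumes lin: "\<And>x y. P (x - y) = P x - P y"
    and sym: "\<And>x y. inner (P x) y = inner x (P y)"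
    and contr: "\<And>x. (norm (P x))\<^sup>2 \<le> inner (P x) x"
    and fixed: "\<And>x. P x = x \<Longrightarrow> x = 0"
  shows "(\<lambda>n. (P ^^ n) x) \<longlonglongrightarrow> 0"
proof -
  have nP: "norm (P y) \<le> norm y" for y
  proof (cases "norm (P y) = 0")
    case False
    have "norm (P y) * norm (P y) \<le> norm (P y) * norm y"
      using contr[of y] norm_cauchy_schwarz[of "P y" y] by (simp add: power2_eq_square)
    then show ?thesis using False by (simp add: mult_le_cancel_left)
  qed simp
  define a where "a k = inner ((P ^^ k) x) x" for k
  have inn: "inner ((P ^^ m) x) ((P ^^ n) x) = a (m + n)" for m n
  proof (induction n arbitrary: m)
    case (Suc n)
    have "inner ((P ^^ m) x) ((P ^^ Suc n) x) = inner ((P ^^ Suc m) x) ((P ^^ n) x)"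
      by (simp add: sym)
    then show ?case using Suc[of "Suc m"] by simp
  qed (simp add: a_def)
  \<comment> \<open>With y the j-th iterate, passing from 2j to 2j + 1 is Cauchy-Schwarz with
    \<open>norm (P y) \<le> norm y\<close>, and passing from 2j + 1 to 2j + 2 is
    \<open>contr\<close>.\<close>
  have step: "a (Suc (Suc (2 * j))) \<le> a (Suc (2 * j)) \<and> a (Suc (2 * j)) \<le> a (2 * j)" for j
  proof -
    let ?y = "(P ^^ j) x"
    have e: "a (2 * j) = (norm ?y)\<^sup>2" "a (Suc (2 * j)) = inner (P ?y) ?y" "a (Suc (Suc (2 * j))) = (norm (P ?y))\<^sup>2"
      using inn[of j j] inn[of "Suc j" j] inn[of "Suc j" "Suc j"]
      by (simp_all add: power2_norm_eq_inner mult_2)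
    have "inner (P ?y) ?y \<le> norm (P ?y) * norm ?y" by (rule norm_cauchy_schwarz)
    also have "\<dots> \<le> norm ?y * norm ?y" by (intro mult_right_mono nP) simp
    finally show ?thesis using contr[of ?y] unfolding e by (simp add: power2_eq_square)
  qed
  have "a (Suc k) \<le> a k" for k
    using step[of "k div 2"] by (cases "even k") (auto elim!: evenE oddE)
  then have dec: "decseq a" by (simp add: decseq_Suc_iff)
  have "a k \<ge> 0" for k
  proof -
    have "a k \<ge> a (k + k)" using dec by (simp add: decseqD)
    moreover have "a (k + k) = inner ((P ^^ k) x) ((P ^^ k) x)" by (rule inn[symmetric])
    ultimately show ?thesis using inner_ge_zero[of "(P ^^ k) x"] by linarith
  qed
  then obtain L where L: "a \<longlonglongrightarrow> L" using decseq_convergent[OF dec, of 0] by blast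
  have "Cauchy (\<lambda>n. (P ^^ n) x)"
  proof (rule CauchyI)
    fix e :: real assume "e > 0"
    \<comment> \<open>The squared distance combines three moments with weights 1, 1 and -2, so each
      unit of weight may cost a quarter of e squared.\<close>
    then obtain M where M: "\<And>k. k \<ge> M \<Longrightarrow> \<bar>a k - L\<bar> < e\<^sup>2 / 4"
      using LIMSEQ_D[OF L, of "e\<^sup>2 / 4"] by auto
    have "norm ((P ^^ m) x - (P ^^ n) x) < e" if "m \<ge> M" "n \<ge> M" for m n
    proof -
      have "(norm ((P ^^ m) x - (P ^^ n) x))\<^sup>2 = a (m + m) + a (n + n) - 2 * a (m + n)"
        by (simp add: power2_norm_eq_inner inner_diff inn add.commute[of n m])
      also have "\<dots> < e\<^sup>2"
        using M[of "m + m"] M[of "n + n"] M[of "m + n"] that by (simp add: abs_if split: if_splits)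
      finally show ?thesis using \<open>e > 0\<close> by (simp add: power2_less_imp_less)
    qed
    then show "\<exists>M. \<forall>m\<ge>M. \<forall>n\<ge>M. norm ((P ^^ m) x - (P ^^ n) x) < e" by blast
  qed
  then obtain y where y: "(\<lambda>n. (P ^^ n) x) \<longlonglongrightarrow> y"
    by (auto simp: Cauchy_convergent_iff convergent_def)
  have "(\<lambda>n. P ((P ^^ n) x)) \<longlonglongrightarrow> P y"
  proof (rule LIMSEQ_I)
    fix e :: real assume "e > 0"
    then obtain M where "\<forall>n\<ge>M. norm ((P ^^ n) x - y) < e" using LIMSEQ_D[OF y] by blast
    then show "\<exists>M. \<forall>n\<ge>M. norm (P ((P ^^ n) x) - P y) < e"
      using nP[of "(P ^^ _) x - y"] unfolding lin by (meson le_less_trans)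
  qed
  moreover have "(\<lambda>n. P ((P ^^ n) x)) \<longlonglongrightarrow> y" using LIMSEQ_Suc[OF y] by simp
  ultimately have "P y = y" by (rule LIMSEQ_unique)
  then show ?thesis using y fixed by blast
qed

lemma inner_unit_Nil: "inner a (unit []) = Re (coord a [])"
proof -
  have "star (unit ([] :: 'a list)) = unit []" by (simp add: star_def)
  then show ?thesis by (simp add: Re_cip[symmetric] cip_wick)
qed

(* P = 1 - k A A^* and Q = 1 - k A^* A satisfy |P^n Omega| = |Q^n Omega| by traciality. If A^* were
   injective, P^n would tend to 0, whereas Q^n fixes the kernel of A. *)
lemma kernel_adjoint:
  fixes f :: "'i word_ell2"
  assumes f: "fin_deg N f" and \<psi>: "wmul f \<psi> = 0" "\<psi> \<noteq> 0"
  shows "\<exists>\<zeta>. \<zeta> \<noteq> 0 \<and> wmul (star f) \<zeta> = 0"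
proof (rule ccontr)
  assume "\<nexists>\<zeta>. \<zeta> \<noteq> 0 \<and> wmul (star f) \<zeta> = 0"
  then have inj: "wmul (star f) a = 0 \<Longrightarrow> a = 0" for a by blast
  have f': "fin_deg N (star f)" using f by simp
  define A where "A = wmul f"
  define B where "B = wmul (star f)"
  define \<Omega> where "\<Omega> = unit ([] :: 'i list)"
  have linA: "bounded_clinear A" and linB: "bounded_clinear B"
    unfolding A_def B_def by (rule bounded_clinear_wmul[OF f], rule bounded_clinear_wmul[OF f'])
  have adj: "inner (A a) b = inner a (B b)" "inner (B a) b = inner a (A b)" for a b
    using inner_adjoint[OF f] inner_adjoint[OF f'] by (simp_all add: A_def B_def)
  obtain K1 where K1: "K1 > 0" "\<And>a. norm (A a) \<le> K1 * norm a" using bounded_clinear_bound[OF linA] by blast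
  obtain K2 where K2: "K2 > 0" "\<And>a. norm (B a) \<le> K2 * norm a" using bounded_clinear_bound[OF linB] by blast
  \<comment> \<open>The scaling makes \<open>\<kappa>\<close> times the square of either operator
    norm at most 1, so that P and Q are positive contractions.\<close>
  define \<kappa> where "\<kappa> = 1 / (max K1 K2)\<^sup>2"
  have \<kappa>: "\<kappa> > 0" using K1(1) by (simp add: \<kappa>_def)
  have bnd: "\<kappa> * (norm x)\<^sup>2 \<le> (norm y)\<^sup>2" if "norm x \<le> K * norm y" "K \<le> max K1 K2" for x y :: "'i word_ell2" and K
  proof -
    have "norm x \<le> max K1 K2 * norm y" using that mult_right_mono[OF that(2), of "norm y"] by simp
    then have "(norm x)\<^sup>2 \<le> (max K1 K2)\<^sup>2 * (norm y)\<^sup>2"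
      unfolding power_mult_distrib[symmetric] by (intro power_mono) auto
    then show ?thesis using K1(1) by (simp add: \<kappa>_def field_simps)
  qed
  define P where "P a = a - \<kappa> *\<^sub>R A (B a)" for a
  define Q where "Q a = a - \<kappa> *\<^sub>R B (A a)" for a
  have linP: "bounded_clinear P" and linQ: "bounded_clinear Q"
    unfolding P_def[abs_def] Q_def[abs_def]
    by (rule bounded_clinear_diff[OF bounded_clinear_id bounded_clinear_scaleR[OF bounded_clinear_comp[OF linA linB]]],
        rule bounded_clinear_diff[OF bounded_clinear_id bounded_clinear_scaleR[OF bounded_clinear_comp[OF linB linA]]])
  note lins = bounded_clinearD[OF linA] bounded_clinearD[OF linB] bounded_clinearD[OF linP] bounded_clinearD[OF linQ]
  have symP: "inner (P x) y = inner x (P y)" and symQ: "inner (Q x) y = inner x (Q y)" for x y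
    by (simp_all add: P_def Q_def inner_diff adj)
  have "(\<lambda>n. (P ^^ n) \<Omega>) \<longlonglongrightarrow> 0"
  proof (rule funpow_tendsto_0)
    fix x
    let ?c = "B x"
    \<comment> \<open>Since B P = Q B, the defect P - P^2 at x becomes \<open>\<kappa>\<close> times
      the quadratic form of Q at \<open>B x\<close>, which is nonnegative by the choice of
      \<open>\<kappa>\<close>.\<close>
    have "inner (P x) x - (norm (P x))\<^sup>2 = inner (P x) (x - P x)"
      by (simp add: inner_diff power2_norm_eq_inner)
    also have "\<dots> = \<kappa> * inner (B (P x)) ?c" by (simp add: P_def adj)
    also have "B (P x) = Q ?c" by (simp add: P_def Q_def lins)
    also have "inner (Q ?c) ?c = (norm ?c)\<^sup>2 - \<kappa> * (norm (A ?c))\<^sup>2"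
      by (simp add: Q_def inner_diff adj power2_norm_eq_inner)
    finally have "inner (P x) x - (norm (P x))\<^sup>2 = \<kappa> * ((norm ?c)\<^sup>2 - \<kappa> * (norm (A ?c))\<^sup>2)" .
    moreover have "\<kappa> * (norm (A ?c))\<^sup>2 \<le> (norm ?c)\<^sup>2" by (rule bnd[OF K1(2)]) simp
    ultimately show "(norm (P x))\<^sup>2 \<le> inner (P x) x"
      using \<kappa> mult_nonneg_nonneg[of \<kappa> "(norm ?c)\<^sup>2 - \<kappa> * (norm (A ?c))\<^sup>2"] by linarith
  next
    fix x assume "P x = x"
    then have "A (B x) = 0" using \<kappa> by (simp add: P_def)
    then have "inner (B x) (B x) = 0" using adj(1)[of "B x" x] by simp
    then show "x = 0" using inj by (simp add: B_def)
  qed (simp_all add: lins symP)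
  moreover have "norm ((Q ^^ n) \<Omega>) = norm ((P ^^ n) \<Omega>)" for n
  proof -
    have QB: "(Q ^^ n) (B a) = B ((P ^^ n) a)" for n a
      by (induction n) (simp_all add: P_def Q_def lins)
    have commP: "P (Rop i a) = Rop i (P a)" for i a
      by (simp add: P_def A_def B_def wmul_Rop[OF f] wmul_Rop[OF f'] bounded_clinearD[OF bounded_clinear_Rop])
    have commPn: "(P ^^ n) (Rop i a) = Rop i ((P ^^ n) a)" for i a n
      by (induction n) (simp_all add: commP)
    \<comment> \<open>The powers of P and Q have equal traces. In the step, B crosses the inner
      product, the pairing of \<open>(P ^^ n) f\<close> with f is read as the trace of its product
      with \<open>star f\<close>, and \<open>P ^^ n\<close> absorbs the right factor since it
      commutes with every \<open>Rop i\<close>.\<close>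
    have tr: "inner ((Q ^^ n) \<Omega>) \<Omega> = inner ((P ^^ n) \<Omega>) \<Omega>" for n
    proof (induction n)
      case (Suc n)
      have linPn: "bounded_clinear (P ^^ n)" and linQn: "bounded_clinear (Q ^^ n)"
        by (intro bounded_clinear_funpow linP linQ)+
      have A\<Omega>: "A \<Omega> = f" and B\<Omega>: "B \<Omega> = star f" by (simp_all add: A_def B_def \<Omega>_def)
      have "inner ((Q ^^ Suc n) \<Omega>) \<Omega> = inner ((Q ^^ n) \<Omega>) \<Omega> - \<kappa> * inner (B ((P ^^ n) f)) \<Omega>"
        by (simp add: funpow_Suc_right A\<Omega> QB inner_diff bounded_clinearD[OF linQn] Q_def[of \<Omega>] del: funpow.simps)
      also have "inner (B ((P ^^ n) f)) \<Omega> = inner ((P ^^ n) f) f"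
        by (simp add: adj A\<Omega>)
      also have "\<dots> = Re (wick ((P ^^ n) f) (star f) [])"
        by (simp add: Re_cip[symmetric] cip_wick)
      also have "\<dots> = inner (wmul ((P ^^ n) f) (star f)) \<Omega>"
        by (simp add: \<Omega>_def inner_unit_Nil wmul_right(2)[OF f'])
      also have "wmul ((P ^^ n) f) (star f) = (P ^^ n) (A (B \<Omega>))"
        by (simp add: Rop_commutant_wmul[OF linPn commPn f'] B\<Omega> A_def)
      also have "inner ((Q ^^ n) \<Omega>) \<Omega> - \<kappa> * inner ((P ^^ n) (A (B \<Omega>))) \<Omega> = inner ((P ^^ Suc n) \<Omega>) \<Omega>"
        using Suc by (simp add: funpow_Suc_right inner_diff bounded_clinearD[OF linPn] P_def[of \<Omega>] del: funpow.simps)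
      finally show ?case .
    qed simp
    have symn: "inner ((P ^^ n) x) y = inner x ((P ^^ n) y)" "inner ((Q ^^ n) x) y = inner x ((Q ^^ n) y)" for x y n
      by (induction n arbitrary: x y) (simp_all add: symP symQ funpow_swap1)
    \<comment> \<open>By symmetry a squared norm at n is a trace at n + n.\<close>
    have "inner ((Q ^^ n) \<Omega>) ((Q ^^ n) \<Omega>) = inner ((P ^^ n) \<Omega>) ((P ^^ n) \<Omega>)"
      using tr[of "n + n"] by (simp add: funpow_add symn)
    then show ?thesis by (simp add: norm_eq_sqrt_inner)
  qed
  ultimately have lim: "(\<lambda>n. norm ((Q ^^ n) \<Omega>)) \<longlonglongrightarrow> 0"
    using tendsto_norm by fastforce
  have "\<exists>\<phi>. wmul f \<phi> = 0 \<and> coord \<phi> [] \<noteq> 0"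
  proof (rule ccontr)
    assume "\<not> ?thesis"
    then have "\<psi> = 0"
      using \<psi>(1) bounded_clinearD(5)[OF bounded_clinear_Rop]
      by (intro Rop_invariant_eq_0[of "{\<phi>. wmul f \<phi> = 0}"]) (auto simp: wmul_Rop[OF f])
    with \<psi>(2) show False by simp
  qed
  then obtain \<phi> where \<phi>: "wmul f \<phi> = 0" "coord \<phi> [] \<noteq> 0" by blast
  \<comment> \<open>The scalar makes the pairing with \<open>\<Omega>\<close> the positive number
    |\<open>\<phi>\<close>([])|^2, as \<open>inner\<close> sees real parts only. Q fixes
    \<open>\<eta>\<close>, so this number is also the pairing of \<open>\<eta>\<close> with
    \<open>(Q ^^ n) \<Omega>\<close>, whose norm tends to 0.\<close>
  define \<eta> where "\<eta> = cscale (cnj (coord \<phi> [])) \<phi>"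
  have "A \<eta> = 0" using \<phi>(1) by (simp add: \<eta>_def A_def bounded_clinearD[OF bounded_clinear_wmul[OF f]])
  then have "(Q ^^ n) \<eta> = \<eta>" for n by (induction n) (simp_all add: Q_def lins)
  moreover have "inner ((Q ^^ n) x) y = inner x ((Q ^^ n) y)" for x y n
    by (induction n arbitrary: x y) (simp_all add: symQ funpow_swap1)
  ultimately have "inner \<eta> \<Omega> = inner \<eta> ((Q ^^ n) \<Omega>)" for n by metis
  then have "inner \<eta> \<Omega> \<le> norm \<eta> * norm ((Q ^^ n) \<Omega>)" for n
    using norm_cauchy_schwarz[of \<eta> "(Q ^^ n) \<Omega>"] by simp
  moreover have "(\<lambda>n. norm \<eta> * norm ((Q ^^ n) \<Omega>)) \<longlonglongrightarrow> 0"
    using tendsto_mult_left[OF lim, of "norm \<eta>"] by simp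
  ultimately have "inner \<eta> \<Omega> \<le> 0" by (meson LIMSEQ_le_const)
  moreover have "inner \<eta> \<Omega> = (cmod (coord \<phi> []))\<^sup>2"
    by (simp add: \<Omega>_def inner_unit_Nil \<eta>_def) (simp only: cmod_power2, simp only: power2_eq_square)
  ultimately show False using \<phi>(2) by simp
qed

section \<open>Right annihilation and the induction on the degree\<close>

definition rann :: "'i \<Rightarrow> 'i word_ell2 \<Rightarrow> 'i word_ell2" where
  "rann i a = Ell2 (\<lambda>w. coord a (w @ [i]))"

lemma coord_rann [simp]: "coord (rann i a) w = coord a (w @ [i])"
proof -
  have "inj (\<lambda>w. w @ [i])" by (auto intro: injI)
  then show ?thesis
    using square_summable_inj[OF square_summable_coord[of a], of "\<lambda>w. w @ [i]"] by (simp add: rann_def)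
qed

lemma norm_rann_le: "norm (rann i a) \<le> norm a"
proof (rule norm_ell2_le_finite)
  fix F :: "'a list set" assume "finite F"
  have "(\<Sum>w\<in>F. (cmod (coord (rann i a) w))\<^sup>2) = (\<Sum>w\<in>(\<lambda>w. w @ [i]) ` F. (cmod (coord a w))\<^sup>2)"
    by (subst sum.reindex) (auto intro: inj_onI)
  also have "\<dots> \<le> (norm a)\<^sup>2" by (rule sum_norm_sq_le)
  finally show "(\<Sum>w\<in>F. (cmod (coord (rann i a) w))\<^sup>2) \<le> (norm a)\<^sup>2" .
qed simp

text \<open>Every split of \<open>w @ [i]\<close> that leaves i in the right factor is a split of w
  for \<open>rann i a\<close>. The one remaining split gives the whole word to f and is the
  commutator of annihilation and multiplication.\<close>

lemma wick_snoc_rann: "wick f a (w @ [i]) = wick f (rann i a) w + contract f a (w @ [i]) []"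
  unfolding wick_snoc by (simp add: wick_def contract_def)

theorem wmul_no_zero_divisors:
  fixes f \<psi> :: "'i word_ell2"
  assumes "fin_deg N f" "f \<noteq> 0" "wmul f \<psi> = 0"
  shows "\<psi> = 0"
  using assms
proof (induction N arbitrary: f)
  case 0
  have f: "f = cscale (coord f []) (unit [])"
    using 0(1) by (intro ell2_eqI) (auto simp: fin_deg_def)
  then have "coord f [] \<noteq> 0" using 0(2) by (metis coord_ell2_simps(1) coord_cscale ell2_eqI mult_zero_left)
  moreover have "wmul f \<psi> = cscale (coord f []) \<psi>"
    by (subst f, subst wmul_cscale_left[OF fin_deg_unit]) simp
  ultimately show ?case using 0(3) by (intro ell2_eqI) (metis coord_cscale coord_ell2_simps(1) mult_eq_0_iff)
next
  case (Suc N)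
  note f = Suc.prems(1)
  have f': "fin_deg (Suc N) (star f)" using f by simp
  show ?case
  proof (cases "fin_deg N f")
    case True
    then show ?thesis using Suc by blast
  next
    case False
    then obtain u where u: "length u > N" "coord f u \<noteq> 0" by (auto simp: fin_deg_def)
    then have "length u = Suc N" using f by (meson fin_deg_def linorder_neqE_nat not_less_eq)
    \<comment> \<open>The first letter of a top-degree word selects the difference quotient whose
      coefficient at y0 is nonzero.\<close>
    then obtain i y0 where y0: "u = i # y0" by (cases u) auto
    show ?thesis
    proof (rule ccontr)
      assume "\<psi> \<noteq> 0"
      then obtain \<zeta>0 where \<zeta>0: "\<zeta>0 \<noteq> 0" "wmul (star f) \<zeta>0 = 0"
        using kernel_adjoint[OF f Suc.prems(3)] by blast
      have "\<exists>\<zeta>. wmul (star f) \<zeta> = 0 \<and> coord \<zeta> [] \<noteq> 0"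
      proof (rule ccontr)
        assume "\<not> ?thesis"
        then have "\<zeta>0 = 0"
          using \<zeta>0(2) bounded_clinearD(5)[OF bounded_clinear_Rop]
          by (intro Rop_invariant_eq_0[of "{\<phi>. wmul (star f) \<phi> = 0}"]) (auto simp: wmul_Rop[OF f'])
        with \<zeta>0(1) show False by simp
      qed
      then obtain \<zeta> where \<zeta>: "wmul (star f) \<zeta> = 0" "coord \<zeta> [] \<noteq> 0" by blast
      \<comment> \<open>This is f' of the overview: the reversals in \<open>star\<close> and in the
        contraction cancel, leaving the sum of \<open>cnj (\<zeta> w) * f (w @ i # y)\<close> over
        all w.\<close>
      define g where "g = Ell2 (\<lambda>y. contract (star \<zeta>) f [] (i # y))"
      \<comment> \<open>Here the right factor f carries the finite degree, which bounds the
        contraction length m. Thus only the parts without creation operators, finitely many of them,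
        are involved.\<close>
      have "contract (star \<zeta>) f [] y = (\<Sum>m\<le>Suc N. wick_part 0 m (star \<zeta>) f y)" for y
        unfolding contract_def
        by (subst infsum_by_length[OF summable_contract, of "Suc N"])
          (use f in \<open>auto simp: fin_deg_def wick_part_def\<close>)
      then have "contract (star \<zeta>) f [] = coord (\<Sum>m\<le>Suc N. Ell2 (wick_part 0 m (star \<zeta>) f))"
        by (auto simp: square_summable_wick_part simp del: sum.atMost_Suc)
      then have "square_summable (contract (star \<zeta>) f [])" by (simp only: square_summable_coord)
      then have "square_summable (\<lambda>y. contract (star \<zeta>) f [] (i # y))"
        by (rule square_summable_inj) (auto intro: injI)
      then have g: "coord g y = contract (star \<zeta>) f [] (i # y)" for y
        by (simp add: g_def)
      have fing: "fin_deg N g"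
        using f by (auto simp: fin_deg_def g contract_def intro!: infsum_0)
      have "coord f (rev x @ u) = 0" if "x \<noteq> []" for x
        using f u that \<open>length u = Suc N\<close> by (simp add: fin_deg_def)
      then have "coord g y0 = cnj (coord \<zeta> []) * coord f u"
        unfolding g contract_def y0 by (subst infsum_single[of "[]"]) auto
      then have "g \<noteq> 0" using u \<zeta> by auto
      define D where "D \<phi> = rann i (wmul f \<phi>) - wmul f (rann i \<phi>)" for \<phi>
      have D: "coord (D \<phi>) w = contract f \<phi> (w @ [i]) []" for \<phi> w
        by (simp add: D_def wmul_eq_parts(2)[OF f] wick_snoc_rann)
      have Dadd: "D (a + b) = D a + D b" for a b
        by (intro ell2_eqI) (simp add: D contract_add_right)
      have Dbnd: "norm (D \<phi>) \<le> 2 * (real (Suc N) + 1)\<^sup>2 * norm f * norm \<phi>" for \<phi>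
      proof -
        have "norm (rann i (wmul f \<phi>)) \<le> (real (Suc N) + 1)\<^sup>2 * norm f * norm \<phi>"
          using norm_rann_le norm_wmul_le[OF f] by (rule order_trans)
        moreover have "norm (wmul f (rann i \<phi>)) \<le> (real (Suc N) + 1)\<^sup>2 * norm f * norm \<phi>"
          by (rule order_trans[OF norm_wmul_le[OF f]]) (intro mult_left_mono norm_rann_le, simp)
        ultimately show ?thesis
          using norm_triangle_ineq4[of "rann i (wmul f \<phi>)" "wmul f (rann i \<phi>)"] by (simp add: D_def)
      qed
      \<comment> \<open>Both terms are additive and bounded in \<open>\<phi>\<close>, so they may be
        compared on multiples of a word v; each then equals c times the coefficient of g at
        \<open>rev v\<close>.\<close>
      have eq: "wick g \<phi> [] - cip (D \<phi>) \<zeta> = 0" for \<phi>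
      proof (rule additive_bounded_eq_0[where S = UNIV and a = \<phi> and \<Phi> = "\<lambda>\<phi>. wick g \<phi> [] - cip (D \<phi>) \<zeta>"])
        show "wick g (a + b) [] - cip (D (a + b)) \<zeta> = wick g a [] - cip (D a) \<zeta> + (wick g b [] - cip (D b) \<zeta>)" for a b
          by (simp add: wick_add_right Dadd cip_add_left)
      next
        fix \<phi> :: "'i word_ell2"
        have "cmod (wick g \<phi> []) \<le> ((real N + 1)\<^sup>2 * norm g) * norm \<phi>"
          using coord_le_norm[of "wmul g \<phi>" "[]"] norm_wmul_le[OF fing, of \<phi>] by (simp add: wmul_eq_parts(2)[OF fing])
        moreover have "cmod (cip (D \<phi>) \<zeta>) \<le> (2 * (real (Suc N) + 1)\<^sup>2 * norm f * norm \<phi>) * norm \<zeta>"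
          by (rule order_trans[OF norm_cip_le mult_right_mono[OF Dbnd]]) simp
        ultimately show "norm (wick g \<phi> [] - cip (D \<phi>) \<zeta>)
            \<le> ((real N + 1)\<^sup>2 * norm g + 2 * (real (Suc N) + 1)\<^sup>2 * norm f * norm \<zeta>) * norm \<phi>"
          using norm_triangle_ineq4[of "wick g \<phi> []" "cip (D \<phi>) \<zeta>"] by (simp add: algebra_simps)
      next
        fix v :: "'i list" and c
        have "contract f (cscale c (unit v)) (w @ [i]) [] = c * coord f (w @ i # rev v)" for w
          unfolding contract_def
          by (subst infsum_single[of "rev v"]) (auto simp: rev_swap)
        then have "cip (D (cscale c (unit v))) \<zeta> = (\<Sum>\<^sub>\<infinity>w. c * coord f (w @ i # rev v) * cnj (coord \<zeta> w))"
          unfolding cip_def D by simp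
        also have "\<dots> = (\<Sum>\<^sub>\<infinity>w. c * coord f (rev w @ i # rev v) * cnj (coord \<zeta> (rev w)))"
        proof -
          have "bij (rev :: 'i list \<Rightarrow> 'i list)" by (rule o_bij[of rev]) auto
          then show ?thesis
            using infsum_reindex_bij_betw[of rev UNIV UNIV "\<lambda>w. c * coord f (w @ i # rev v) * cnj (coord \<zeta> w)"] by simp
        qed
        also have "\<dots> = c * coord g (rev v)"
          unfolding g contract_def infsum_cmult_right'[symmetric] by (simp add: mult_ac)
        also have "\<dots> = wick g (cscale c (unit v)) []"
          unfolding wick_Nil by (subst infsum_single[of "rev v"]) (auto simp: rev_swap)
        finally show "wick g (cscale c (unit v)) [] - cip (D (cscale c (unit v))) \<zeta> = 0" by simp
      qed simp
      have vac: "wick g \<phi> [] = 0" if "wmul f \<phi> = 0" for \<phi>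
      proof -
        have "rann i (0 :: 'i word_ell2) = 0" by (intro ell2_eqI) simp
        then have "D \<phi> = cscale (-1) (wmul f (rann i \<phi>))"
          by (simp add: D_def that cscale_minus_one)
        then have "cip (D \<phi>) \<zeta> = 0"
          by (simp add: cip_cscale_left cip_adjoint[OF f] \<zeta>(1))
        then show ?thesis using eq[of \<phi>] by simp
      qed
      \<comment> \<open>The invariance argument runs on all products of g with kernel vectors of f:
        their vacuum coefficients vanish by \<open>vac\<close>, and every \<open>Rop j\<close> maps
        this set into itself.\<close>
      have "wmul g \<psi> = 0"
      proof (rule Rop_invariant_eq_0[of "wmul g ` {\<phi>. wmul f \<phi> = 0}"])
        fix j a assume "a \<in> wmul g ` {\<phi>. wmul f \<phi> = 0}"
        then obtain \<phi> where \<phi>: "wmul f \<phi> = 0" "a = wmul g \<phi>" by blast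
        then have "wmul f (Rop j \<phi>) = 0" "Rop j a = wmul g (Rop j \<phi>)"
          by (simp_all add: wmul_Rop[OF f] wmul_Rop[OF fing] bounded_clinearD[OF bounded_clinear_Rop])
        then show "Rop j a \<in> wmul g ` {\<phi>. wmul f \<phi> = 0}" by blast
      qed (use Suc.prems(3) vac in \<open>auto simp: wmul_eq_parts(2)[OF fing]\<close>)
      with Suc.IH[OF fing \<open>g \<noteq> 0\<close>] \<open>\<psi> \<noteq> 0\<close> show False by blast
    qed
  qed
qed

section \<open>Orthonormal bases of square-integrable functions\<close>

text \<open>A common form of \<open>sqint\<close> and \<open>sqint1\<close> over an arbitrary
  measure. Functions are not identified almost everywhere, so uniqueness statements below carry
  \<open>AE\<close>.\<close>

definition l2fun :: "'a measure \<Rightarrow> ('a \<Rightarrow> complex) \<Rightarrow> bool" where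
  "l2fun M f \<longleftrightarrow> f \<in> borel_measurable M \<and> integrable M (\<lambda>t. (cmod (f t))\<^sup>2)"

definition sqnorm :: "'a measure \<Rightarrow> ('a \<Rightarrow> complex) \<Rightarrow> real" where
  "sqnorm M f = (\<integral>t. (cmod (f t))\<^sup>2 \<partial>M)"

lemma l2fun_measurable [measurable_dest]: "l2fun M f \<Longrightarrow> f \<in> borel_measurable M"
  by (simp add: l2fun_def)

lemma l2fun_integrable: "l2fun M f \<Longrightarrow> integrable M (\<lambda>t. (cmod (f t))\<^sup>2)"
  by (simp add: l2fun_def)

lemma sqnorm_nonneg [simp]: "0 \<le> sqnorm M f"
  by (simp add: sqnorm_def)

lemma l2fun_prod_integrable:
  assumes [measurable]: "l2fun M f" "l2fun M g"
  shows "integrable M (\<lambda>t. f t * g t)"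
proof (rule Bochner_Integration.integrable_bound)
  show "integrable M (\<lambda>t. (cmod (f t))\<^sup>2 + (cmod (g t))\<^sup>2)"
    using assms by (simp add: l2fun_integrable)
  show "AE t in M. norm (f t * g t) \<le> norm ((cmod (f t))\<^sup>2 + (cmod (g t))\<^sup>2)"
  proof (rule AE_I2)
    fix t
    have "2 * (cmod (f t) * cmod (g t)) \<le> (cmod (f t))\<^sup>2 + (cmod (g t))\<^sup>2"
      using sum_squares_bound[of "cmod (f t)" "cmod (g t)"] by simp
    moreover have "0 \<le> cmod (f t) * cmod (g t)" by simp
    ultimately have "cmod (f t) * cmod (g t) \<le> (cmod (f t))\<^sup>2 + (cmod (g t))\<^sup>2" by linarith
    then show "norm (f t * g t) \<le> norm ((cmod (f t))\<^sup>2 + (cmod (g t))\<^sup>2)"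
      unfolding norm_mult by simp
  qed
qed measurable

lemma l2fun_add:
  assumes [measurable]: "l2fun M f" "l2fun M g"
  shows "l2fun M (\<lambda>t. f t + g t)"
  unfolding l2fun_def
proof
  show "integrable M (\<lambda>t. (cmod (f t + g t))\<^sup>2)"
  proof (rule Bochner_Integration.integrable_bound)
    show "integrable M (\<lambda>t. 2 * (cmod (f t))\<^sup>2 + 2 * (cmod (g t))\<^sup>2)"
      using assms by (simp add: l2fun_integrable)
    show "AE t in M. norm ((cmod (f t + g t))\<^sup>2) \<le> norm (2 * (cmod (f t))\<^sup>2 + 2 * (cmod (g t))\<^sup>2)"
    proof (rule AE_I2)
      fix t
      have "(cmod (f t + g t))\<^sup>2 \<le> (cmod (f t) + cmod (g t))\<^sup>2"
        by (simp add: norm_triangle_ineq power_mono)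
      also have "\<dots> \<le> 2 * (cmod (f t))\<^sup>2 + 2 * (cmod (g t))\<^sup>2"
        using sum_squares_bound[of "cmod (f t)" "cmod (g t)"] by (simp add: power2_sum)
      finally show "norm ((cmod (f t + g t))\<^sup>2) \<le> norm (2 * (cmod (f t))\<^sup>2 + 2 * (cmod (g t))\<^sup>2)" by simp
    qed
  qed measurable
qed measurable

lemma l2fun_cmult:
  assumes [measurable]: "l2fun M f"
  shows "l2fun M (\<lambda>t. c * f t)"
  unfolding l2fun_def norm_mult power_mult_distrib using l2fun_integrable[OF assms] by simp

lemma l2fun_zero: "l2fun M (\<lambda>t. 0)"
  by (simp add: l2fun_def)

lemma l2fun_diff: "l2fun M f \<Longrightarrow> l2fun M g \<Longrightarrow> l2fun M (\<lambda>t. f t - g t)"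
  using l2fun_add[of M f "\<lambda>t. -1 * g t"] l2fun_cmult[of M g "-1"] by simp

lemma l2fun_sum: "(\<And>i. i \<in> F \<Longrightarrow> l2fun M (f i)) \<Longrightarrow> l2fun M (\<lambda>t. \<Sum>i\<in>F. f i t)"
  by (induction F rule: infinite_finite_induct) (auto intro: l2fun_add l2fun_zero)

lemma l2fun_cnj: "l2fun M f \<Longrightarrow> l2fun M (\<lambda>t. cnj (f t))"
  unfolding l2fun_def using borel_measurable_complex_iff[of "\<lambda>t. cnj (f t)" M] borel_measurable_complex_iff[of f M]
  by simp

lemma sqnorm_cong_AE:
  assumes [measurable]: "f \<in> borel_measurable M" "g \<in> borel_measurable M" and "AE t in M. f t = g t"
  shows "sqnorm M f = sqnorm M g"
  unfolding sqnorm_def using assms(3) by (intro integral_cong_AE) auto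

lemma sqnorm_eq_0_iff:
  assumes "l2fun M f"
  shows "sqnorm M f = 0 \<longleftrightarrow> (AE t in M. f t = 0)"
  unfolding sqnorm_def using integral_nonneg_eq_0_iff_AE[OF l2fun_integrable[OF assms]] by simp

lemma l2_Cauchy_Schwarz:
  assumes [measurable]: "l2fun M f" "l2fun M g"
  shows "(cmod (\<integral>t. f t * g t \<partial>M))\<^sup>2 \<le> sqnorm M f * sqnorm M g"
proof -
  have i: "integrable M (\<lambda>t. cmod (f t) * cmod (g t))"
    using integrable_norm[OF l2fun_prod_integrable[OF assms]] by (simp add: norm_mult)
  have "(ennreal (\<integral>t. cmod (f t) * cmod (g t) \<partial>M))\<^sup>2 = (\<integral>\<^sup>+t. ennreal (cmod (f t)) * ennreal (cmod (g t)) \<partial>M)\<^sup>2"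
    by (subst nn_integral_eq_integral[symmetric, OF i]) (auto simp: ennreal_mult)
  also have "\<dots> \<le> (\<integral>\<^sup>+t. (ennreal (cmod (f t)))\<^sup>2 \<partial>M) * (\<integral>\<^sup>+t. (ennreal (cmod (g t)))\<^sup>2 \<partial>M)"
    by (rule Cauchy_Schwarz_nn_integral) measurable
  also have "\<dots> = ennreal (sqnorm M f) * ennreal (sqnorm M g)"
    unfolding sqnorm_def
    by (subst (1 2) nn_integral_eq_integral[symmetric]) (auto simp: ennreal_power l2fun_integrable assms)
  finally have "ennreal ((\<integral>t. cmod (f t) * cmod (g t) \<partial>M)\<^sup>2) \<le> ennreal (sqnorm M f * sqnorm M g)"
    by (simp add: ennreal_mult ennreal_power)
  then have "(\<integral>t. cmod (f t) * cmod (g t) \<partial>M)\<^sup>2 \<le> sqnorm M f * sqnorm M g"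
    by simp
  moreover have "cmod (\<integral>t. f t * g t \<partial>M) \<le> (\<integral>t. cmod (f t) * cmod (g t) \<partial>M)"
    using integral_norm_bound[of M "\<lambda>t. f t * g t"] by (simp add: norm_mult)
  ultimately show ?thesis
    by (meson norm_ge_zero order_trans power_mono)
qed

lemma sqnorm_add:
  assumes [measurable]: "l2fun M f" "l2fun M g"
  shows "sqnorm M (\<lambda>t. f t + g t) = sqnorm M f + sqnorm M g + 2 * Re (\<integral>t. f t * cnj (g t) \<partial>M)"
proof -
  have i: "integrable M (\<lambda>t. f t * cnj (g t))"
    by (rule l2fun_prod_integrable[OF assms(1) l2fun_cnj[OF assms(2)]])
  have "(cmod (f t + g t))\<^sup>2 = (cmod (f t))\<^sup>2 + (cmod (g t))\<^sup>2 + 2 * Re (f t * cnj (g t))" for t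
    unfolding cmod_power2 by (simp add: power2_eq_square algebra_simps)
  then have "sqnorm M (\<lambda>t. f t + g t) = (\<integral>t. (cmod (f t))\<^sup>2 + (cmod (g t))\<^sup>2 + 2 * Re (f t * cnj (g t)) \<partial>M)"
    unfolding sqnorm_def by simp
  also have "\<dots> = (\<integral>t. (cmod (f t))\<^sup>2 \<partial>M) + (\<integral>t. (cmod (g t))\<^sup>2 \<partial>M) + 2 * (\<integral>t. Re (f t * cnj (g t)) \<partial>M)"
    using i l2fun_integrable[OF assms(1)] l2fun_integrable[OF assms(2)]
    by (simp add: integrable_Re del: times_complex.sel)
  finally show ?thesis
    using i by (simp add: sqnorm_def integral_Re del: times_complex.sel)
qed

lemma sqnorm_cmult: "sqnorm M (\<lambda>t. c * f t) = (cmod c)\<^sup>2 * sqnorm M f"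
  by (simp add: sqnorm_def norm_mult power_mult_distrib)

lemma sqnorm_triangle:
  assumes "l2fun M f" "l2fun M g"
  shows "sqrt (sqnorm M (\<lambda>t. f t + g t)) \<le> sqrt (sqnorm M f) + sqrt (sqnorm M g)"
proof -
  have "(cmod (\<integral>t. f t * cnj (g t) \<partial>M))\<^sup>2 \<le> sqnorm M f * sqnorm M g"
    using l2_Cauchy_Schwarz[OF assms(1) l2fun_cnj[OF assms(2)]] by (simp add: sqnorm_def)
  then have "cmod (\<integral>t. f t * cnj (g t) \<partial>M) \<le> sqrt (sqnorm M f) * sqrt (sqnorm M g)"
    by (simp add: real_le_rsqrt real_sqrt_mult[symmetric])
  then have "sqnorm M (\<lambda>t. f t + g t) \<le> (sqrt (sqnorm M f) + sqrt (sqnorm M g))\<^sup>2"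
    using complex_Re_le_cmod[of "\<integral>t. f t * cnj (g t) \<partial>M"]
    unfolding sqnorm_add[OF assms] power2_sum by simp
  then show ?thesis by (intro real_le_lsqrt) auto
qed

text \<open>A fast subsequence converges almost everywhere, and Fatou's lemma shows that its limit
  is the limit of the whole sequence in square mean.\<close>

lemma l2_complete:
  fixes S :: "nat \<Rightarrow> 'a \<Rightarrow> complex"
  assumes S [measurable]: "\<And>n. l2fun M (S n)"
    and cauchy: "\<And>e. e > 0 \<Longrightarrow> \<exists>N. \<forall>m\<ge>N. \<forall>n\<ge>N. sqnorm M (\<lambda>t. S m t - S n t) < e"
  shows "\<exists>f. l2fun M f \<and> (\<lambda>n. sqnorm M (\<lambda>t. f t - S n t)) \<longlonglongrightarrow> 0"
proof -
  have [measurable]: "S n \<in> borel_measurable M" for n by (rule l2fun_measurable[OF S])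
  have "\<exists>N. \<forall>k. (\<forall>m\<ge>N k. \<forall>n\<ge>N k. sqnorm M (\<lambda>t. S m t - S n t) < (1/4) ^ k)"
    using cauchy by (intro choice allI) simp
  then obtain N where N: "\<And>k m n. m \<ge> N k \<Longrightarrow> n \<ge> N k \<Longrightarrow> sqnorm M (\<lambda>t. S m t - S n t) < (1/4) ^ k"
    by blast
  \<comment> \<open>The partial sums make r increasing and at least \<open>N k\<close>; the added k
    makes r k at least k, so that r j passes any threshold.\<close>
  define r where "r k = (\<Sum>j\<le>k. N j) + k" for k
  have rN: "r k \<ge> N k" for k
    unfolding r_def using member_le_sum[of k "{..k}" N] by simp
  have rmono: "r j \<le> r k" if "j \<le> k" for j k
    unfolding r_def using that by (intro add_mono sum_mono2) auto
  have rk: "r k \<ge> k" for k by (simp add: r_def)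
  define d where "d k t = S (r (Suc k)) t - S (r k) t" for k t
  have [measurable]: "d k \<in> borel_measurable M" for k unfolding d_def by measurable
  have dl: "l2fun M (d k)" for k unfolding d_def by (intro l2fun_diff S)
  \<comment> \<open>The rate 1/4 leaves room for a weight 2^k: the weighted sum of |d k|^2 still has
    finite integral, hence almost everywhere |d k t| is at most a constant times sqrt(1/2)^k and the
    telescoping series converges.\<close>
  have dn: "sqnorm M (d k) < (1/4) ^ k" for k
    unfolding d_def using rN[of k] rmono[of k "Suc k"] by (intro N) auto
  have "(\<integral>\<^sup>+t. (\<Sum>k. ennreal (2 ^ k * (cmod (d k t))\<^sup>2)) \<partial>M) = (\<Sum>k. (\<integral>\<^sup>+t. ennreal (2 ^ k * (cmod (d k t))\<^sup>2) \<partial>M))"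
    by (rule nn_integral_suminf) measurable
  also have "\<dots> = (\<Sum>k. ennreal (2 ^ k * sqnorm M (d k)))"
    using l2fun_integrable[OF dl] by (subst nn_integral_eq_integral) (auto simp: sqnorm_def)
  also have "\<dots> \<le> (\<Sum>k. ennreal ((1/2) ^ k))"
  proof (intro suminf_le ennreal_leI)
    fix k :: nat
    have "2 ^ k * sqnorm M (d k) \<le> 2 ^ k * (1/4) ^ k" using dn[of k] by simp
    also have "\<dots> = (1/2) ^ k" by (simp add: power_mult_distrib[symmetric])
    finally show "2 ^ k * sqnorm M (d k) \<le> (1/2) ^ k" .
  qed auto
  also have "\<dots> = ennreal (\<Sum>k. (1/2) ^ k)"
    by (rule suminf_ennreal2) (auto simp: summable_geometric)
  finally have fin: "(\<integral>\<^sup>+t. (\<Sum>k. ennreal (2 ^ k * (cmod (d k t))\<^sup>2)) \<partial>M) \<noteq> \<infinity>"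
    by (auto simp: top_unique)
  have "AE t in M. (\<Sum>k. ennreal (2 ^ k * (cmod (d k t))\<^sup>2)) \<noteq> \<infinity>"
    by (rule nn_integral_noteq_infinite[OF _ fin]) measurable
  then have conv: "AE t in M. convergent (\<lambda>k. S (r k) t)"
  proof (rule AE_mp, intro AE_I2 impI)
    fix t assume *: "(\<Sum>k. ennreal (2 ^ k * (cmod (d k t))\<^sup>2)) \<noteq> \<infinity>"
    then have "summable (\<lambda>k. 2 ^ k * (cmod (d k t))\<^sup>2)"
      by (intro summable_suminf_not_top) auto
    then have "(\<lambda>k. 2 ^ k * (cmod (d k t))\<^sup>2) \<longlonglongrightarrow> 0" by (rule summable_LIMSEQ_zero)
    then have "Bseq (\<lambda>k. 2 ^ k * (cmod (d k t))\<^sup>2)" by (intro convergent_imp_Bseq) (auto simp: convergent_def)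
    then obtain B where B: "B > 0" "\<And>k. \<bar>2 ^ k * (cmod (d k t))\<^sup>2\<bar> \<le> B" by (auto elim!: BseqE)
    have "summable (\<lambda>k. d k t)"
    proof (rule summable_comparison_test')
      show "summable (\<lambda>k. sqrt B * (sqrt (1/2)) ^ k)"
        by (intro summable_mult summable_geometric) (simp add: real_sqrt_divide)
      fix k :: nat assume "k \<ge> 0"
      have "(cmod (d k t))\<^sup>2 \<le> B * (1/2) ^ k"
        using B(2)[of k] by (simp add: field_simps power_divide)
      then have "cmod (d k t) \<le> sqrt (B * (1/2) ^ k)" by (rule real_le_rsqrt)
      then show "norm (d k t) \<le> sqrt B * (sqrt (1/2)) ^ k"
        by (simp add: real_sqrt_mult real_sqrt_power)
    qed
    then have "convergent (\<lambda>n. \<Sum>k<n. d k t)" by (simp add: summable_iff_convergent)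
    moreover have "(\<Sum>k<n. d k t) = S (r n) t - S (r 0) t" for n
      unfolding d_def by (rule sum_lessThan_telescope)
    ultimately have "convergent (\<lambda>n. S (r n) t - S (r 0) t)" by simp
    from convergent_add[OF this convergent_const[of "S (r 0) t"]] show "convergent (\<lambda>k. S (r k) t)" by simp
  qed
  define f where "f t = lim (\<lambda>k. S (r k) t)" for t
  have fm [measurable]: "f \<in> borel_measurable M" unfolding f_def by measurable
  have lim: "AE t in M. (\<lambda>k. S (r k) t) \<longlonglongrightarrow> f t"
    using conv by eventually_elim (simp add: convergent_LIMSEQ_iff f_def)
  \<comment> \<open>Fatou is applied along the subsequence with n fixed, so the estimate holds for
    all n from \<open>N k\<close> on and not merely for subsequence members.\<close>
  have bound: "l2fun M (\<lambda>t. f t - S n t) \<and> sqnorm M (\<lambda>t. f t - S n t) \<le> (1/4) ^ k" if n: "n \<ge> N k" for n k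
  proof -
    have "(\<integral>\<^sup>+t. ennreal ((cmod (f t - S n t))\<^sup>2) \<partial>M) \<le> (\<integral>\<^sup>+t. liminf (\<lambda>j. ennreal ((cmod (S (r j) t - S n t))\<^sup>2)) \<partial>M)"
    proof (rule nn_integral_mono_AE)
      show "AE t in M. ennreal ((cmod (f t - S n t))\<^sup>2) \<le> liminf (\<lambda>j. ennreal ((cmod (S (r j) t - S n t))\<^sup>2))"
        using lim
      proof eventually_elim
        case (elim t)
        then have "(\<lambda>j. ennreal ((cmod (S (r j) t - S n t))\<^sup>2)) \<longlonglongrightarrow> ennreal ((cmod (f t - S n t))\<^sup>2)"
          by (intro tendsto_intros)
        from lim_imp_Liminf[OF trivial_limit_sequentially this] show ?case by (simp only: order_refl)
      qed
    qed
    also have "\<dots> \<le> liminf (\<lambda>j. \<integral>\<^sup>+t. ennreal ((cmod (S (r j) t - S n t))\<^sup>2) \<partial>M)"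
      by (rule nn_integral_liminf) measurable
    also have "\<dots> \<le> ennreal ((1/4) ^ k)"
    proof -
      have "\<forall>\<^sub>F j in sequentially. (\<integral>\<^sup>+t. ennreal ((cmod (S (r j) t - S n t))\<^sup>2) \<partial>M) \<le> ennreal ((1/4) ^ k)"
        unfolding eventually_sequentially
      proof (intro exI[of _ "N k"] allI impI)
        fix j assume "N k \<le> j"
        then have "sqnorm M (\<lambda>t. S (r j) t - S n t) < (1/4) ^ k"
          using n rk[of j] by (intro N) auto
        then show "(\<integral>\<^sup>+t. ennreal ((cmod (S (r j) t - S n t))\<^sup>2) \<partial>M) \<le> ennreal ((1/4) ^ k)"
          using l2fun_integrable[OF l2fun_diff[OF S S]]
          by (subst nn_integral_eq_integral) (auto simp: sqnorm_def intro: ennreal_leI)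
      qed
      then show ?thesis
        by (rule order_trans[OF Liminf_le_Limsup[OF trivial_limit_sequentially] Limsup_bounded])
    qed
    finally have le: "(\<integral>\<^sup>+t. ennreal ((cmod (f t - S n t))\<^sup>2) \<partial>M) \<le> ennreal ((1/4) ^ k)" .
    then have i: "integrable M (\<lambda>t. (cmod (f t - S n t))\<^sup>2)"
      by (intro integrableI_bounded) (auto simp: top_unique less_top[symmetric])
    then have "l2fun M (\<lambda>t. f t - S n t)" by (simp add: l2fun_def)
    moreover have "sqnorm M (\<lambda>t. f t - S n t) \<le> (1/4) ^ k"
      using le i by (subst (asm) nn_integral_eq_integral) (auto simp: sqnorm_def)
    ultimately show ?thesis by blast
  qed
  have "l2fun M f"
    using l2fun_add[OF _ S, of "\<lambda>t. f t - S (N 0) t" "N 0"] bound[of 0 "N 0"] by simp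
  moreover have "(\<lambda>n. sqnorm M (\<lambda>t. f t - S n t)) \<longlonglongrightarrow> 0"
  proof (rule LIMSEQ_I)
    fix e :: real assume "e > 0"
    then obtain k where k: "(1/4 :: real) ^ k < e" using real_arch_pow_inv[of e "1/4"] by auto
    have "norm (sqnorm M (\<lambda>t. f t - S n t) - 0) < e" if "n \<ge> N k" for n
      using bound[OF that] k by simp
    then show "\<exists>no. \<forall>n\<ge>no. norm (sqnorm M (\<lambda>t. f t - S n t) - 0) < e" by blast
  qed
  ultimately show ?thesis by blast
qed

section \<open>Coefficients with respect to real orthonormal systems\<close>

definition fcoef :: "'a measure \<Rightarrow> ('a \<Rightarrow> real) \<Rightarrow> ('a \<Rightarrow> complex) \<Rightarrow> complex" where
  "fcoef M e f = (\<integral>t. f t * complex_of_real (e t) \<partial>M)"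

definition orthonormal :: "'a measure \<Rightarrow> 'i set \<Rightarrow> ('i \<Rightarrow> 'a \<Rightarrow> real) \<Rightarrow> bool" where
  "orthonormal M I e \<longleftrightarrow> (\<forall>i\<in>I. l2fun M (\<lambda>t. of_real (e i t))) \<and>
     (\<forall>i\<in>I. \<forall>j\<in>I. (\<integral>t. e i t * e j t \<partial>M) = (if i = j then 1 else 0))"

text \<open>Completeness is stated as totality; Parseval's identity is derived from it. An index set
  in place of a whole type allows words of one fixed length to index the basis on
  \<open>Mn n\<close>.\<close>

definition onb :: "'a measure \<Rightarrow> 'i set \<Rightarrow> ('i \<Rightarrow> 'a \<Rightarrow> real) \<Rightarrow> bool" where
  "onb M I e \<longleftrightarrow> orthonormal M I e \<and>
     (\<forall>f. l2fun M f \<longrightarrow> (\<forall>i\<in>I. fcoef M (e i) f = 0) \<longrightarrow> (AE t in M. f t = 0))"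

lemma fcoef_add:
  assumes "l2fun M (\<lambda>t. of_real (e t))" "l2fun M f" "l2fun M g"
  shows "fcoef M e (\<lambda>t. f t + g t) = fcoef M e f + fcoef M e g"
  unfolding fcoef_def distrib_right by (intro Bochner_Integration.integral_add l2fun_prod_integrable assms)

lemma fcoef_cmult: "fcoef M e (\<lambda>t. c * f t) = c * fcoef M e f"
  by (simp add: fcoef_def mult.assoc)

lemma fcoef_diff:
  assumes "l2fun M (\<lambda>t. of_real (e t))" "l2fun M f" "l2fun M g"
  shows "fcoef M e (\<lambda>t. f t - g t) = fcoef M e f - fcoef M e g"
  unfolding fcoef_def left_diff_distrib by (intro Bochner_Integration.integral_diff l2fun_prod_integrable assms)

lemma fcoef_sum:
  assumes "l2fun M (\<lambda>t. of_real (e t))" "\<And>i. i \<in> F \<Longrightarrow> l2fun M (f i)"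
  shows "fcoef M e (\<lambda>t. \<Sum>i\<in>F. f i t) = (\<Sum>i\<in>F. fcoef M e (f i))"
  using assms(2)
proof (induction F rule: infinite_finite_induct)
  case (insert x F)
  then show ?case by (simp add: fcoef_add[OF assms(1)] l2fun_sum)
qed (simp_all add: fcoef_def)

lemma fcoef_cong_AE:
  assumes [measurable]: "f \<in> borel_measurable M" "g \<in> borel_measurable M" "e \<in> borel_measurable M"
    and "AE t in M. f t = g t"
  shows "fcoef M e f = fcoef M e g"
  unfolding fcoef_def using assms(4) by (intro integral_cong_AE) auto

lemma fcoef_basis:
  assumes "orthonormal M I e" "i \<in> I" "j \<in> I"
  shows "fcoef M (e i) (\<lambda>t. of_real (e j t)) = (if i = j then 1 else 0)"
proof -
  have "fcoef M (e i) (\<lambda>t. of_real (e j t)) = of_real (\<integral>t. e j t * e i t \<partial>M)"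
    unfolding fcoef_def by (simp flip: of_real_mult)
  then show ?thesis using assms by (auto simp: orthonormal_def)
qed

lemma fcoef_bound:
  assumes "l2fun M (\<lambda>t. of_real (e t))" "l2fun M f"
  shows "(cmod (fcoef M e f))\<^sup>2 \<le> sqnorm M f * sqnorm M (\<lambda>t. of_real (e t))"
  unfolding fcoef_def by (rule l2_Cauchy_Schwarz[OF assms(2,1)])

definition lincomb :: "('i \<Rightarrow> 'a \<Rightarrow> real) \<Rightarrow> 'i set \<Rightarrow> ('i \<Rightarrow> complex) \<Rightarrow> 'a \<Rightarrow> complex" where
  "lincomb e F c t = (\<Sum>i\<in>F. c i * of_real (e i t))"

lemma l2fun_lincomb: "orthonormal M I e \<Longrightarrow> F \<subseteq> I \<Longrightarrow> l2fun M (lincomb e F c)"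
  unfolding lincomb_def[abs_def] by (intro l2fun_sum l2fun_cmult) (auto simp: orthonormal_def)

lemma fcoef_lincomb:
  assumes "orthonormal M I e" "finite F" "F \<subseteq> I" "i \<in> I"
  shows "fcoef M (e i) (lincomb e F c) = (if i \<in> F then c i else 0)"
proof -
  have "fcoef M (e i) (lincomb e F c) = (\<Sum>j\<in>F. c j * fcoef M (e i) (\<lambda>t. of_real (e j t)))"
    unfolding lincomb_def[abs_def]
    by (subst fcoef_sum) (use assms in \<open>auto simp: orthonormal_def fcoef_cmult intro!: l2fun_cmult\<close>)
  also have "\<dots> = (\<Sum>j\<in>F. if i = j then c j else 0)"
    using assms by (intro sum.cong) (auto simp: fcoef_basis[OF assms(1)])
  finally show ?thesis using assms(2) by simp
qed

lemma integral_lincomb: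
  assumes "orthonormal M I e" "finite F" "F \<subseteq> I" "l2fun M f"
  shows "(\<integral>t. f t * cnj (lincomb e F c t) \<partial>M) = (\<Sum>i\<in>F. cnj (c i) * fcoef M (e i) f)"
proof -
  have i: "integrable M (\<lambda>t. cnj (c i) * (f t * of_real (e i t)))" if "i \<in> F" for i
    using assms that by (intro integrable_mult_right l2fun_prod_integrable) (auto simp: orthonormal_def)
  have "(\<integral>t. f t * cnj (lincomb e F c t) \<partial>M) = (\<integral>t. (\<Sum>i\<in>F. cnj (c i) * (f t * of_real (e i t))) \<partial>M)"
    by (rule Bochner_Integration.integral_cong) (auto simp: lincomb_def sum_distrib_left mult_ac)
  also have "\<dots> = (\<Sum>i\<in>F. \<integral>t. cnj (c i) * (f t * of_real (e i t)) \<partial>M)"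
    by (rule Bochner_Integration.integral_sum) (rule i)
  finally show ?thesis by (simp add: fcoef_def)
qed

lemma sqnorm_lincomb:
  assumes "orthonormal M I e" "finite F" "F \<subseteq> I"
  shows "sqnorm M (lincomb e F c) = (\<Sum>i\<in>F. (cmod (c i))\<^sup>2)"
proof -
  have "complex_of_real (sqnorm M (lincomb e F c)) = (\<integral>t. lincomb e F c t * cnj (lincomb e F c t) \<partial>M)"
    unfolding sqnorm_def by (simp flip: complex_norm_square of_real_power)
  also have "\<dots> = (\<Sum>i\<in>F. cnj (c i) * c i)"
    using assms by (subst integral_lincomb[OF assms(1,2,3) l2fun_lincomb[OF assms(1,3)]])
      (auto intro!: sum.cong simp: fcoef_lincomb subset_iff)
  also have "\<dots> = complex_of_real (\<Sum>i\<in>F. (cmod (c i))\<^sup>2)"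
    unfolding of_real_sum by (intro sum.cong refl) (simp only: complex_norm_square mult.commute)
  finally show ?thesis by (simp only: of_real_eq_iff)
qed

lemma Bessel:
  assumes "orthonormal M I e" "finite F" "F \<subseteq> I" "l2fun M f"
  shows "(\<Sum>i\<in>F. (cmod (fcoef M (e i) f))\<^sup>2) \<le> sqnorm M f"
proof -
  let ?c = "\<lambda>i. - fcoef M (e i) f"
  have "0 \<le> sqnorm M (\<lambda>t. f t + lincomb e F ?c t)" by simp
  also have "\<dots> = sqnorm M f + (\<Sum>i\<in>F. (cmod (?c i))\<^sup>2) + 2 * Re (\<Sum>i\<in>F. cnj (?c i) * fcoef M (e i) f)"
    by (simp add: sqnorm_add[OF assms(4) l2fun_lincomb[OF assms(1,3)]] sqnorm_lincomb[OF assms(1-3)]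
        integral_lincomb[OF assms])
  also have "(\<Sum>i\<in>F. cnj (?c i) * fcoef M (e i) f) = - of_real (\<Sum>i\<in>F. (cmod (fcoef M (e i) f))\<^sup>2)"
    unfolding of_real_sum sum_negf[symmetric]
    by (intro sum.cong refl) (simp only: complex_norm_square mult.commute complex_cnj_minus mult_minus_left mult_minus_right)
  finally show ?thesis by simp
qed

definition coefs :: "'a measure \<Rightarrow> 'i set \<Rightarrow> ('i \<Rightarrow> 'a \<Rightarrow> real) \<Rightarrow> ('a \<Rightarrow> complex) \<Rightarrow> 'i ell2" where
  "coefs M I e f = Ell2 (\<lambda>i. if i \<in> I then fcoef M (e i) f else 0)"

lemma coord_coefs:
  assumes "orthonormal M I e" "l2fun M f"
  shows "coord (coefs M I e f) i = (if i \<in> I then fcoef M (e i) f else 0)"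
proof -
  have "square_summable (\<lambda>i. if i \<in> I then fcoef M (e i) f else 0)"
  proof (rule square_summableI_finite)
    fix F :: "'b set" assume "finite F"
    have "(\<Sum>i\<in>F. (cmod (if i \<in> I then fcoef M (e i) f else 0))\<^sup>2) = (\<Sum>i\<in>F \<inter> I. (cmod (fcoef M (e i) f))\<^sup>2)"
      using \<open>finite F\<close> by (intro sum.mono_neutral_cong_right) auto
    also have "\<dots> \<le> sqnorm M f"
      using \<open>finite F\<close> by (intro Bessel[OF assms(1) _ _ assms(2)]) auto
    finally show "(\<Sum>i\<in>F. (cmod (if i \<in> I then fcoef M (e i) f else 0))\<^sup>2) \<le> sqnorm M f" .
  qed
  then show ?thesis by (simp add: coefs_def)
qed

text \<open>Finite truncations of a are synthesised isometrically, so they form a Cauchy sequence of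
  functions, whose limit has coefficients a. The norm is part of the conclusion because Parseval's
  identity is deduced from it.\<close>

lemma Riesz_Fischer:
  assumes on: "orthonormal M I e" and a: "supported_in I a"
  shows "\<exists>f. l2fun M f \<and> coefs M I e f = a \<and> sqnorm M f = (norm a)\<^sup>2"
proof -
  have "\<exists>F. finite F \<and> norm (a - (\<Sum>x\<in>F. cscale (coord a x) (unit x))) \<le> 1 / real (Suc n)" for n
    by (rule ell2_approx[of "1 / real (Suc n)" a]) auto
  then obtain F0 where F0: "\<And>n. finite (F0 n)" "\<And>n. norm (a - (\<Sum>x\<in>F0 n. cscale (coord a x) (unit x))) \<le> 1 / real (Suc n)"
    by metis
  \<comment> \<open>The approximating sets may contain indices outside I; a vanishes there, so
    cutting them off leaves the approximants unchanged.\<close>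
  define F where "F n = F0 n \<inter> I" for n
  define p where "p n = (\<Sum>x\<in>F n. cscale (coord a x) (unit x))" for n
  have F: "finite (F n)" "F n \<subseteq> I" for n using F0 by (auto simp: F_def)
  have "p n = (\<Sum>x\<in>F0 n. cscale (coord a x) (unit x))" for n
    unfolding p_def F_def
  proof (rule sum.mono_neutral_left)
    show "\<forall>i\<in>F0 n - F0 n \<inter> I. cscale (coord a i) (unit i) = 0"
      using a by (auto simp: supported_in_def intro!: ell2_eqI)
  qed (use F0 in auto)
  then have p: "norm (a - p n) \<le> 1 / real (Suc n)" for n using F0(2)[of n] by simp
  have cp: "coord (p n) i = (if i \<in> F n then coord a i else 0)" for n i
    using F(1)[of n] by (simp add: p_def if_distrib cong: if_cong)
  define S where "S n = lincomb e (F n) (coord a)" for n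
  have Sl: "l2fun M (S n)" for n unfolding S_def by (rule l2fun_lincomb[OF on F(2)])
  have Sd: "sqnorm M (\<lambda>t. S m t - S n t) \<le> (norm (p m - p n))\<^sup>2" for m n
  proof -
    let ?c = "\<lambda>i. (if i \<in> F m then coord a i else 0) - (if i \<in> F n then coord a i else 0)"
    have "(\<lambda>t. S m t - S n t) = lincomb e (F m \<union> F n) ?c"
    proof
      fix t
      have "lincomb e (F m \<union> F n) ?c t = (\<Sum>i\<in>F m \<union> F n. (if i \<in> F m then coord a i * of_real (e i t) else 0)
          - (if i \<in> F n then coord a i * of_real (e i t) else 0))"
        unfolding lincomb_def by (rule sum.cong) auto
      also have "\<dots> = S m t - S n t"
        unfolding sum_subtractf S_def lincomb_def
        by (intro arg_cong2[of _ _ _ _ "(-)"] sum.mono_neutral_cong_right) (use F in auto)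
      finally show "S m t - S n t = lincomb e (F m \<union> F n) ?c t" by simp
    qed
    then have "sqnorm M (\<lambda>t. S m t - S n t) = (\<Sum>i\<in>F m \<union> F n. (cmod (coord (p m - p n) i))\<^sup>2)"
      using F by (simp add: sqnorm_lincomb[OF on] cp)
    also have "\<dots> \<le> (norm (p m - p n))\<^sup>2" by (rule sum_norm_sq_le)
    finally show ?thesis .
  qed
  have plim: "p \<longlonglongrightarrow> a"
  proof -
    have "(\<lambda>n. norm (p n - a)) \<longlonglongrightarrow> 0"
      by (rule tendsto_sandwich[OF _ _ tendsto_const LIMSEQ_Suc[OF lim_1_over_n]])
        (use p in \<open>auto simp: norm_minus_commute\<close>)
    then show ?thesis by (simp add: LIM_zero_iff tendsto_norm_zero_iff)
  qed
  have "\<exists>f. l2fun M f \<and> (\<lambda>n. sqnorm M (\<lambda>t. f t - S n t)) \<longlonglongrightarrow> 0"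
  proof (rule l2_complete[OF Sl])
    fix e :: real assume "e > 0"
    then obtain N where N: "\<And>m n. m \<ge> N \<Longrightarrow> n \<ge> N \<Longrightarrow> norm (p m - p n) < sqrt e"
      using LIMSEQ_imp_Cauchy[OF plim] unfolding Cauchy_iff by (meson real_sqrt_gt_0_iff)
    have "sqnorm M (\<lambda>t. S m t - S n t) < e" if "m \<ge> N" "n \<ge> N" for m n
    proof -
      have "(norm (p m - p n))\<^sup>2 < (sqrt e)\<^sup>2" using N[OF that] by (intro power_strict_mono) auto
      then show ?thesis using Sd[of m n] \<open>e > 0\<close> by simp
    qed
    then show "\<exists>N. \<forall>m\<ge>N. \<forall>n\<ge>N. sqnorm M (\<lambda>t. S m t - S n t) < e" by blast
  qed
  then obtain f where f: "l2fun M f" and flim: "(\<lambda>n. sqnorm M (\<lambda>t. f t - S n t)) \<longlonglongrightarrow> 0" by blast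
  have "fcoef M (e i) f = coord a i" if i: "i \<in> I" for i
  proof -
    have ei: "l2fun M (\<lambda>t. of_real (e i t))" using on i by (simp add: orthonormal_def)
    have "(\<lambda>n. fcoef M (e i) f - fcoef M (e i) (S n)) \<longlonglongrightarrow> 0"
    proof (rule Lim_null_comparison)
      show "\<forall>\<^sub>F n in sequentially. norm (fcoef M (e i) f - fcoef M (e i) (S n))
          \<le> sqrt (sqnorm M (\<lambda>t. f t - S n t) * sqnorm M (\<lambda>t. of_real (e i t)))"
        using fcoef_bound[OF ei l2fun_diff[OF f Sl]]
        by (intro always_eventually allI real_le_rsqrt) (simp add: fcoef_diff[OF ei f Sl])
      show "(\<lambda>n. sqrt (sqnorm M (\<lambda>t. f t - S n t) * sqnorm M (\<lambda>t. of_real (e i t)))) \<longlonglongrightarrow> 0"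
        using tendsto_real_sqrt[OF tendsto_mult_right[OF flim, of "sqnorm M (\<lambda>t. of_real (e i t))"]] by simp
    qed
    moreover have "fcoef M (e i) (S n) = coord (p n) i" for n
      unfolding S_def by (simp add: fcoef_lincomb[OF on F i] cp)
    ultimately have "(\<lambda>n. fcoef M (e i) f - coord (p n) i) \<longlonglongrightarrow> 0" by simp
    from tendsto_diff[OF tendsto_const[of "fcoef M (e i) f"] this]
    have "(\<lambda>n. coord (p n) i) \<longlonglongrightarrow> fcoef M (e i) f" by simp
    moreover have "(\<lambda>n. coord (p n) i) \<longlonglongrightarrow> coord a i"
    proof -
      have "(\<lambda>n. coord (p n) i - coord a i) \<longlonglongrightarrow> 0"
      proof (rule Lim_null_comparison)
        show "\<forall>\<^sub>F n in sequentially. norm (coord (p n) i - coord a i) \<le> norm (p n - a)"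
          using coord_le_norm[of "p _ - a" i] by (intro always_eventually allI) simp
      qed (use plim in \<open>simp add: LIM_zero_iff tendsto_norm_zero_iff\<close>)
      then show ?thesis by (simp add: LIM_zero_iff)
    qed
    ultimately show ?thesis by (rule LIMSEQ_unique)
  qed
  then have "coefs M I e f = a"
    using a by (intro ell2_eqI) (auto simp: coord_coefs[OF on f] supported_in_def)
  moreover have "sqnorm M f = (norm a)\<^sup>2"
  proof -
    have Sn: "sqnorm M (S n) = (norm (p n))\<^sup>2" for n
    proof -
      have "(norm (p n))\<^sup>2 = (\<Sum>\<^sub>\<infinity>i\<in>F n. (cmod (coord a i))\<^sup>2)"
        unfolding norm_ell2_sq by (rule infsum_cong_neutral) (auto simp: cp)
      then show ?thesis using F(1)[of n] by (simp add: S_def sqnorm_lincomb[OF on F])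
    qed
    have "(\<lambda>n. sqrt (sqnorm M (S n))) \<longlonglongrightarrow> sqrt (sqnorm M f)"
    proof -
      have z: "(\<lambda>n. sqrt (sqnorm M (\<lambda>t. f t - S n t))) \<longlonglongrightarrow> 0"
        using tendsto_real_sqrt[OF flim] by simp
      have "(\<lambda>n. sqrt (sqnorm M f) - sqrt (sqnorm M (S n))) \<longlonglongrightarrow> 0"
      proof (rule Lim_null_comparison[OF _ z], intro always_eventually allI)
        fix n
        have "sqrt (sqnorm M (\<lambda>t. (f t - S n t) + S n t)) \<le> sqrt (sqnorm M (\<lambda>t. f t - S n t)) + sqrt (sqnorm M (S n))"
          by (rule sqnorm_triangle[OF l2fun_diff[OF f Sl] Sl])
        moreover have "sqrt (sqnorm M (\<lambda>t. -1 * (f t - S n t) + f t)) \<le> sqrt (sqnorm M (\<lambda>t. -1 * (f t - S n t))) + sqrt (sqnorm M f)"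
          by (rule sqnorm_triangle[OF l2fun_cmult[OF l2fun_diff[OF f Sl]] f])
        ultimately show "norm (sqrt (sqnorm M f) - sqrt (sqnorm M (S n))) \<le> sqrt (sqnorm M (\<lambda>t. f t - S n t))"
          unfolding sqnorm_cmult by (simp add: abs_le_iff)
      qed
      from tendsto_diff[OF tendsto_const[of "sqrt (sqnorm M f)"] this] show ?thesis by simp
    qed
    moreover have "(\<lambda>n. norm (p n)) \<longlonglongrightarrow> norm a" using plim by (rule tendsto_norm)
    ultimately have "sqrt (sqnorm M f) = norm a"
      unfolding Sn by (auto intro: LIMSEQ_unique)
    then show ?thesis by (metis real_sqrt_pow2 sqnorm_nonneg)
  qed
  ultimately show ?thesis using f by blast
qed

lemma onbD: "onb M I e \<Longrightarrow> orthonormal M I e"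
  by (simp add: onb_def)

lemma onb_l2fun: "onb M I e \<Longrightarrow> i \<in> I \<Longrightarrow> l2fun M (\<lambda>t. of_real (e i t))"
  by (simp add: onb_def orthonormal_def)

lemma onb_AE_eq:
  assumes o: "onb M I e" and f: "l2fun M f" and g: "l2fun M g" and eq: "coefs M I e f = coefs M I e g"
  shows "AE t in M. f t = g t"
proof -
  have "fcoef M (e i) (\<lambda>t. f t - g t) = 0" if "i \<in> I" for i
    using coord_coefs[OF onbD[OF o] f, of i] coord_coefs[OF onbD[OF o] g, of i] that
    by (simp add: fcoef_diff[OF onb_l2fun[OF o that] f g] eq)
  then have "AE t in M. f t - g t = 0"
    using o l2fun_diff[OF f g] unfolding onb_def by blast
  then show ?thesis by eventually_elim simp
qed

text \<open>The function synthesised from the coefficients of f has the right norm, and by totality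
  it agrees with f almost everywhere.\<close>

lemma Parseval:
  assumes o: "onb M I e" and f: "l2fun M f"
  shows "sqnorm M f = (norm (coefs M I e f))\<^sup>2"
proof -
  have "supported_in I (coefs M I e f)"
    by (simp add: supported_in_def coord_coefs[OF onbD[OF o] f])
  then obtain g where g: "l2fun M g" "coefs M I e g = coefs M I e f" "sqnorm M g = (norm (coefs M I e f))\<^sup>2"
    using Riesz_Fischer[OF onbD[OF o]] by blast
  have "AE t in M. g t = f t" by (rule onb_AE_eq[OF o g(1) f g(2)])
  then have "sqnorm M g = sqnorm M f"
    by (rule sqnorm_cong_AE[OF l2fun_measurable[OF g(1)] l2fun_measurable[OF f]])
  then show ?thesis using g(3) by simp
qed

lemma coefs_add:
  assumes "orthonormal M I e" "l2fun M f" "l2fun M g"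
  shows "coefs M I e (\<lambda>t. f t + g t) = coefs M I e f + coefs M I e g"
proof (rule ell2_eqI)
  fix i
  have "i \<in> I \<Longrightarrow> l2fun M (\<lambda>t. of_real (e i t))" using assms by (simp add: orthonormal_def)
  then show "coord (coefs M I e (\<lambda>t. f t + g t)) i = coord (coefs M I e f + coefs M I e g) i"
    using assms by (simp add: coord_coefs[OF assms(1)] l2fun_add fcoef_add)
qed

lemma coefs_cmult:
  assumes "orthonormal M I e" "l2fun M f"
  shows "coefs M I e (\<lambda>t. c * f t) = cscale c (coefs M I e f)"
  by (intro ell2_eqI) (simp add: coord_coefs[OF assms(1)] assms(2) l2fun_cmult fcoef_cmult)

text \<open>Polarisation: real parts come from the norm of a sum, and imaginary parts from the same
  identity for -i f.\<close>

lemma Parseval_cip: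
  assumes o: "onb M I e" and f: "l2fun M f" and g: "l2fun M g"
  shows "(\<integral>t. f t * cnj (g t) \<partial>M) = cip (coefs M I e f) (coefs M I e g)"
proof -
  have Re: "Re (\<integral>t. h t * cnj (g t) \<partial>M) = Re (cip (coefs M I e h) (coefs M I e g))" if h: "l2fun M h" for h
  proof -
    have "sqnorm M (\<lambda>t. h t + g t) = (norm (coefs M I e h + coefs M I e g))\<^sup>2"
      by (simp add: Parseval[OF o] l2fun_add h g coefs_add[OF onbD[OF o]])
    then have "2 * Re (\<integral>t. h t * cnj (g t) \<partial>M) = 2 * inner (coefs M I e h) (coefs M I e g)"
      unfolding sqnorm_add[OF h g]
      by (simp add: Parseval[OF o h] Parseval[OF o g] power2_norm_eq_inner inner_add inner_commute)
    then show ?thesis by (simp add: Re_cip)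
  qed
  have "Re (\<integral>t. (- \<i> * f t) * cnj (g t) \<partial>M) = Re (cip (coefs M I e (\<lambda>t. - \<i> * f t)) (coefs M I e g))"
    by (rule Re[OF l2fun_cmult[OF f]])
  moreover have "(\<integral>t. (- \<i> * f t) * cnj (g t) \<partial>M) = - \<i> * (\<integral>t. f t * cnj (g t) \<partial>M)"
    unfolding mult.assoc by (rule integral_mult_right_zero)
  ultimately have "Im (\<integral>t. f t * cnj (g t) \<partial>M) = Im (cip (coefs M I e f) (coefs M I e g))"
    unfolding coefs_cmult[OF onbD[OF o] f] cip_cscale_left by simp
  then show ?thesis using Re[OF f] by (simp add: complex_eq_iff)
qed

section \<open>Tensor products of orthonormal bases\<close>

lemma l2fun_tensor:
  assumes "sigma_finite_measure A" "sigma_finite_measure B" and h [measurable]: "l2fun A h" and k [measurable]: "l2fun B k"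
  shows "l2fun (A \<Otimes>\<^sub>M B) (\<lambda>z. h (fst z) * k (snd z))"
proof -
  interpret pair_sigma_finite A B by (simp add: pair_sigma_finite_def assms)
  have [measurable]: "h \<in> borel_measurable A" "k \<in> borel_measurable B"
    using h k by (auto intro: l2fun_measurable)
  have "integrable (A \<Otimes>\<^sub>M B) (\<lambda>z. (cmod (h (fst z) * k (snd z)))\<^sup>2)"
    using l2fun_integrable[OF h] l2fun_integrable[OF k]
    by (intro Fubini_integrable) (auto simp: norm_mult power_mult_distrib)
  moreover have "(\<lambda>z. h (fst z) * k (snd z)) \<in> borel_measurable (A \<Otimes>\<^sub>M B)" by measurable
  ultimately show ?thesis by (simp add: l2fun_def)
qed

lemma l2fun_slice:
  assumes "sigma_finite_measure A" "sigma_finite_measure B"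
    and F [measurable]: "l2fun (A \<Otimes>\<^sub>M B) F" and k [measurable]: "l2fun B k"
  shows "l2fun A (\<lambda>s. \<integral>t. F (s, t) * k t \<partial>B)"
proof -
  interpret pair_sigma_finite A B by (simp add: pair_sigma_finite_def assms)
  have mF [measurable]: "F \<in> borel_measurable (A \<Otimes>\<^sub>M B)" by (rule l2fun_measurable[OF F])
  have mk [measurable]: "k \<in> borel_measurable B" by (rule l2fun_measurable[OF k])
  have iF: "integrable A (\<lambda>s. \<integral>t. (cmod (F (s, t)))\<^sup>2 \<partial>B)"
    by (rule integrable_fst'[OF l2fun_integrable[OF F]])
  have "AE s in A. integrable B (\<lambda>t. (cmod (F (s, t)))\<^sup>2)"
    by (rule AE_integrable_fst'[OF l2fun_integrable[OF F]])
  then have "AE s in A. (cmod (\<integral>t. F (s, t) * k t \<partial>B))\<^sup>2 \<le> sqnorm B k * (\<integral>t. (cmod (F (s, t)))\<^sup>2 \<partial>B)"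
  proof (rule AE_mp, intro AE_I2 impI)
    fix s assume s: "s \<in> space A" and "integrable B (\<lambda>t. (cmod (F (s, t)))\<^sup>2)"
    then have "l2fun B (\<lambda>t. F (s, t))" using measurable_Pair2[OF mF s] by (simp add: l2fun_def)
    from l2_Cauchy_Schwarz[OF this k]
    show "(cmod (\<integral>t. F (s, t) * k t \<partial>B))\<^sup>2 \<le> sqnorm B k * (\<integral>t. (cmod (F (s, t)))\<^sup>2 \<partial>B)"
      by (simp add: sqnorm_def mult.commute)
  qed
  then have "integrable A (\<lambda>s. (cmod (\<integral>t. F (s, t) * k t \<partial>B))\<^sup>2)"
    by (intro Bochner_Integration.integrable_bound[OF integrable_mult_right[OF iF, of "sqnorm B k"]]) auto
  moreover have "(\<lambda>s. \<integral>t. F (s, t) * k t \<partial>B) \<in> borel_measurable A"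
    by measurable
  ultimately show ?thesis by (simp add: l2fun_def)
qed

lemma integral_slice:
  assumes "sigma_finite_measure A" "sigma_finite_measure B"
    and F [measurable]: "l2fun (A \<Otimes>\<^sub>M B) F" and h: "l2fun A h" and k: "l2fun B k"
  shows "(\<integral>s. (\<integral>t. F (s, t) * k t \<partial>B) * h s \<partial>A) = (\<integral>z. F z * (h (fst z) * k (snd z)) \<partial>(A \<Otimes>\<^sub>M B))"
proof -
  interpret pair_sigma_finite A B by (simp add: pair_sigma_finite_def assms)
  have "integrable (A \<Otimes>\<^sub>M B) (\<lambda>z. F z * (h (fst z) * k (snd z)))"
    by (rule l2fun_prod_integrable[OF F l2fun_tensor[OF assms(1,2) h k]])
  from integral_fst'[OF this]
  have "(\<integral>z. F z * (h (fst z) * k (snd z)) \<partial>(A \<Otimes>\<^sub>M B)) = (\<integral>s. (\<integral>t. h s * (F (s, t) * k t) \<partial>B) \<partial>A)"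
    by (simp add: mult_ac)
  also have "\<dots> = (\<integral>s. (\<integral>t. F (s, t) * k t \<partial>B) * h s \<partial>A)"
    by (simp add: mult.commute)
  finally show ?thesis by simp
qed

lemma l2fun_swap:
  assumes "sigma_finite_measure A" "sigma_finite_measure B" and F: "l2fun (A \<Otimes>\<^sub>M B) F"
  shows "l2fun (B \<Otimes>\<^sub>M A) (\<lambda>(t, s). F (s, t))"
proof -
  interpret pair_sigma_finite A B by (simp add: pair_sigma_finite_def assms)
  have "integrable (B \<Otimes>\<^sub>M A) (\<lambda>(t, s). (cmod (F (s, t)))\<^sup>2)"
    by (rule integrable_product_swap[OF l2fun_integrable[OF F]])
  moreover have "(\<lambda>(t, s). F (s, t)) \<in> borel_measurable (B \<Otimes>\<^sub>M A)"
    using l2fun_measurable[OF F] by measurable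
  ultimately show ?thesis by (simp add: l2fun_def case_prod_unfold)
qed

lemma integral_slice_swap:
  assumes "sigma_finite_measure A" "sigma_finite_measure B"
    and F [measurable]: "l2fun (A \<Otimes>\<^sub>M B) F" and h: "l2fun A h" and k: "l2fun B k"
  shows "(\<integral>t. (\<integral>s. h s * F (s, t) \<partial>A) * k t \<partial>B) = (\<integral>s. (\<integral>t. F (s, t) * k t \<partial>B) * h s \<partial>A)"
proof -
  interpret pair_sigma_finite A B by (simp add: pair_sigma_finite_def assms)
  interpret Q: pair_sigma_finite B A by (simp add: pair_sigma_finite_def assms)
  have "(\<integral>t. (\<integral>s. (\<lambda>(t, s). F (s, t)) (t, s) * h s \<partial>A) * k t \<partial>B)
      = (\<integral>z. (\<lambda>(t, s). F (s, t)) z * (k (fst z) * h (snd z)) \<partial>(B \<Otimes>\<^sub>M A))"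
    by (rule integral_slice[OF assms(2,1) l2fun_swap[OF assms(1-3)] k h])
  also have "\<dots> = (\<integral>(x, y). (\<lambda>z. F z * (h (fst z) * k (snd z))) (y, x) \<partial>(B \<Otimes>\<^sub>M A))"
    by (rule Bochner_Integration.integral_cong) (auto simp: mult_ac)
  also have "\<dots> = (\<integral>z. F z * (h (fst z) * k (snd z)) \<partial>(A \<Otimes>\<^sub>M B))"
  proof (rule integral_product_swap)
    show "(\<lambda>z. F z * (h (fst z) * k (snd z))) \<in> borel_measurable (A \<Otimes>\<^sub>M B)"
      by (rule borel_measurable_integrable[OF l2fun_prod_integrable[OF F l2fun_tensor[OF assms(1,2) h k]]])
  qed
  also have "\<dots> = (\<integral>s. (\<integral>t. F (s, t) * k t \<partial>B) * h s \<partial>A)"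
    by (rule integral_slice[symmetric, OF assms])
  finally show ?thesis by (simp add: mult.commute)
qed

lemma fcoef_pair:
  assumes "sigma_finite_measure A" "sigma_finite_measure B" "l2fun (A \<Otimes>\<^sub>M B) F"
    "l2fun A (\<lambda>s. of_real (e s))" "l2fun B (\<lambda>t. of_real (d t))"
  shows "fcoef (A \<Otimes>\<^sub>M B) (\<lambda>z. e (fst z) * d (snd z)) F = fcoef A e (\<lambda>s. fcoef B d (\<lambda>t. F (s, t)))"
  unfolding fcoef_def using integral_slice[OF assms] by simp

lemma fcoef_zero: "fcoef M e (\<lambda>t. 0) = 0"
  by (simp add: fcoef_def)

text \<open>For totality, each j yields a null set of s off which the j-th coefficient of the slice
  at s vanishes. Countability of J merges these null sets, and totality of d then kills almost every
  slice.\<close>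

lemma onb_pair:
  assumes sf: "sigma_finite_measure A" "sigma_finite_measure B"
    and e: "onb A I e" and d: "onb B J d" and J: "countable J"
  shows "onb (A \<Otimes>\<^sub>M B) (I \<times> J) (\<lambda>(i, j) z. e i (fst z) * d j (snd z))"
proof -
  interpret pair_sigma_finite A B by (simp add: pair_sigma_finite_def sf)
  note le = onb_l2fun[OF e] and ld = onb_l2fun[OF d]
  have lt: "l2fun (A \<Otimes>\<^sub>M B) (\<lambda>z. of_real (e i (fst z) * d j (snd z)))" if "i \<in> I" "j \<in> J" for i j
    using l2fun_tensor[OF sf le[OF that(1)] ld[OF that(2)]] by simp
  have "orthonormal (A \<Otimes>\<^sub>M B) (I \<times> J) (\<lambda>(i, j) z. e i (fst z) * d j (snd z))"
    unfolding orthonormal_def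
  proof (intro conjI ballI)
    fix p q assume "p \<in> I \<times> J" "q \<in> I \<times> J"
    then obtain i j i' j' where [simp]: "p = (i, j)" "q = (i', j')" and ij: "i \<in> I" "j \<in> J" "i' \<in> I" "j' \<in> J" by blast
    have "complex_of_real (\<integral>z. (e i (fst z) * d j (snd z)) * (e i' (fst z) * d j' (snd z)) \<partial>(A \<Otimes>\<^sub>M B))
        = fcoef (A \<Otimes>\<^sub>M B) (\<lambda>z. e i' (fst z) * d j' (snd z)) (\<lambda>z. of_real (e i (fst z) * d j (snd z)))"
      unfolding fcoef_def by (simp flip: of_real_mult)
    also have "\<dots> = fcoef A (e i') (\<lambda>s. of_real (e i s) * fcoef B (d j') (\<lambda>t. of_real (d j t)))"
      by (subst fcoef_pair[OF sf lt le ld]) (use ij in \<open>simp_all add: fcoef_cmult\<close>)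
    also have "\<dots> = (if i = i' then 1 else 0) * (if j = j' then 1 else 0)"
      using ij by (simp add: fcoef_basis[OF onbD[OF d]] mult.commute fcoef_cmult fcoef_basis[OF onbD[OF e]] fcoef_zero)
    finally have "complex_of_real (\<integral>z. (e i (fst z) * d j (snd z)) * (e i' (fst z) * d j' (snd z)) \<partial>(A \<Otimes>\<^sub>M B))
        = complex_of_real (if p = q then 1 else 0)" by auto
    then show "(\<integral>z. (case p of (i, j) \<Rightarrow> \<lambda>z. e i (fst z) * d j (snd z)) z * (case q of (i, j) \<Rightarrow> \<lambda>z. e i (fst z) * d j (snd z)) z \<partial>(A \<Otimes>\<^sub>M B))
        = (if p = q then 1 else 0)"
      by (simp only: of_real_eq_iff prod.case \<open>p = (i, j)\<close> \<open>q = (i', j')\<close>)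
  qed (use lt in auto)
  moreover have "AE z in A \<Otimes>\<^sub>M B. F z = 0" if F: "l2fun (A \<Otimes>\<^sub>M B) F"
    and z: "\<forall>p\<in>I \<times> J. fcoef (A \<Otimes>\<^sub>M B) ((\<lambda>(i, j) z. e i (fst z) * d j (snd z)) p) F = 0" for F
  proof -
    have mF [measurable]: "F \<in> borel_measurable (A \<Otimes>\<^sub>M B)" by (rule l2fun_measurable[OF F])
    have "AE s in A. fcoef B (d j) (\<lambda>t. F (s, t)) = 0" if j: "j \<in> J" for j
    proof -
      have "l2fun A (\<lambda>s. fcoef B (d j) (\<lambda>t. F (s, t)))"
        unfolding fcoef_def by (rule l2fun_slice[OF sf F ld[OF j]])
      moreover have "fcoef A (e i) (\<lambda>s. fcoef B (d j) (\<lambda>t. F (s, t))) = 0" if "i \<in> I" for i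
        using z that j fcoef_pair[OF sf F le[OF that] ld[OF j]] by force
      ultimately show ?thesis using e unfolding onb_def by blast
    qed
    then have "AE s in A. \<forall>j\<in>J. fcoef B (d j) (\<lambda>t. F (s, t)) = 0"
      using J by (simp add: AE_ball_countable)
    moreover have "AE s in A. integrable B (\<lambda>t. (cmod (F (s, t)))\<^sup>2)"
      by (rule AE_integrable_fst'[OF l2fun_integrable[OF F]])
    ultimately have "AE s in A. (\<integral>t. (cmod (F (s, t)))\<^sup>2 \<partial>B) = 0"
      using AE_space
    proof eventually_elim
      case (elim s)
      then have l: "l2fun B (\<lambda>t. F (s, t))" using measurable_Pair2[OF mF] by (simp add: l2fun_def)
      then have "AE t in B. F (s, t) = 0" using d elim(1) unfolding onb_def by blast
      then show ?case using sqnorm_eq_0_iff[OF l] by (simp add: sqnorm_def)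
    qed
    then have "(\<integral>s. (\<integral>t. (cmod (F (s, t)))\<^sup>2 \<partial>B) \<partial>A) = 0"
      by (rule integral_eq_zero_AE)
    then have "sqnorm (A \<Otimes>\<^sub>M B) F = 0"
      unfolding sqnorm_def using integral_fst'[OF l2fun_integrable[OF F]] by simp
    then show ?thesis using sqnorm_eq_0_iff[OF F] by simp
  qed
  ultimately show ?thesis unfolding onb_def by blast
qed

lemma l2fun_distr:
  assumes \<phi> [measurable]: "\<phi> \<in> measurable M N" and f [measurable]: "f \<in> borel_measurable N"
  shows "l2fun (distr M N \<phi>) f \<longleftrightarrow> l2fun M (\<lambda>x. f (\<phi> x))"
  unfolding l2fun_def by (subst integrable_distr_eq) auto

lemma sqnorm_distr:
  assumes \<phi> [measurable]: "\<phi> \<in> measurable M N" and f [measurable]: "f \<in> borel_measurable N"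
  shows "sqnorm (distr M N \<phi>) f = sqnorm M (\<lambda>x. f (\<phi> x))"
  unfolding sqnorm_def by (rule integral_distr) auto

text \<open>Coefficients and square norms are invariant under the change of variables, and totality
  passes through square norms since vanishing almost everywhere means norm 0. It is used with
  \<open>ncons\<close>.\<close>

lemma onb_distr:
  assumes o: "onb M K d" and \<phi> [measurable]: "\<phi> \<in> measurable M N" and b: "bij_betw b K L"
    and e [measurable]: "\<And>l. l \<in> L \<Longrightarrow> e l \<in> borel_measurable N"
    and eq: "\<And>k x. k \<in> K \<Longrightarrow> x \<in> space M \<Longrightarrow> e (b k) (\<phi> x) = d k x"
  shows "onb (distr M N \<phi>) L e"
proof -
  have l2cong: "l2fun M f \<longleftrightarrow> l2fun M g" if "\<And>x. x \<in> space M \<Longrightarrow> f x = g x" for f g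
    unfolding l2fun_def using measurable_cong[of M f g] Bochner_Integration.integrable_cong[of M M "\<lambda>x. (cmod (f x))\<^sup>2" "\<lambda>x. (cmod (g x))\<^sup>2"] that
    by auto
  have bL: "b k \<in> L" if "k \<in> K" for k using b that by (auto simp: bij_betw_def)
  have l: "l2fun (distr M N \<phi>) (\<lambda>t. of_real (e (b k) t))" if k: "k \<in> K" for k
  proof -
    have "l2fun M (\<lambda>x. of_real (e (b k) (\<phi> x)))"
      using onb_l2fun[OF o k] eq[OF k] by (subst l2cong[of _ "\<lambda>x. of_real (d k x)"]) auto
    then show ?thesis using e[OF bL[OF k]] by (subst l2fun_distr[OF \<phi>]) auto
  qed
  have inner: "(\<integral>t. e (b k) t * e (b k') t \<partial>(distr M N \<phi>)) = (\<integral>x. d k x * d k' x \<partial>M)" if "k \<in> K" "k' \<in> K" for k k'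
    using e[OF bL] that eq
    by (subst integral_distr[OF \<phi>]) (auto intro!: Bochner_Integration.integral_cong)
  have fc: "fcoef (distr M N \<phi>) (e (b k)) f = fcoef M (d k) (\<lambda>x. f (\<phi> x))"
    if "k \<in> K" "f \<in> borel_measurable N" for k f
    unfolding fcoef_def using e[OF bL] that eq
    by (subst integral_distr[OF \<phi>]) (auto intro!: Bochner_Integration.integral_cong)
  have L: "L = b ` K" using b by (auto simp: bij_betw_def)
  have inj: "inj_on b K" using b by (auto simp: bij_betw_def)
  show ?thesis
    unfolding onb_def orthonormal_def L ball_simps
  proof (intro conjI ballI allI impI)
    fix k k' assume k: "k \<in> K" "k' \<in> K"
    then have "(\<integral>x. d k x * d k' x \<partial>M) = (if k = k' then 1 else 0)"
      using o by (auto simp: onb_def orthonormal_def)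
    then show "(\<integral>t. e (b k) t * e (b k') t \<partial>(distr M N \<phi>)) = (if b k = b k' then 1 else 0)"
      using inner[OF k] inj k by (auto simp: inj_on_def)
  next
    fix f assume f: "l2fun (distr M N \<phi>) f" and z: "\<forall>k\<in>K. fcoef (distr M N \<phi>) (e (b k)) f = 0"
    have mf: "f \<in> borel_measurable N" using l2fun_measurable[OF f] by simp
    have f': "l2fun M (\<lambda>x. f (\<phi> x))" using f l2fun_distr[OF \<phi> mf] by simp
    have "AE x in M. f (\<phi> x) = 0" using o f' z fc[OF _ mf] unfolding onb_def by auto
    then show "AE t in distr M N \<phi>. f t = 0"
      using sqnorm_eq_0_iff[OF f] sqnorm_eq_0_iff[OF f'] sqnorm_distr[OF \<phi> mf] by simp
  qed (use l in auto)
qed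

section \<open>Powers of the half-line and their product bases\<close>

lemma sigma_finite_Rplus: "sigma_finite_measure Rplus"
  unfolding Rplus_def by (rule sigma_finite_measure_restrict_space[OF sigma_finite_lborel]) simp

lemma product_sigma_finite_Rplus: "product_sigma_finite (\<lambda>_ :: nat. Rplus)"
  by (simp add: product_sigma_finite_def sigma_finite_Rplus)

lemma sigma_finite_Mn: "sigma_finite_measure (Mn n)"
  unfolding Mn_def by (rule product_sigma_finite.sigma_finite[OF product_sigma_finite_Rplus]) simp

text \<open>Points of \<open>Mn n\<close> take the value \<open>undefined\<close> from index n on;
  the shift preserves this convention, so no cutoff appears for large indices.\<close>

definition ncons :: "real \<times> (nat \<Rightarrow> real) \<Rightarrow> nat \<Rightarrow> real" where
  "ncons z = (\<lambda>i. if i = 0 then fst z else snd z (i - 1))"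

lemma ncons_Suc [simp]: "ncons z (Suc i) = snd z i" and ncons_0 [simp]: "ncons z 0 = fst z"
  by (simp_all add: ncons_def)

lemma measurable_ncons [measurable]: "ncons \<in> measurable (Rplus \<Otimes>\<^sub>M Mn n) (Mn (Suc n))"
  unfolding Mn_def ncons_def[abs_def]
proof (rule measurable_PiM_single')
  fix i assume i: "i \<in> {..<Suc n}"
  show "(\<lambda>z. if i = 0 then fst z else snd z (i - 1)) \<in> measurable (Rplus \<Otimes>\<^sub>M Pi\<^sub>M {..<n} (\<lambda>_. Rplus)) Rplus"
  proof (cases i)
    case (Suc j)
    then have "j \<in> {..<n}" using i by simp
    then have "(\<lambda>z. snd z j) \<in> measurable (Rplus \<Otimes>\<^sub>M Pi\<^sub>M {..<n} (\<lambda>_. Rplus)) Rplus" by measurable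
    then show ?thesis using Suc by simp
  qed simp
next
  show "(\<lambda>z i. if i = 0 then fst z else snd z (i - 1)) \<in> space (Rplus \<Otimes>\<^sub>M Pi\<^sub>M {..<n} (\<lambda>_. Rplus)) \<rightarrow> (\<Pi>\<^sub>E i\<in>{..<Suc n}. space Rplus)"
    by (auto simp: space_pair_measure space_PiM PiE_def Pi_def extensional_def split: nat.splits)
qed

text \<open>The two measures agree on boxes, where the preimage under \<open>ncons\<close> is a
  rectangle. This realises the tensor factorisation of the functions of n + 1 variables.\<close>

lemma distr_ncons: "distr (Rplus \<Otimes>\<^sub>M Mn n) (Mn (Suc n)) ncons = Mn (Suc n)"
proof -
  interpret B: sigma_finite_measure "Mn n" by (rule sigma_finite_Mn)
  interpret product_sigma_finite "\<lambda>_ :: nat. Rplus" by (rule product_sigma_finite_Rplus)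
  have "distr (Rplus \<Otimes>\<^sub>M Mn n) (Mn (Suc n)) ncons = Pi\<^sub>M {..<Suc n} (\<lambda>_. Rplus)"
  proof (rule PiM_eqI)
    fix A :: "nat \<Rightarrow> real set" assume A: "\<And>i. i \<in> {..<Suc n} \<Longrightarrow> A i \<in> sets Rplus"
    have sub: "A i \<subseteq> space Rplus" if "i \<in> {..<Suc n}" for i using A[OF that] by (rule sets.sets_into_space)
    have *: "ncons -` Pi\<^sub>E {..<Suc n} A \<inter> space (Rplus \<Otimes>\<^sub>M Mn n) = A 0 \<times> Pi\<^sub>E {..<n} (\<lambda>i. A (Suc i))"
    proof (intro set_eqI iffI)
      fix z assume z: "z \<in> ncons -` Pi\<^sub>E {..<Suc n} A \<inter> space (Rplus \<Otimes>\<^sub>M Mn n)"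
      then have "ncons z i \<in> A i" if "i < Suc n" for i using that by auto
      from this[of 0] this[of "Suc _"] z
      show "z \<in> A 0 \<times> Pi\<^sub>E {..<n} (\<lambda>i. A (Suc i))"
        by (cases z) (auto simp: space_pair_measure Mn_def space_PiM PiE_def)
    next
      fix z assume z: "z \<in> A 0 \<times> Pi\<^sub>E {..<n} (\<lambda>i. A (Suc i))"
      then obtain s t where st: "z = (s, t)" "s \<in> A 0" "t \<in> Pi\<^sub>E {..<n} (\<lambda>i. A (Suc i))" by blast
      then have "ncons z i \<in> A i" if "i < Suc n" for i using that by (cases i) auto
      moreover have "ncons z i = undefined" if "\<not> i < Suc n" for i
        using st that by (cases i) (auto simp: PiE_def extensional_def)
      moreover have "s \<in> space Rplus" "t \<in> space (Mn n)"
        using st sub[of 0] sub[of "Suc _"] by (auto simp: Mn_def space_PiM PiE_def Pi_def subset_iff)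
      ultimately show "z \<in> ncons -` Pi\<^sub>E {..<Suc n} A \<inter> space (Rplus \<Otimes>\<^sub>M Mn n)"
        using st by (auto simp: space_pair_measure PiE_def extensional_def)
    qed
    have "Pi\<^sub>E {..<Suc n} A \<in> sets (Mn (Suc n))"
      unfolding Mn_def by (rule sets_PiM_I_finite) (auto intro: A)
    then have "emeasure (distr (Rplus \<Otimes>\<^sub>M Mn n) (Mn (Suc n)) ncons) (Pi\<^sub>E {..<Suc n} A)
        = emeasure (Rplus \<Otimes>\<^sub>M Mn n) (A 0 \<times> Pi\<^sub>E {..<n} (\<lambda>i. A (Suc i)))"
      by (simp only: emeasure_distr[OF measurable_ncons] *)
    also have "\<dots> = emeasure Rplus (A 0) * emeasure (Mn n) (Pi\<^sub>E {..<n} (\<lambda>i. A (Suc i)))"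
      using A by (intro B.emeasure_pair_measure_Times) (auto simp: Mn_def intro!: sets_PiM_I_finite)
    also have "\<dots> = emeasure Rplus (A 0) * (\<Prod>i<n. emeasure Rplus (A (Suc i)))"
      unfolding Mn_def using A by (subst emeasure_PiM) auto
    also have "\<dots> = (\<Prod>i\<in>{..<Suc n}. emeasure Rplus (A i))"
      by (simp add: prod.lessThan_Suc_shift del: prod.lessThan_Suc)
    finally show "emeasure (distr (Rplus \<Otimes>\<^sub>M Mn n) (Mn (Suc n)) ncons) (Pi\<^sub>E {..<Suc n} A) = (\<Prod>i\<in>{..<Suc n}. emeasure Rplus (A i))" .
  qed (auto simp: Mn_def)
  then show ?thesis by (simp add: Mn_def)
qed

lemma l2fun_Mn_Suc:
  assumes "f \<in> borel_measurable (Mn (Suc n))"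
  shows "l2fun (Mn (Suc n)) f \<longleftrightarrow> l2fun (Rplus \<Otimes>\<^sub>M Mn n) (\<lambda>z. f (ncons z))"
  using l2fun_distr[OF measurable_ncons assms] by (simp add: distr_ncons)

definition tensor_basis :: "('i \<Rightarrow> real \<Rightarrow> real) \<Rightarrow> 'i list \<Rightarrow> (nat \<Rightarrow> real) \<Rightarrow> real" where
  "tensor_basis e w t = (\<Prod>j<length w. e (w ! j) (t j))"

lemma tensor_basis_Cons: "tensor_basis e (i # w) (ncons z) = e i (fst z) * tensor_basis e w (snd z)"
  by (simp add: tensor_basis_def prod.lessThan_Suc_shift del: prod.lessThan_Suc)

lemma measurable_tensor_basis:
  assumes "\<And>i. e i \<in> borel_measurable Rplus"
  shows "tensor_basis e w \<in> borel_measurable (Mn (length w))"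
  unfolding tensor_basis_def[abs_def] Mn_def
  by (intro borel_measurable_prod measurable_compose[OF _ assms] measurable_component_singleton)

lemma onb_Mn:
  fixes e :: "'i :: countable \<Rightarrow> real \<Rightarrow> real"
  assumes e: "onb Rplus UNIV e"
  shows "onb (Mn n) {w. length w = n} (tensor_basis e)"
proof (induction n)
  case 0
  \<comment> \<open>With no variables the space is the single point that is \<open>undefined\<close>
    everywhere, and the empty product, the constant 1, is its basis.\<close>
  have M0: "Mn 0 = count_space {\<lambda>_. undefined}" by (simp add: Mn_def PiM_empty)
  have int: "(\<integral>t. f t \<partial>Mn 0) = f (\<lambda>_. undefined)" for f :: "(nat \<Rightarrow> real) \<Rightarrow> 'b :: {banach, second_countable_topology}"
    unfolding M0 by (subst lebesgue_integral_count_space_finite) auto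
  have l2: "l2fun (Mn 0) f" for f
    unfolding l2fun_def M0 by (auto intro: integrable_count_space)
  have ae: "(AE t in Mn 0. P t) \<longleftrightarrow> P (\<lambda>_. undefined)" for P
    unfolding M0 by (simp add: AE_count_space)
  have "measure (Mn 0) (space (Mn 0)) = 1" by (simp add: M0)
  then show ?case
    unfolding onb_def orthonormal_def ae
    by (auto simp: l2 int tensor_basis_def fcoef_def)
next
  case (Suc n)
  have me: "e i \<in> borel_measurable Rplus" for i
    using l2fun_measurable[OF onb_l2fun[OF e, of i]]
      borel_measurable_complex_iff[of "\<lambda>t. complex_of_real (e i t)" Rplus] by simp
  have "onb (distr (Rplus \<Otimes>\<^sub>M Mn n) (Mn (Suc n)) ncons) {w. length w = Suc n} (tensor_basis e)"
  proof (rule onb_distr)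
    show "onb (Rplus \<Otimes>\<^sub>M Mn n) (UNIV \<times> {w. length w = n}) (\<lambda>(i, w) z. e i (fst z) * tensor_basis e w (snd z))"
      by (rule onb_pair[OF sigma_finite_Rplus sigma_finite_Mn e Suc]) simp
    show "bij_betw (\<lambda>(i, w). i # w) (UNIV \<times> {w :: 'i list. length w = n}) {w. length w = Suc n}"
    proof (rule bij_betwI')
      fix w :: "'i list" assume "w \<in> {w. length w = Suc n}"
      then show "\<exists>p\<in>UNIV \<times> {w. length w = n}. w = (case p of (i, w) \<Rightarrow> i # w)" by (cases w) auto
    qed auto
    show "tensor_basis e w \<in> borel_measurable (Mn (Suc n))" if "w \<in> {w. length w = Suc n}" for w
      using measurable_tensor_basis[of e w, OF me] that by simp
  qed (auto simp: tensor_basis_Cons)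
  then show ?case by (simp add: distr_ncons)
qed

section \<open>An orthonormal basis of the half line\<close>

lemma integral_mult_of_real:
  "(\<integral>t. complex_of_real (u t) * complex_of_real (v t) \<partial>M) = complex_of_real (\<integral>t. u t * v t \<partial>M)"
  by (simp flip: of_real_mult)

lemma fcoef_of_real: "fcoef M e (\<lambda>t. of_real (u t)) = of_real (\<integral>t. u t * e t \<partial>M)"
  unfolding fcoef_def by (rule integral_mult_of_real)

lemma sqnorm_of_real: "sqnorm M (\<lambda>t. of_real (u t)) = (\<integral>t. u t * u t \<partial>M)"
  by (simp add: sqnorm_def power2_eq_square)

lemma fcoef_real_add:
  assumes "l2fun M (\<lambda>t. of_real (u t))" "l2fun M (\<lambda>t. of_real (v t))" "l2fun M f"
  shows "fcoef M (\<lambda>t. u t + v t) f = fcoef M u f + fcoef M v f"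
  unfolding fcoef_def of_real_add distrib_left
  by (intro Bochner_Integration.integral_add l2fun_prod_integrable assms)

lemma fcoef_real_cmult: "fcoef M (\<lambda>t. c * u t) f = of_real c * fcoef M u f"
  by (simp add: fcoef_def mult.left_commute)

lemma l2fun_real_cmult: "l2fun M (\<lambda>t. of_real (u t)) \<Longrightarrow> l2fun M (\<lambda>t. of_real (c * u t))"
  unfolding of_real_mult by (rule l2fun_cmult)

lemma l2fun_real_sum:
  assumes "\<And>i. i \<in> F \<Longrightarrow> l2fun M (\<lambda>t. of_real (u i t))"
  shows "l2fun M (\<lambda>t. of_real (\<Sum>i\<in>F. u i t))"
  unfolding of_real_sum by (rule l2fun_sum[OF assms])

lemma fcoef_real_sum:
  assumes "finite F" "\<And>i. i \<in> F \<Longrightarrow> l2fun M (\<lambda>t. of_real (u i t))" "l2fun M f"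
  shows "fcoef M (\<lambda>t. \<Sum>i\<in>F. u i t) f = (\<Sum>i\<in>F. fcoef M (u i) f)"
  using assms(1,2)
proof (induction F rule: finite_induct)
  case (insert i F)
  then have "fcoef M (\<lambda>t. u i t + (\<Sum>i\<in>F. u i t)) f = fcoef M (u i) f + fcoef M (\<lambda>t. \<Sum>i\<in>F. u i t) f"
    by (intro fcoef_real_add l2fun_real_sum assms(3)) auto
  with insert show ?case by simp
qed (simp add: fcoef_def)

lemma fcoef_commute: "fcoef M e (\<lambda>t. of_real (u t)) = fcoef M u (\<lambda>t. of_real (e t))"
  by (simp add: fcoef_def mult.commute)

lemma fcoef_eq_0:
  assumes "l2fun M (\<lambda>t. of_real (e t))" "l2fun M f" "(\<integral>t. e t * e t \<partial>M) = 0"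
  shows "fcoef M e f = 0"
  using fcoef_bound[OF assms(1,2)] assms(3) by (simp add: sqnorm_of_real)

(* Gram-Schmidt without linear independence: if v k depends on its predecessors, the division by 0
   makes the k-th function 0, and onb_gs drops the index. *)
primrec gs_table :: "'a measure \<Rightarrow> (nat \<Rightarrow> 'a \<Rightarrow> real) \<Rightarrow> nat \<Rightarrow> nat \<Rightarrow> 'a \<Rightarrow> real" where
  "gs_table M v 0 = (\<lambda>_ _. 0)"
| "gs_table M v (Suc k) = (let g = gs_table M v k;
     w = (\<lambda>t. v k t - (\<Sum>j<k. (\<integral>s. v k s * g j s \<partial>M) * g j t))
   in g(k := (\<lambda>t. w t / sqrt (\<integral>s. w s * w s \<partial>M))))"

text \<open>Entry k is written at stage k + 1 and never changed afterwards, so reading the table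
  just past the diagonal gives the final value.\<close>

definition gs :: "'a measure \<Rightarrow> (nat \<Rightarrow> 'a \<Rightarrow> real) \<Rightarrow> nat \<Rightarrow> 'a \<Rightarrow> real" where
  "gs M v k = gs_table M v (Suc k) k"

definition gs_diff :: "'a measure \<Rightarrow> (nat \<Rightarrow> 'a \<Rightarrow> real) \<Rightarrow> nat \<Rightarrow> 'a \<Rightarrow> real" where
  "gs_diff M v k t = v k t - (\<Sum>j<k. (\<integral>s. v k s * gs M v j s \<partial>M) * gs M v j t)"

lemma gs_table_eq: "j < k \<Longrightarrow> gs_table M v k j = gs M v j"
proof (induction k)
  case (Suc k)
  show ?case
  proof (cases "j = k")
    case False
    then have "gs_table M v (Suc k) j = gs_table M v k j" by (simp add: Let_def)
    then show ?thesis using Suc False by simp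
  qed (simp only: gs_def)
qed simp

lemma gs_eq: "gs M v k = (\<lambda>t. gs_diff M v k t / sqrt (\<integral>s. gs_diff M v k s * gs_diff M v k s \<partial>M))"
proof -
  have "v k t - (\<Sum>j<k. (\<integral>s. v k s * gs_table M v k j s \<partial>M) * gs_table M v k j t) = gs_diff M v k t" for t
    by (simp add: gs_diff_def gs_table_eq)
  then show ?thesis unfolding gs_def gs_table.simps Let_def by (simp only: fun_upd_same)
qed

lemma Gram_Schmidt:
  assumes v: "\<And>k. l2fun M (\<lambda>t. of_real (v k t))"
  shows "l2fun M (\<lambda>t. of_real (gs M v k t))"
    and "(\<integral>t. gs M v k t * gs M v k t \<partial>M) \<in> {0, 1}"
    and "i < k \<Longrightarrow> (\<integral>t. gs M v k t * gs M v i t \<partial>M) = 0"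
    and "l2fun M f \<Longrightarrow> (\<And>j. fcoef M (gs M v j) f = 0) \<Longrightarrow> fcoef M (v k) f = 0"
proof -
  let ?e = "gs M v" and ?w = "gs_diff M v"
  have wl: "l2fun M (\<lambda>t. of_real (?w k t))" if "\<And>j. j < k \<Longrightarrow> l2fun M (\<lambda>t. of_real (?e j t))" for k
    unfolding gs_diff_def of_real_diff using that
    by (intro l2fun_diff v l2fun_real_sum l2fun_real_cmult) auto
  have el: "l2fun M (\<lambda>t. of_real (?e k t))" for k
  proof (induction k rule: less_induct)
    case (less k)
    have "l2fun M (\<lambda>t. of_real (inverse (sqrt (\<integral>s. ?w k s * ?w k s \<partial>M)) * ?w k t))"
      by (rule l2fun_real_cmult[OF wl[OF less]])
    then show ?case by (subst gs_eq) (simp add: field_simps)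
  qed
  then show "l2fun M (\<lambda>t. of_real (?e k t))" .
  note wl = wl[OF el]
  have sq: "(\<integral>t. ?e k t * ?e k t \<partial>M) \<in> {0, 1}" for k
  proof -
    let ?n = "\<integral>s. ?w k s * ?w k s \<partial>M"
    have "?n \<ge> 0" by (rule integral_nonneg_AE) simp
    have "(\<integral>t. ?e k t * ?e k t \<partial>M) = (\<integral>t. (?w k t * ?w k t) / ?n \<partial>M)"
      by (subst (1 2) gs_eq) (use \<open>?n \<ge> 0\<close> in simp)
    also have "\<dots> = ?n / ?n" by simp
    finally show ?thesis by auto
  qed
  then show "(\<integral>t. ?e k t * ?e k t \<partial>M) \<in> {0, 1}" .
  have v_dec: "v k = (\<lambda>t. ?w k t + (\<Sum>j<k. (\<integral>s. v k s * ?e j s \<partial>M) * ?e j t))" for k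
    by (simp add: gs_diff_def)
  have fv: "fcoef M (v k) f = fcoef M (?w k) f + (\<Sum>j<k. of_real (\<integral>s. v k s * ?e j s \<partial>M) * fcoef M (?e j) f)"
    if f: "l2fun M f" for k f
    by (subst v_dec, subst fcoef_real_add[OF wl l2fun_real_sum f])
      (auto simp: fcoef_real_sum el f l2fun_real_cmult fcoef_real_cmult simp del: of_real_mult)
  have fe: "fcoef M (?e k) f = of_real (inverse (sqrt (\<integral>s. ?w k s * ?w k s \<partial>M))) * fcoef M (?w k) f" for k f
  proof -
    have "?e k = (\<lambda>t. inverse (sqrt (\<integral>s. ?w k s * ?w k s \<partial>M)) * ?w k t)"
      by (subst gs_eq) (simp add: field_simps)
    then show ?thesis by (simp only: fcoef_real_cmult)
  qed
  have orth: "\<forall>i<k. (\<integral>t. ?e k t * ?e i t \<partial>M) = 0" for k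
  proof (induction k rule: less_induct)
    case (less k)
    have ee: "fcoef M (?e j) (\<lambda>t. of_real (?e i t)) = (if i = j then of_real (\<integral>t. ?e i t * ?e i t \<partial>M) else 0)" if "i < k" "j < k" for i j
      using less[OF that(1)] less[OF that(2)]
      by (cases i j rule: linorder_cases) (auto simp: fcoef_of_real mult.commute)
    show ?case
    proof (intro allI impI)
      fix i assume i: "i < k"
      let ?f = "\<lambda>t. complex_of_real (?e i t)"
      have "fcoef M (v k) ?f = fcoef M (?w k) ?f + (\<Sum>j<k. of_real (\<integral>s. v k s * ?e j s \<partial>M) * fcoef M (?e j) ?f)"
        by (rule fv[OF el])
      also have "(\<Sum>j<k. of_real (\<integral>s. v k s * ?e j s \<partial>M) * fcoef M (?e j) ?f)
          = (\<Sum>j<k. if i = j then of_real (\<integral>s. v k s * ?e i s \<partial>M) * of_real (\<integral>t. ?e i t * ?e i t \<partial>M) else 0)"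
        using i by (intro sum.cong) (auto simp: ee)
      also have "\<dots> = of_real (\<integral>s. v k s * ?e i s \<partial>M) * of_real (\<integral>t. ?e i t * ?e i t \<partial>M)"
        using i by simp
      also have "of_real (\<integral>s. v k s * ?e i s \<partial>M) = fcoef M (v k) ?f"
        by (simp add: fcoef_of_real mult.commute)
      finally have *: "fcoef M (v k) ?f = fcoef M (?w k) ?f + fcoef M (v k) ?f * of_real (\<integral>t. ?e i t * ?e i t \<partial>M)" .
      \<comment> \<open>In \<open>*\<close> the coefficient against \<open>v k\<close> returns
        multiplied by the squared norm of the i-th function, which is 0 or 1. If it is 1, the two
        copies cancel; if it is 0, that function is null and Cauchy-Schwarz gives the claim.\<close>
      have "fcoef M (?w k) ?f = 0"
      proof (cases "(\<integral>t. ?e i t * ?e i t \<partial>M) = 0")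
        case True
        then show ?thesis
          by (subst fcoef_commute) (rule fcoef_eq_0[OF el wl True])
      next
        case False
        then have "(\<integral>t. ?e i t * ?e i t \<partial>M) = 1" using sq[of i] by simp
        then show ?thesis using * by simp
      qed
      then have "fcoef M (?e k) ?f = 0" by (simp add: fe)
      then show "(\<integral>t. ?e k t * ?e i t \<partial>M) = 0" by (simp add: fcoef_of_real mult.commute)
    qed
  qed
  then show "(\<integral>t. ?e k t * ?e i t \<partial>M) = 0" if "i < k" using that by blast
  show "fcoef M (v k) f = 0" if f: "l2fun M f" and z: "\<And>j. fcoef M (?e j) f = 0"
  proof -
    have "fcoef M (?w k) f = 0"
    proof (cases "(\<integral>s. ?w k s * ?w k s \<partial>M) = 0")
      case True
      then show ?thesis by (rule fcoef_eq_0[OF wl f])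
    next
      case False
      then show ?thesis using z[of k] fe[of k f] by simp
    qed
    then show ?thesis by (simp add: fv[OF f] z)
  qed
qed

lemma onb_gs:
  assumes v: "\<And>k. l2fun M (\<lambda>t. of_real (v k t))"
    and total: "\<And>f. l2fun M f \<Longrightarrow> (\<And>k. fcoef M (v k) f = 0) \<Longrightarrow> AE t in M. f t = 0"
  shows "onb M {k. (\<integral>t. gs M v k t * gs M v k t \<partial>M) = 1} (gs M v)"
  unfolding onb_def orthonormal_def
proof (intro conjI ballI allI impI)
  fix i j assume "i \<in> {k. (\<integral>t. gs M v k t * gs M v k t \<partial>M) = 1}" "j \<in> {k. (\<integral>t. gs M v k t * gs M v k t \<partial>M) = 1}"
  then show "(\<integral>t. gs M v i t * gs M v j t \<partial>M) = (if i = j then 1 else 0)"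
    using Gram_Schmidt(3)[where v = v and i = i and k = j, OF v] Gram_Schmidt(3)[where v = v and i = j and k = i, OF v]
    by (cases i j rule: linorder_cases) (auto simp: mult.commute)
next
  fix f assume f: "l2fun M f" and z: "\<forall>i\<in>{k. (\<integral>t. gs M v k t * gs M v k t \<partial>M) = 1}. fcoef M (gs M v i) f = 0"
  have "fcoef M (gs M v j) f = 0" for j
    using z Gram_Schmidt(2)[where v = v and k = j, OF v] fcoef_eq_0[OF Gram_Schmidt(1)[where v = v and k = j, OF v] f] by auto
  then show "AE t in M. f t = 0"
    by (intro total f Gram_Schmidt(4)[OF v f])
qed (rule Gram_Schmidt(1)[OF v])

text \<open>Double counting of the squared inner products of all e i with the first card I + 1
  functions u j: Parseval gives total 1 for each j, Bessel at most 1 for each i, hence card I + 1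
  would be at most card I.\<close>

lemma onb_infinite:
  fixes u :: "nat \<Rightarrow> 'a \<Rightarrow> real"
  assumes o: "onb M I e" and u: "orthonormal M UNIV u"
  shows "infinite I"
proof
  assume I: "finite I"
  have ul: "l2fun M (\<lambda>t. of_real (u j t))" for j using u by (simp add: orthonormal_def)
  let ?c = "\<lambda>i j. (cmod (fcoef M (e i) (\<lambda>t. of_real (u j t))))\<^sup>2"
  have "(\<Sum>i\<in>I. ?c i j) = 1" for j
  proof -
    have "1 = sqnorm M (\<lambda>t. of_real (u j t))" using u by (simp add: sqnorm_of_real orthonormal_def)
    also have "\<dots> = (\<Sum>\<^sub>\<infinity>i\<in>I. ?c i j)"
      unfolding Parseval[OF o ul] norm_ell2_sq
      by (rule infsum_cong_neutral) (auto simp: coord_coefs[OF onbD[OF o] ul])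
    finally show ?thesis using I by simp
  qed
  then have "real (Suc (card I)) = (\<Sum>j<Suc (card I). \<Sum>i\<in>I. ?c i j)" by simp
  also have "\<dots> = (\<Sum>i\<in>I. \<Sum>j<Suc (card I). ?c i j)" by (rule sum.swap)
  also have "\<dots> \<le> (\<Sum>i\<in>I. 1)"
  proof (rule sum_mono)
    fix i assume i: "i \<in> I"
    have "(\<Sum>j<Suc (card I). ?c i j) = (\<Sum>j<Suc (card I). (cmod (fcoef M (u j) (\<lambda>t. of_real (e i t))))\<^sup>2)"
      by (rule sum.cong[OF refl], subst fcoef_commute) (rule refl)
    also have "\<dots> \<le> sqnorm M (\<lambda>t. of_real (e i t))"
      by (rule Bessel[OF u]) (auto intro: onb_l2fun[OF o i])
    also have "\<dots> = 1" using o i by (simp add: sqnorm_of_real onb_def orthonormal_def)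
    finally show "(\<Sum>j<Suc (card I). ?c i j) \<le> 1" .
  qed
  finally show False by simp
qed

lemma onb_reindex:
  assumes "onb M K d" "bij_betw g L K"
  shows "onb M L (\<lambda>l. d (g l))"
proof -
  have K: "K = g ` L" and inj: "inj_on g L" using assms(2) by (auto simp: bij_betw_def)
  show ?thesis
    using assms(1) inj unfolding K onb_def orthonormal_def ball_simps by (auto simp: inj_on_def)
qed

text \<open>Rational half-lines are an intersection-stable generator of the Borel sets, so Dynkin's
  argument spreads the vanishing integrals to all Borel sets. Rational endpoints keep the family
  countable, as Gram-Schmidt takes a sequence.\<close>

lemma AE_zero_if_integral_atMost_rat:
  fixes h :: "real \<Rightarrow> real"
  assumes h: "integrable lborel h" and q: "\<And>q :: rat. (\<integral>x. indicator {..of_rat q} x * h x \<partial>lborel) = 0"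
    and all: "(\<integral>x. h x \<partial>lborel) = 0"
  shows "AE x in lborel. h x = 0"
proof -
  have [measurable]: "h \<in> borel_measurable borel" using borel_measurable_integrable[OF h] by simp
  let ?G = "range (\<lambda>q :: rat. {..real_of_rat q})"
  have G: "sigma_sets UNIV ?G = sets borel"
  proof
    show "sigma_sets UNIV ?G \<subseteq> sets borel"
      by (rule sets.sigma_sets_subset'[of _ borel UNIV, simplified]) auto
    have "{..a} \<in> sigma_sets UNIV ?G" for a :: real
    proof -
      have "{..a} = (\<Inter>q\<in>{q. a < of_rat q}. {..real_of_rat q})"
      proof (intro set_eqI iffI)
        fix x assume x: "x \<in> (\<Inter>q\<in>{q. a < of_rat q}. {..real_of_rat q})"
        show "x \<in> {..a}"
        proof (rule ccontr)
          assume "x \<notin> {..a}"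
          then obtain q where "a < of_rat q" "of_rat q < x" using of_rat_dense[of a x] by auto
          then show False using x by force
        qed
      qed auto
      moreover have "\<exists>q. a < real_of_rat q" using of_rat_dense[of a "a + 1"] by auto
      moreover have "(\<Inter>q\<in>{q. a < of_rat q}. {..real_of_rat q}) \<in> sets (sigma UNIV ?G)" if "\<exists>q. a < real_of_rat q"
        by (rule sets.countable_INT) (use that in \<open>auto simp: sets_measure_of\<close>)
      ultimately show ?thesis by (simp add: sets_measure_of)
    qed
    then show "sets borel \<subseteq> sigma_sets UNIV ?G"
      unfolding borel_eq_atMost by (auto intro!: sigma_sets_mono simp: sets_measure_of)
  qed
  have int: "set_integrable lborel A h" if "A \<in> sets borel" for A
    unfolding set_integrable_def using h that by (intro integrable_mult_indicator) auto
  have zero: "(LINT x:A|lborel. h x) = 0" if A: "A \<in> sets borel" for A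
  proof (rule sigma_sets_induct_disjoint[of ?G UNIV A])
    show "Int_stable ?G"
    proof (rule Int_stableI)
      fix a b assume "a \<in> ?G" "b \<in> ?G"
      then obtain p q where "a = {..real_of_rat p}" "b = {..real_of_rat q}" by auto
      then have "a \<inter> b = {..real_of_rat (min p q)}" by (auto simp: of_rat_less_eq min_def)
      then show "a \<inter> b \<in> ?G" by blast
    qed
    show "A \<in> sigma_sets UNIV ?G" using A by (simp add: G)
    show "(LINT x:B|lborel. h x) = 0" if "B \<in> ?G" for B
      using that q by (auto simp: set_lebesgue_integral_def)
    show "(LINT x:{}|lborel. h x) = 0" by (simp add: set_lebesgue_integral_def)
    show "(LINT x:UNIV - B|lborel. h x) = 0" if "B \<in> sigma_sets UNIV ?G" and z: "(LINT x:B|lborel. h x) = 0" for B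
    proof -
      have B: "B \<in> sets borel" "UNIV - B \<in> sets borel" using that(1) by (auto simp: G)
      have "(LINT x:B \<union> (UNIV - B)|lborel. h x) = (LINT x:B|lborel. h x) + (LINT x:UNIV - B|lborel. h x)"
        by (rule set_integral_Un) (use int B in auto)
      moreover have "(LINT x:B \<union> (UNIV - B)|lborel. h x) = 0"
        using all by (simp add: set_lebesgue_integral_def)
      ultimately show ?thesis using z by simp
    qed
    show "(LINT x:(\<Union>i. B i)|lborel. h x) = 0"
      if "disjoint_family B" "range B \<subseteq> sigma_sets UNIV ?G" "\<And>i. (LINT x:B i|lborel. h x) = 0" for B :: "nat \<Rightarrow> real set"
    proof -
      have B: "B i \<in> sets borel" for i using that(2) by (auto simp: G)
      have "(LINT x:(\<Union>i. B i)|lborel. h x) = (\<Sum>i. (LINT x:B i|lborel. h x))"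
        using that(1) B by (intro lebesgue_integral_countable_add int) (auto simp: disjoint_family_on_def)
      then show ?thesis using that(3) by simp
    qed
  qed auto
  \<comment> \<open>Testing on the set where c h is positive, with c = 1 and c = -1, excludes both
    signs.\<close>
  have half: "AE x in lborel. \<not> (c * h x > 0)" for c :: real
  proof -
    let ?A = "{x. c * h x > 0}"
    have A: "?A \<in> sets borel" by measurable
    have "integrable lborel (\<lambda>x. c * (indicator ?A x * h x))"
      using int[OF A] by (simp add: set_integrable_def)
    moreover have "(\<integral>x. c * (indicator ?A x * h x) \<partial>lborel) = 0"
      using zero[OF A] by (simp add: set_lebesgue_integral_def)
    moreover have "AE x in lborel. 0 \<le> c * (indicator ?A x * h x)"
      by (rule AE_I2) (auto simp: indicator_def)
    ultimately have "AE x in lborel. c * (indicator ?A x * h x) = 0"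
      using integral_nonneg_eq_0_iff_AE by blast
    then show ?thesis by eventually_elim (auto simp: indicator_def split: if_splits)
  qed
  from half[of 1] half[of "-1"] show ?thesis by eventually_elim auto
qed

lemma integral_indicator_Rplus:
  assumes "A \<in> sets borel"
  shows "emeasure lborel ({0..} \<inter> A) < \<infinity> \<Longrightarrow> integrable Rplus (indicator A :: real \<Rightarrow> real)"
    and "(\<integral>t. indicator A t \<partial>Rplus) = measure lborel ({0..} \<inter> A)"
proof -
  have *: "(\<lambda>t. indicator {0..} t * indicator A t :: real) = indicator ({0..} \<inter> A)"
    by (auto simp: indicator_def fun_eq_iff)
  show "emeasure lborel ({0..} \<inter> A) < \<infinity> \<Longrightarrow> integrable Rplus (indicator A :: real \<Rightarrow> real)"
    unfolding Rplus_def using assms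
    by (subst integrable_restrict_space) (auto simp: * intro!: integrable_real_indicator)
  show "(\<integral>t. indicator A t \<partial>Rplus) = measure lborel ({0..} \<inter> A)"
    unfolding Rplus_def by (subst integral_restrict_space) (auto simp: *)
qed

lemma l2fun_indicator_Rplus:
  assumes "A \<in> sets borel" "emeasure lborel ({0..} \<inter> A) < \<infinity>"
  shows "l2fun Rplus (\<lambda>t. of_real (indicator A t))"
proof -
  have "(\<lambda>t. complex_of_real (indicator A t)) \<in> borel_measurable Rplus"
    unfolding Rplus_def by (rule measurable_restrict_space1) (use assms in measurable)
  moreover have "(cmod (of_real (indicator A t)))\<^sup>2 = (indicator A t :: real)" for t
    by (simp add: indicator_def)
  ultimately show ?thesis using integral_indicator_Rplus(1)[OF assms] by (simp add: l2fun_def)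
qed

text \<open>Real and imaginary parts are treated alike through a real-linear functional L, which
  reduces the claim to real integrands on the line.\<close>

lemma Rplus_total:
  assumes f: "l2fun Rplus f" and z: "\<And>q :: rat. fcoef Rplus (indicator {..of_rat q}) f = 0"
  shows "AE t in Rplus. f t = 0"
proof -
  have indl2: "l2fun Rplus (\<lambda>t. of_real (indicator {..a} t))" for a :: real
    by (rule l2fun_indicator_Rplus) (simp_all add: emeasure_lborel_Icc_eq flip: atLeastAtMost_def)
  have part: "AE t in Rplus. L (f t) = 0"
    if L: "bounded_linear L" and Lr: "\<And>r z. L (of_real r * z) = r * L z" for L :: "complex \<Rightarrow> real"
  proof -
    have i: "integrable Rplus (\<lambda>t. indicator {..a} t * L (f t))"
      "(\<integral>t. indicator {..a} t * L (f t) \<partial>Rplus) = L (fcoef Rplus (indicator {..a}) f)" for a :: real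
      using integrable_bounded_linear[OF L l2fun_prod_integrable[OF indl2 f, of a]]
        integral_bounded_linear[OF L l2fun_prod_integrable[OF indl2 f, of a]]
      by (simp_all add: Lr fcoef_def mult.commute[of "f _"])
    have i': "integrable lborel (\<lambda>t. indicator {0..} t * (indicator {..a} t * L (f t)))"
      "(\<integral>t. indicator {0..} t * (indicator {..a} t * L (f t)) \<partial>lborel) = L (fcoef Rplus (indicator {..a}) f)" for a :: real
      using i[of a] by (simp_all add: Rplus_def integrable_restrict_space integral_restrict_space)
    have L0: "L 0 = 0" by (rule linear_simps(3)[OF L])
    \<comment> \<open>A square-integrable function on the half-line need not be integrable, so it is
      first cut off at n; letting n run through all naturals recovers every point.\<close>
    have h: "AE t in lborel. indicator {0..} t * (indicator {..real n} t * L (f t)) = 0" for n :: nat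
    proof (rule AE_zero_if_integral_atMost_rat)
      fix q :: rat
      \<comment> \<open>Cutting the cut-off function at q is cutting at min q n, which is again
        rational and hence covered by the hypothesis.\<close>
      have "real_of_rat (min q (of_nat n)) = min (real_of_rat q) (real n)"
        using of_rat_less_eq[of q "of_nat n"] by (auto simp: min_def)
      then have "indicator {..real_of_rat q} t * (indicator {0..} t * (indicator {..real n} t * L (f t)))
          = indicator {0..} t * (indicator {..real_of_rat (min q (of_nat n))} t * L (f t))" for t
        by (auto simp: indicator_def)
      then show "(\<integral>t. indicator {..real_of_rat q} t * (indicator {0..} t * (indicator {..real n} t * L (f t))) \<partial>lborel) = 0"
        using i'(2)[of "real_of_rat (min q (of_nat n))"] by (simp only: z L0)
    next
      show "(\<integral>t. indicator {0..} t * (indicator {..real n} t * L (f t)) \<partial>lborel) = 0"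
        using i'(2)[of "real n"] z[of "of_nat n"] by (simp add: L0)
    qed (rule i'(1))
    have "AE t in lborel. \<forall>n. indicator {0..} t * (indicator {..real n} t * L (f t)) = 0"
      unfolding AE_all_countable by (rule allI) (rule h)
    then have "AE t in lborel. t \<in> {0..} \<longrightarrow> L (f t) = 0"
    proof eventually_elim
      case (elim t)
      obtain n where "t \<le> real n" using real_arch_simple by blast
      then show ?case using elim[rule_format, of n] by (auto simp: indicator_def)
    qed
    then show ?thesis unfolding Rplus_def by (subst AE_restrict_space_iff) auto
  qed
  have "AE t in Rplus. Re (f t) = 0" "AE t in Rplus. Im (f t) = 0"
    by (rule part; simp add: bounded_linear_Re bounded_linear_Im)+
  then show ?thesis by eventually_elim (simp add: complex_eq_iff)
qed

text \<open>Gram-Schmidt on the rational half-line indicators gives a basis indexed by a subset of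
  \<open>nat\<close>. Once this subset is known to be infinite, its enumeration makes all of
  \<open>nat\<close> the alphabet.\<close>

lemma exists_onb_Rplus: "\<exists>e :: nat \<Rightarrow> real \<Rightarrow> real. onb Rplus UNIV e"
proof -
  obtain r :: "nat \<Rightarrow> rat" where r: "range r = UNIV"
    using uncountable_def[of "UNIV :: rat set"] by auto
  define v where "v k = (indicator {..real_of_rat (r k)} :: real \<Rightarrow> real)" for k
  have fin: "emeasure lborel ({0..} \<inter> {..a}) < \<infinity>" for a :: real
    by (simp add: atLeastAtMost_def[symmetric] emeasure_lborel_Icc_eq)
  have o: "onb Rplus {k. (\<integral>t. gs Rplus v k t * gs Rplus v k t \<partial>Rplus) = 1} (gs Rplus v)"
  proof (rule onb_gs)
    show "l2fun Rplus (\<lambda>t. of_real (v k t))" for k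
      unfolding v_def by (rule l2fun_indicator_Rplus[OF _ fin]) simp
    show "AE t in Rplus. f t = 0" if "l2fun Rplus f" "\<And>k. fcoef Rplus (v k) f = 0" for f
    proof (rule Rplus_total[OF that(1)])
      fix q :: rat
      obtain k where "q = r k" using r by (metis rangeE UNIV_I)
      then show "fcoef Rplus (indicator {..of_rat q}) f = 0" using that(2)[of k] by (simp add: v_def)
    qed
  qed
  \<comment> \<open>The indicators of disjoint unit intervals are infinitely many orthonormal
    functions, which is what \<open>onb_infinite\<close> asks for.\<close>
  define u where "u j = (indicator {real j..<real (Suc j)} :: real \<Rightarrow> real)" for j
  have J: "{0..} \<inter> {real j..<real (Suc j)} = {real j..<real (Suc j)}" for j by auto
  have "orthonormal Rplus UNIV u"
    unfolding orthonormal_def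
  proof (intro conjI ballI)
    show "l2fun Rplus (\<lambda>t. of_real (u j t))" for j
      unfolding u_def by (rule l2fun_indicator_Rplus) (simp_all only: J, simp_all)
    fix i j :: nat
    show "(\<integral>t. u i t * u j t \<partial>Rplus) = (if i = j then 1 else 0)"
    proof (cases "i = j")
      case True
      have "u i t * u i t = indicator {real i..<real (Suc i)} t" for t by (simp add: u_def indicator_def)
      moreover have "(\<integral>t. indicator {real i..<real (Suc i)} t \<partial>Rplus) = measure lborel {real i..<real (Suc i)}"
        using integral_indicator_Rplus(2)[of "{real i..<real (Suc i)}"] by (simp only: J) simp
      ultimately show ?thesis using True by simp
    next
      case False
      have "(\<lambda>t. u i t * u j t) = (\<lambda>t. 0)"
      proof (rule ext, rule ccontr)
        fix t
        assume "u i t * u j t \<noteq> 0"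
        then have "real i \<le> t" "t < real (Suc i)" "real j \<le> t" "t < real (Suc j)"
          by (auto simp: u_def indicator_def split: if_splits)
        then have "i < Suc j" "j < Suc i" by linarith+
        then show False using False by simp
      qed
      then show ?thesis using False by simp
    qed
  qed
  then have "infinite {k. (\<integral>t. gs Rplus v k t * gs Rplus v k t \<partial>Rplus) = 1}"
    by (rule onb_infinite[OF o])
  from onb_reindex[OF o bij_enumerate[OF this]] show ?thesis by blast
qed

section \<open>Coordinates on the Fock space\<close>

definition bas :: "nat \<Rightarrow> real \<Rightarrow> real" where
  "bas = (SOME e. onb Rplus UNIV e)"

lemma onb_bas: "onb Rplus UNIV bas"
  unfolding bas_def by (rule someI_ex[OF exists_onb_Rplus])

abbreviation tbas :: "nat list \<Rightarrow> (nat \<Rightarrow> real) \<Rightarrow> real" where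
  "tbas \<equiv> tensor_basis bas"

lemma onb_tbas: "onb (Mn n) {w. length w = n} tbas"
  by (rule onb_Mn[OF onb_bas])

lemma sqint_l2fun: "sqint n f \<longleftrightarrow> l2fun (Mn n) f"
  by (simp add: sqint_def l2fun_def)

lemma sqint1_l2fun: "sqint1 h \<longleftrightarrow> l2fun Rplus h"
  by (simp add: sqint1_def l2fun_def)

lemma fnorm2_comp_sqnorm: "fnorm2_comp \<psi> n = sqnorm (Mn n) (\<psi> n)"
  by (simp add: fnorm2_comp_def sqnorm_def)

lemma fock_l2fun: "fock \<psi> \<Longrightarrow> l2fun (Mn n) (\<psi> n)"
  by (simp add: fock_def sqint_l2fun)

definition fvcoef :: "fockv \<Rightarrow> nat list \<Rightarrow> complex" where
  "fvcoef \<psi> w = fcoef (Mn (length w)) (tbas w) (\<psi> (length w))"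

definition fvec :: "fockv \<Rightarrow> nat word_ell2" where
  "fvec \<psi> = Ell2 (fvcoef \<psi>)"

lemma coord_coefs_tbas:
  "l2fun (Mn n) (\<psi> n) \<Longrightarrow> coord (coefs (Mn n) {w. length w = n} tbas (\<psi> n)) w = (if length w = n then fvcoef \<psi> w else 0)"
  by (auto simp: coord_coefs[OF onbD[OF onb_tbas]] fvcoef_def)

lemma has_sum_level:
  assumes "l2fun (Mn n) (\<psi> n)"
  shows "((\<lambda>w. (cmod (fvcoef \<psi> w))\<^sup>2) has_sum sqnorm (Mn n) (\<psi> n)) {w. length w = n}"
proof -
  let ?a = "coefs (Mn n) {w. length w = n} tbas (\<psi> n)"
  have "((\<lambda>w. (cmod (coord ?a w))\<^sup>2) has_sum sqnorm (Mn n) (\<psi> n)) UNIV"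
    unfolding Parseval[OF onb_tbas assms] norm_ell2_sq by (rule has_sum_infsum[OF summable_norm_sq])
  then show ?thesis
    by (rule has_sum_cong_neutral[THEN iffD1, rotated -1]) (auto simp: coord_coefs_tbas[of n \<psi>, OF assms])
qed

text \<open>Parseval holds on each level; the words, sorted by length, then assemble the levels into
  a single square-summable family.\<close>

lemma has_sum_fvcoef:
  assumes "fock \<psi>"
  shows "((\<lambda>w. (cmod (fvcoef \<psi> w))\<^sup>2) has_sum (\<Sum>n. fnorm2_comp \<psi> n)) UNIV"
proof -
  have s: "((\<lambda>n. sqnorm (Mn n) (\<psi> n)) has_sum (\<Sum>n. fnorm2_comp \<psi> n)) UNIV"
  proof -
    have "summable (\<lambda>n. sqnorm (Mn n) (\<psi> n))"
      using assms by (simp add: fock_def fnorm2_comp_sqnorm[abs_def])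
    then show ?thesis
      unfolding fnorm2_comp_sqnorm by (intro norm_summable_imp_has_sum summable_sums) simp_all
  qed
  have l: "((\<lambda>w. (cmod (fvcoef \<psi> (snd (n, w))))\<^sup>2) has_sum sqnorm (Mn n) (\<psi> n)) {w. length w = n}" for n
    using has_sum_level[where \<psi> = \<psi>, OF fock_l2fun[OF assms]] by simp
  have "((\<lambda>p. (cmod (fvcoef \<psi> (snd p)))\<^sup>2) has_sum (\<Sum>n. fnorm2_comp \<psi> n)) (SIGMA n:UNIV. {w. length w = n})"
  proof (rule has_sum_SigmaI[OF l s])
    show "(\<lambda>p. (cmod (fvcoef \<psi> (snd p)))\<^sup>2) summable_on (SIGMA n:UNIV. {w. length w = n})"
      using l s by (intro summable_on_SigmaI[where g = "\<lambda>n. sqnorm (Mn n) (\<psi> n)"]) (auto intro: has_sum_imp_summable)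
  qed
  moreover have "bij_betw snd (SIGMA n:UNIV. {w :: nat list. length w = n}) UNIV"
    by (rule bij_betwI[where g = "\<lambda>w. (length w, w)"]) auto
  ultimately show ?thesis
    using has_sum_reindex_bij_betw[of snd _ UNIV "\<lambda>w. (cmod (fvcoef \<psi> w))\<^sup>2"] by blast
qed

lemma coord_fvec:
  assumes "fock \<psi>"
  shows "coord (fvec \<psi>) = fvcoef \<psi>"
  unfolding fvec_def
  by (rule coord_Ell2) (auto simp: square_summable_def intro: has_sum_imp_summable[OF has_sum_fvcoef[OF assms]])

lemma norm_fvec:
  assumes "fock \<psi>"
  shows "norm (fvec \<psi>) = fnorm \<psi>"
proof -
  have "(norm (fvec \<psi>))\<^sup>2 = (\<Sum>n. fnorm2_comp \<psi> n)"
    unfolding norm_ell2_sq coord_fvec[OF assms] using has_sum_fvcoef[OF assms] by (rule infsumI)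
  then show ?thesis by (metis fnorm_def norm_ge_zero real_sqrt_abs abs_of_nonneg)
qed

text \<open>The standard way to recognise a Fock vector: levelwise square-integrability and
  coefficients that match a known \<open>ell2\<close> vector also give summability over the
  levels.\<close>

lemma fockI:
  assumes l: "\<And>n. l2fun (Mn n) (\<psi> n)" and c: "\<And>w. fvcoef \<psi> w = coord a w"
  shows "fock \<psi>" "fvec \<psi> = a"
proof -
  have "summable (\<lambda>n. sqnorm (Mn n) (\<psi> n))"
  proof (rule summableI_nonneg_bounded)
    fix N
    have "(\<Sum>n<N. sqnorm (Mn n) (\<psi> n)) = (\<Sum>n<N. infsum (\<lambda>w. (cmod (coord a w))\<^sup>2) {w. length w = n})"
      using infsumI[OF has_sum_level[where \<psi> = \<psi>, OF l]] by (intro sum.cong refl) (simp add: c)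
    also have "\<dots> = infsum (\<lambda>w. (cmod (coord a w))\<^sup>2) (\<Union>n<N. {w. length w = n})"
      by (rule sum_infsum) (auto intro: summable_norm_sq)
    also have "\<dots> \<le> (norm a)\<^sup>2" by (rule infsum_norm_sq_le)
    finally show "(\<Sum>n<N. sqnorm (Mn n) (\<psi> n)) \<le> (norm a)\<^sup>2" .
  qed simp
  then show f: "fock \<psi>"
    using l by (simp add: fock_def sqint_l2fun fnorm2_comp_sqnorm[abs_def])
  show "fvec \<psi> = a" by (intro ell2_eqI) (simp add: coord_fvec[OF f] c)
qed

definition synth :: "nat word_ell2 \<Rightarrow> fockv" where
  "synth a = (SOME \<psi>. fock \<psi> \<and> fvec \<psi> = a)"

lemma synth: "fock (synth a)" "fvec (synth a) = a"
proof -
  define p where "p n = Ell2 (\<lambda>w. if length w = n then coord a w else 0)" for n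
  have p: "coord (p n) w = (if length w = n then coord a w else 0)" for n w
  proof -
    have "square_summable (\<lambda>w. if length w = n then coord a w else 0)"
      by (rule square_summable_cong_norm[OF square_summable_coord[of a]]) simp
    then show ?thesis by (simp add: p_def)
  qed
  have "\<exists>f. l2fun (Mn n) f \<and> coefs (Mn n) {w. length w = n} tbas f = p n" for n
    using Riesz_Fischer[OF onbD[OF onb_tbas], of n "p n"] by (auto simp: supported_in_def p)
  then obtain \<psi> where \<psi>: "\<And>n. l2fun (Mn n) (\<psi> n)" "\<And>n. coefs (Mn n) {w. length w = n} tbas (\<psi> n) = p n"
    by metis
  have c: "fvcoef \<psi> w = coord a w" for w
  proof -
    have "coord (p (length w)) w = fvcoef \<psi> w"
      unfolding \<psi>(2)[symmetric] by (subst coord_coefs_tbas[where \<psi> = \<psi>, OF \<psi>(1)]) simp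
    then show ?thesis by (simp add: p)
  qed
  have "fock \<psi> \<and> fvec \<psi> = a"
    by (intro conjI fockI[where \<psi> = \<psi> and a = a]) (rule \<psi>(1), rule c)+
  then have "fock (synth a) \<and> fvec (synth a) = a"
    unfolding synth_def by (rule someI[where P = "\<lambda>\<psi>. fock \<psi> \<and> fvec \<psi> = a"])
  then show "fock (synth a)" "fvec (synth a) = a" by auto
qed

text \<open>Coordinates are faithful up to null sets. Through this equivalence, \<open>feq\<close>
  between Fock vectors becomes plain equality in \<open>ell2\<close>.\<close>

lemma feq_iff_fvec:
  assumes \<psi>: "fock \<psi>" and \<phi>: "fock \<phi>"
  shows "feq \<psi> \<phi> \<longleftrightarrow> fvec \<psi> = fvec \<phi>"
proof
  assume e: "feq \<psi> \<phi>"
  show "fvec \<psi> = fvec \<phi>"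
  proof (rule ell2_eqI)
    fix w
    have "tbas w \<in> borel_measurable (Mn (length w))"
      using l2fun_measurable[OF onb_l2fun[OF onb_tbas, of w "length w"]]
        borel_measurable_complex_iff[of "\<lambda>t. complex_of_real (tbas w t)" "Mn (length w)"] by simp
    then have "fvcoef \<psi> w = fvcoef \<phi> w"
      unfolding fvcoef_def using e \<psi> \<phi>
      by (intro fcoef_cong_AE) (auto simp: feq_def intro: l2fun_measurable fock_l2fun)
    then show "coord (fvec \<psi>) w = coord (fvec \<phi>) w" by (simp add: coord_fvec \<psi> \<phi>)
  qed
next
  assume e: "fvec \<psi> = fvec \<phi>"
  show "feq \<psi> \<phi>"
    unfolding feq_def
  proof
    fix n
    have "fvcoef \<psi> w = fvcoef \<phi> w" for w
      using e coord_fvec[OF \<psi>] coord_fvec[OF \<phi>] by metis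
    then show "AE t in Mn n. \<psi> n t = \<phi> n t"
      by (intro onb_AE_eq[OF onb_tbas fock_l2fun[OF \<psi>] fock_l2fun[OF \<phi>]] ell2_eqI)
        (simp add: coord_coefs_tbas fock_l2fun \<psi> \<phi>)
  qed
qed

lemma onb_tbas_l2fun: "l2fun (Mn (length w)) (\<lambda>t. of_real (tbas w t))"
  by (rule onb_l2fun[OF onb_tbas]) simp

lemma fock_fadd:
  assumes "fock \<psi>" "fock \<phi>"
  shows "fock (fadd \<psi> \<phi>)" "fvec (fadd \<psi> \<phi>) = fvec \<psi> + fvec \<phi>"
  by (rule fockI[of _ "fvec \<psi> + fvec \<phi>"];
      use assms in \<open>auto simp: fadd_def fvcoef_def coord_fvec fock_l2fun l2fun_add fcoef_add[OF onb_tbas_l2fun]\<close>)+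

lemma fock_fscale:
  assumes "fock \<psi>"
  shows "fock (fscale c \<psi>)" "fvec (fscale c \<psi>) = cscale c (fvec \<psi>)"
  by (rule fockI[of _ "cscale c (fvec \<psi>)"];
      use assms in \<open>auto simp: fscale_def fvcoef_def coord_fvec fock_l2fun l2fun_cmult fcoef_cmult\<close>)+

lemma fock_fzero: "fock fzero" "fvec fzero = 0"
  by (rule fockI[of _ 0]; simp add: fzero_def fvcoef_def l2fun_zero fcoef_zero)+

lemma fock_sum:
  assumes "\<And>n. n \<in> A \<Longrightarrow> fock (\<xi> n)"
  shows "fock (\<lambda>m t. \<Sum>n\<in>A. \<xi> n m t)" "fvec (\<lambda>m t. \<Sum>n\<in>A. \<xi> n m t) = (\<Sum>n\<in>A. fvec (\<xi> n))"
  by (rule fockI[of _ "\<Sum>n\<in>A. fvec (\<xi> n)"];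
      use assms in \<open>auto simp: fvcoef_def coord_fvec fock_l2fun intro!: l2fun_sum fcoef_sum[OF onb_tbas_l2fun, THEN trans] sum.cong\<close>)+

lemma fock_emb:
  assumes "sqint n f"
  shows "fock (emb n f)" "fin_deg n (fvec (emb n f))"
proof -
  have l: "l2fun (Mn m) (emb n f m)" for m
    using assms by (cases "m = n") (simp_all add: emb_def sqint_l2fun l2fun_zero)
  have "fnorm2_comp (emb n f) m = 0" if "m \<noteq> n" for m
    using that by (simp add: fnorm2_comp_def emb_def)
  then have "summable (fnorm2_comp (emb n f))"
    by (intro summable_finite[of "{n}"]) auto
  then show *: "fock (emb n f)" using l by (simp add: fock_def sqint_l2fun)
  have "fvcoef (emb n f) w = 0" if "length w \<noteq> n" for w
    using that by (simp add: fvcoef_def emb_def fcoef_zero)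
  then show "fin_deg n (fvec (emb n f))"
    by (simp add: fin_deg_def coord_fvec[OF *])
qed

lemma vacuum_emb: "vacuum = emb 0 (\<lambda>t. 1)"
  by (simp add: vacuum_def emb_def fun_eq_iff)

lemma fock_vacuum: "fock vacuum" "fvec vacuum = unit []"
proof -
  have M0: "Mn 0 = count_space {\<lambda>_. undefined}" by (simp add: Mn_def PiM_empty)
  have "sqint 0 (\<lambda>t. 1)"
    unfolding sqint_def M0 by (auto intro: integrable_count_space)
  then show *: "fock vacuum" unfolding vacuum_emb by (rule fock_emb)
  have "fvcoef vacuum [] = 1"
    by (simp add: fvcoef_def fcoef_def vacuum_def tensor_basis_def) (simp add: M0)
  moreover have "fvcoef vacuum w = 0" if "w \<noteq> []" for w
    using that by (simp add: fvcoef_def vacuum_def fcoef_zero)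
  ultimately show "fvec vacuum = unit []"
    by (intro ell2_eqI) (simp add: coord_fvec[OF *])
qed

section \<open>Creation and annihilation in coordinates\<close>

definition one_particle :: "(real \<Rightarrow> complex) \<Rightarrow> nat word_ell2" where
  "one_particle h = Ell2 (\<lambda>w. if length w = 1 then fcoef Rplus (bas (hd w)) h else 0)"

lemma coord_one_particle:
  assumes h: "l2fun Rplus h"
  shows "coord (one_particle h) w = (if length w = 1 then fcoef Rplus (bas (hd w)) h else 0)"
proof -
  have "square_summable (\<lambda>w. if length w = 1 then fcoef Rplus (bas (hd w)) h else 0)"
  proof (rule square_summableI_finite)
    fix F :: "nat list set" assume F: "finite F"
    let ?G = "{w\<in>F. length w = 1}"
    have inj: "inj_on hd ?G" by (auto simp: inj_on_def length_Suc_conv)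
    have "(\<Sum>w\<in>F. (cmod (if length w = 1 then fcoef Rplus (bas (hd w)) h else 0))\<^sup>2)
        = (\<Sum>w\<in>?G. (cmod (fcoef Rplus (bas (hd w)) h))\<^sup>2)"
      using F by (intro sum.mono_neutral_cong_right) auto
    also have "\<dots> = (\<Sum>i\<in>hd ` ?G. (cmod (fcoef Rplus (bas i) h))\<^sup>2)"
      by (subst sum.reindex[OF inj]) simp
    also have "\<dots> \<le> sqnorm Rplus h"
      using F by (intro Bessel[OF onbD[OF onb_bas] _ _ h]) auto
    finally show "(\<Sum>w\<in>F. (cmod (if length w = 1 then fcoef Rplus (bas (hd w)) h else 0))\<^sup>2) \<le> sqnorm Rplus h" .
  qed
  then show ?thesis by (simp add: one_particle_def)
qed

lemma fin_deg_one_particle: "l2fun Rplus h \<Longrightarrow> fin_deg 1 (one_particle h)"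
  by (simp add: fin_deg_def coord_one_particle)

lemma one_particle_bas: "one_particle (\<lambda>s. of_real (bas i s)) = letter i"
proof (rule ell2_eqI)
  fix w
  show "coord (one_particle (\<lambda>s. of_real (bas i s))) w = coord (letter i) w"
    using fcoef_basis[OF onbD[OF onb_bas], of "hd w" i]
    by (cases w) (auto simp: coord_one_particle onb_l2fun[OF onb_bas] letter_def)
qed

text \<open>The split k = 0 yields the annihilation term and k = 1 the creation term; degree 1
  excludes the others. For real h these are the two summands of \<open>Xop\<close>.\<close>

lemma wick_one_particle:
  assumes h: "l2fun Rplus h"
  shows "wick (one_particle h) a w = (\<Sum>\<^sub>\<infinity>i. fcoef Rplus (bas i) h * coord a (i # w)) +
    (if w = [] then 0 else fcoef Rplus (bas (hd w)) h * coord a (tl w))"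
proof -
  let ?f = "one_particle h"
  have 0: "contract ?f a [] w = (\<Sum>\<^sub>\<infinity>i. fcoef Rplus (bas i) h * coord a (i # w))"
  proof -
    have "contract ?f a [] w = (\<Sum>\<^sub>\<infinity>c\<in>range (\<lambda>i. [i]). coord ?f c * coord a (rev c @ w))"
      unfolding contract_def append_Nil
      by (rule infsum_cong_neutral) (auto simp: coord_one_particle[OF h] length_Suc_conv)
    also have "\<dots> = (\<Sum>\<^sub>\<infinity>i. fcoef Rplus (bas i) h * coord a (i # w))"
      by (subst infsum_reindex) (auto simp: o_def coord_one_particle[OF h] intro: injI)
    finally show ?thesis .
  qed
  have z: "contract ?f a x y = 0" if "length x > 1" for x y
    using that by (auto simp: contract_def coord_one_particle[OF h] intro!: infsum_0)
  have 1: "contract ?f a [i] y = fcoef Rplus (bas i) h * coord a y" for i y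
    unfolding contract_def by (subst infsum_single[of "[]"]) (auto simp: coord_one_particle[OF h])
  show ?thesis
  proof (cases w)
    case Nil
    then show ?thesis using 0 by (simp add: wick_def)
  next
    case (Cons i v)
    have "wick ?f a w = contract ?f a [] w + (\<Sum>k\<le>length v. contract ?f a (i # take k v) (drop k v))"
      unfolding wick_def using Cons by (simp add: sum.atMost_Suc_shift del: sum.atMost_Suc)
    also have "(\<Sum>k\<le>length v. contract ?f a (i # take k v) (drop k v)) = (\<Sum>k\<in>{0}. contract ?f a (i # take k v) (drop k v))"
      by (rule sum.mono_neutral_right) (auto intro!: z)
    finally show ?thesis using Cons 0 by (simp add: 1)
  qed
qed

lemma measurable_tail: "(\<lambda>t i. t (Suc i)) \<in> measurable (Mn (Suc n)) (Mn n)"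
  unfolding Mn_def
proof (rule measurable_PiM_single')
  fix i assume "i \<in> {..<n}"
  then show "(\<lambda>t. t (Suc i)) \<in> measurable (Pi\<^sub>M {..<Suc n} (\<lambda>_. Rplus)) Rplus"
    by (intro measurable_component_singleton) auto
qed (auto simp: space_PiM PiE_def Pi_def extensional_def)

lemma measurable_head: "(\<lambda>t. t 0) \<in> measurable (Mn (Suc n)) Rplus"
  unfolding Mn_def by (intro measurable_component_singleton) auto

lemma fcoef_Mn_Suc:
  assumes f: "l2fun (Mn (Suc (length w))) f"
  shows "fcoef (Mn (Suc (length w))) (tbas (i # w)) f
    = fcoef Rplus (bas i) (\<lambda>s. fcoef (Mn (length w)) (tbas w) (\<lambda>t. f (ncons (s, t))))"
proof -
  let ?P = "Rplus \<Otimes>\<^sub>M Mn (length w)"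
  have f': "l2fun ?P (\<lambda>z. f (ncons z))" using f l2fun_Mn_Suc[OF l2fun_measurable[OF f]] by simp
  have "integrable (Mn (Suc (length w))) (\<lambda>t. f t * complex_of_real (tbas (i # w) t))"
    using l2fun_prod_integrable[OF f] onb_tbas_l2fun[of "i # w"] by simp
  then have "fcoef (Mn (Suc (length w))) (tbas (i # w)) f = (\<integral>z. f (ncons z) * complex_of_real (tbas (i # w) (ncons z)) \<partial>?P)"
    unfolding fcoef_def
    by (subst distr_ncons[symmetric], subst integral_distr[OF measurable_ncons]) auto
  also have "\<dots> = fcoef ?P (\<lambda>z. bas i (fst z) * tbas w (snd z)) (\<lambda>z. f (ncons z))"
    by (simp add: fcoef_def tensor_basis_Cons)
  also have "\<dots> = fcoef Rplus (bas i) (\<lambda>s. fcoef (Mn (length w)) (tbas w) (\<lambda>t. f (ncons (s, t))))"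
    by (rule fcoef_pair[OF sigma_finite_Rplus sigma_finite_Mn f' onb_l2fun[OF onb_bas] onb_tbas_l2fun]) simp
  finally show ?thesis .
qed

lemma l2fun_lcre:
  assumes h: "l2fun Rplus h" and \<psi>: "fock \<psi>"
  shows "l2fun (Mn n) (lcre h \<psi> n)"
proof (cases n)
  case 0
  then show ?thesis by (simp add: lcre_def l2fun_zero)
next
  case (Suc m)
  have "(\<lambda>t. h (t 0) * \<psi> m (\<lambda>i. t (Suc i))) \<in> borel_measurable (Mn (Suc m))"
    using measurable_compose[OF measurable_head l2fun_measurable[OF h]]
      measurable_compose[OF measurable_tail l2fun_measurable[OF fock_l2fun[OF \<psi>]]]
    by (intro borel_measurable_times) auto
  moreover have "l2fun (Rplus \<Otimes>\<^sub>M Mn m) (\<lambda>z. h (fst z) * \<psi> m (snd z))"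
    by (rule l2fun_tensor[OF sigma_finite_Rplus sigma_finite_Mn h fock_l2fun[OF \<psi>]])
  ultimately show ?thesis using Suc by (simp add: lcre_def l2fun_Mn_Suc)
qed

lemma fvcoef_lcre:
  assumes h: "l2fun Rplus h" and \<psi>: "fock \<psi>"
  shows "fvcoef (lcre h \<psi>) w = (if w = [] then 0 else fcoef Rplus (bas (hd w)) h * fvcoef \<psi> (tl w))"
proof (cases w)
  case Nil
  then show ?thesis by (simp add: fvcoef_def lcre_def fcoef_zero)
next
  case (Cons i v)
  have "fvcoef (lcre h \<psi>) (i # v) = fcoef Rplus (bas i) (\<lambda>s. fcoef (Mn (length v)) (tbas v) (\<lambda>t. h s * \<psi> (length v) t))"
    using l2fun_lcre[OF h \<psi>, of "Suc (length v)"]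
    by (simp add: fvcoef_def fcoef_Mn_Suc) (simp add: lcre_def)
  also have "\<dots> = fcoef Rplus (bas i) (\<lambda>s. fvcoef \<psi> v * h s)"
    by (simp add: fcoef_cmult fvcoef_def mult.commute)
  also have "\<dots> = fvcoef \<psi> v * fcoef Rplus (bas i) h" by (rule fcoef_cmult)
  finally show ?thesis using Cons by (simp add: mult.commute)
qed

text \<open>By Fubini, integrating out the first variable commutes with taking coefficients in the
  others; Parseval in \<open>bas\<close> then turns the remaining integral over s into a sum over
  letters.\<close>

lemma
  fixes g :: "real \<Rightarrow> real"
  assumes g: "l2fun Rplus (\<lambda>s. of_real (g s))" and \<psi>: "fock \<psi>"
  shows l2fun_lann: "l2fun (Mn n) (lann (\<lambda>s. of_real (g s)) \<psi> n)"
    and fvcoef_lann: "fvcoef (lann (\<lambda>s. of_real (g s)) \<psi>) w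
      = (\<Sum>\<^sub>\<infinity>i. fcoef Rplus (bas i) (\<lambda>s. of_real (g s)) * fvcoef \<psi> (i # w))"
proof -
  define F where "F n = (\<lambda>z. \<psi> (Suc n) (ncons z))" for n
  have F: "l2fun (Rplus \<Otimes>\<^sub>M Mn n) (F n)" for n
    using fock_l2fun[OF \<psi>, of "Suc n"] l2fun_Mn_Suc[OF l2fun_measurable] by (simp add: F_def)
  have la: "lann (\<lambda>s. of_real (g s)) \<psi> n = (\<lambda>t. \<integral>s. of_real (g s) * F n (s, t) \<partial>Rplus)" for n
    by (simp only: lann_def F_def ncons_def fst_conv snd_conv complex_cnj_complex_of_real)
  show "l2fun (Mn n) (lann (\<lambda>s. of_real (g s)) \<psi> n)"
    using l2fun_slice[OF sigma_finite_Mn sigma_finite_Rplus l2fun_swap[OF sigma_finite_Rplus sigma_finite_Mn F] g]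
    by (simp add: la mult.commute)
  let ?n = "length w"
  define Fw where "Fw s = fcoef (Mn ?n) (tbas w) (\<lambda>t. F ?n (s, t))" for s
  have Fw: "l2fun Rplus Fw"
    unfolding Fw_def fcoef_def by (rule l2fun_slice[OF sigma_finite_Rplus sigma_finite_Mn F onb_tbas_l2fun])
  have cF: "fcoef Rplus (bas i) Fw = fvcoef \<psi> (i # w)" for i
    using fcoef_Mn_Suc[OF fock_l2fun[OF \<psi>], of w i] by (simp add: fvcoef_def Fw_def[abs_def] F_def)
  have "fvcoef (lann (\<lambda>s. of_real (g s)) \<psi>) w = (\<integral>s. Fw s * of_real (g s) \<partial>Rplus)"
    unfolding fvcoef_def la Fw_def fcoef_def
    by (rule integral_slice_swap[OF sigma_finite_Rplus sigma_finite_Mn F g onb_tbas_l2fun])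
  also have "\<dots> = cip (coefs Rplus UNIV bas Fw) (coefs Rplus UNIV bas (\<lambda>s. of_real (g s)))"
    using Parseval_cip[OF onb_bas Fw g] by simp
  also have "\<dots> = (\<Sum>\<^sub>\<infinity>i. fcoef Rplus (bas i) (\<lambda>s. of_real (g s)) * fvcoef \<psi> (i # w))"
    unfolding cip_def
    by (simp add: coord_coefs[OF onbD[OF onb_bas]] Fw g cF fcoef_of_real mult.commute)
  finally show "fvcoef (lann (\<lambda>s. of_real (g s)) \<psi>) w
      = (\<Sum>\<^sub>\<infinity>i. fcoef Rplus (bas i) (\<lambda>s. of_real (g s)) * fvcoef \<psi> (i # w))" .
qed

text \<open>The bridge between the analytic and the combinatorial side: the generators of
  \<open>Salg\<close> act in coordinates as left Wick multiplications.\<close>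

lemma fock_Xop:
  assumes g: "l2fun Rplus (\<lambda>s. of_real (g s))" and \<psi>: "fock \<psi>"
  shows "fock (Xop g \<psi>)" "fvec (Xop g \<psi>) = wmul (one_particle (\<lambda>s. of_real (g s))) (fvec \<psi>)"
proof -
  let ?a = "wmul (one_particle (\<lambda>s. of_real (g s))) (fvec \<psi>)"
  have l: "l2fun (Mn n) (Xop g \<psi> n)" for n
    using l2fun_add[OF l2fun_lcre[OF g \<psi>] l2fun_lann[OF g \<psi>]] by (simp add: Xop_def fadd_def)
  have c: "fvcoef (Xop g \<psi>) w = coord ?a w" for w
  proof -
    have "fvcoef (Xop g \<psi>) w = fvcoef (lcre (\<lambda>s. of_real (g s)) \<psi>) w + fvcoef (lann (\<lambda>s. of_real (g s)) \<psi>) w"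
      unfolding fvcoef_def Xop_def fadd_def
      by (rule fcoef_add[OF onb_tbas_l2fun l2fun_lcre[OF g \<psi>] l2fun_lann[OF g \<psi>]])
    then show ?thesis
      by (simp add: fvcoef_lcre[OF g \<psi>] fvcoef_lann[OF g \<psi>] wmul_eq_parts(2)[OF fin_deg_one_particle[OF g]]
          wick_one_particle[OF g] coord_fvec[OF \<psi>])
  qed
  show "fock (Xop g \<psi>)" "fvec (Xop g \<psi>) = ?a" by (rule fockI[OF l c])+
qed

section \<open>Operators in coordinates and the algebra generated by the X(g)\<close>

definition lift_op :: "(nat word_ell2 \<Rightarrow> nat word_ell2) \<Rightarrow> fockv \<Rightarrow> fockv" where
  "lift_op T \<psi> = synth (T (fvec \<psi>))"

lemma fock_lift_op: "fock (lift_op T \<psi>)" "fvec (lift_op T \<psi>) = T (fvec \<psi>)"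
  by (simp_all add: lift_op_def synth)

lemma bdd_op_lift_op:
  assumes T: "bounded_clinear T"
  shows "bdd_op (lift_op T)"
proof -
  obtain K where "\<And>a. norm (T a) \<le> K * norm a" using bounded_clinear_bound[OF T] by blast
  then have "fnorm (lift_op T \<psi>) \<le> K * fnorm \<psi>" if "fock \<psi>" for \<psi>
    using that by (simp add: norm_fvec[symmetric] fock_lift_op)
  then show ?thesis
    unfolding bdd_op_def
    by (auto simp: fock_lift_op feq_iff_fvec fock_fadd fock_fscale bounded_clinearD[OF T])
qed

text \<open>The choice made by \<open>synth\<close> is invisible for a \<open>bdd_op\<close>, which
  respects \<open>feq\<close>. Thus operators on representatives become honest operators on
  \<open>ell2\<close>, and \<open>lift_op\<close> leads back.\<close>

definition hat_op :: "(fockv \<Rightarrow> fockv) \<Rightarrow> nat word_ell2 \<Rightarrow> nat word_ell2" where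
  "hat_op X a = fvec (X (synth a))"

lemma bdd_op_fock: "bdd_op X \<Longrightarrow> fock \<psi> \<Longrightarrow> fock (X \<psi>)"
  by (simp add: bdd_op_def)

lemma bdd_op_cong: "bdd_op X \<Longrightarrow> fock \<psi> \<Longrightarrow> fock \<phi> \<Longrightarrow> fvec \<psi> = fvec \<phi> \<Longrightarrow> fvec (X \<psi>) = fvec (X \<phi>)"
  unfolding bdd_op_def by (metis feq_iff_fvec)

lemma fvec_hat_op: "bdd_op X \<Longrightarrow> fock \<psi> \<Longrightarrow> fvec (X \<psi>) = hat_op X (fvec \<psi>)"
  unfolding hat_op_def by (rule bdd_op_cong) (auto simp: synth)

lemma bounded_clinear_hat_op:
  assumes X: "bdd_op X"
  shows "bounded_clinear (hat_op X)"
proof -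
  have lin: "hat_op X (cscale c a + cscale d b) = cscale c (hat_op X a) + cscale d (hat_op X b)" for a b c d
  proof -
    have "feq (X (fadd (fscale c (synth a)) (fscale d (synth b)))) (fadd (fscale c (X (synth a))) (fscale d (X (synth b))))"
      using X synth(1) unfolding bdd_op_def by blast
    then have "fvec (X (fadd (fscale c (synth a)) (fscale d (synth b)))) = cscale c (hat_op X a) + cscale d (hat_op X b)"
      by (subst (asm) feq_iff_fvec) (simp_all add: bdd_op_fock[OF X] fock_fadd fock_fscale synth hat_op_def)
    then show ?thesis
      by (simp add: fvec_hat_op[OF X] fock_fadd fock_fscale synth)
  qed
  have one: "cscale 1 a = a" and zero: "cscale 0 a = 0" for a :: "nat word_ell2" by (auto intro: ell2_eqI)
  obtain C where C: "\<And>\<psi>. fock \<psi> \<Longrightarrow> fnorm (X \<psi>) \<le> C * fnorm \<psi>" using X unfolding bdd_op_def by blast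
  have "norm (hat_op X a) \<le> C * norm a" for a
    using C[OF synth(1)[of a]] norm_fvec[OF synth(1)[of a]] norm_fvec[OF bdd_op_fock[OF X synth(1)[of a]]]
    by (simp add: hat_op_def synth)
  then show ?thesis
    using lin[of 1 _ 1] lin[of _ _ 0 0] by (intro bounded_clinearI) (auto simp: one zero)
qed

text \<open>U enters only through its coordinate form T, so that the same lemma covers
  \<open>lift_op (Rop i)\<close> and \<open>Xop g\<close>.\<close>

lemma hat_op_commute:
  assumes X: "bdd_op X" and U: "\<And>\<psi>. fock \<psi> \<Longrightarrow> fock (U \<psi>) \<and> fvec (U \<psi>) = T (fvec \<psi>)" and c: "opeq (X \<circ> U) (U \<circ> X)"
  shows "hat_op X (T a) = T (hat_op X a)"
proof -
  have "feq (X (U (synth a))) (U (X (synth a)))" using c synth(1) by (simp add: opeq_def)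
  then have "fvec (X (U (synth a))) = fvec (U (X (synth a)))"
    by (subst (asm) feq_iff_fvec) (auto simp: U bdd_op_fock[OF X] synth)
  then show ?thesis by (simp add: fvec_hat_op[OF X] U synth bdd_op_fock[OF X])
qed

lemma opeq_commuteI:
  assumes X: "bdd_op X" and U: "\<And>\<psi>. fock \<psi> \<Longrightarrow> fock (U \<psi>) \<and> fvec (U \<psi>) = T (fvec \<psi>)"
    and c: "\<And>a. hat_op X (T a) = T (hat_op X a)"
  shows "opeq (X \<circ> U) (U \<circ> X)"
  unfolding opeq_def
proof (intro allI impI)
  fix \<psi> assume \<psi>: "fock \<psi>"
  have "fvec (X (U \<psi>)) = fvec (U (X \<psi>))"
    by (simp add: fvec_hat_op[OF X] U bdd_op_fock[OF X] \<psi> c)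
  then show "feq ((X \<circ> U) \<psi>) ((U \<circ> X) \<psi>)"
    by (simp add: feq_iff_fvec U bdd_op_fock[OF X] \<psi>)
qed

lemma lift_op_spec: "fock \<psi> \<Longrightarrow> fock (lift_op T \<psi>) \<and> fvec (lift_op T \<psi>) = T (fvec \<psi>)"
  by (simp add: fock_lift_op)

lemma hat_op_lift_op [simp]: "hat_op (lift_op T) a = T a"
  by (simp add: hat_op_def fock_lift_op synth)

abbreviation Xops :: "(fockv \<Rightarrow> fockv) set" where
  "Xops \<equiv> {Xop g | g. sqint1 (\<lambda>s. complex_of_real (g s))}"

lemma Xop_spec:
  "sqint1 (\<lambda>s. complex_of_real (g s)) \<Longrightarrow> fock \<psi> \<Longrightarrow>
    fock (Xop g \<psi>) \<and> fvec (Xop g \<psi>) = wmul (one_particle (\<lambda>s. of_real (g s))) (fvec \<psi>)"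
  by (simp add: sqint1_l2fun fock_Xop)

text \<open>Left and right multiplications commute. Hence every element of the bicommutant
  \<open>Salg\<close> commutes with all right multiplications by letters.\<close>

lemma lift_Rop_commutant: "lift_op (Rop i) \<in> commutant Xops"
proof -
  have "opeq (lift_op (Rop i) \<circ> Xop g) (Xop g \<circ> lift_op (Rop i))" if g: "sqint1 (\<lambda>s. complex_of_real (g s))" for g
    by (rule opeq_commuteI[where U = "Xop g" and T = "wmul (one_particle (\<lambda>s. of_real (g s)))",
          OF bdd_op_lift_op[OF bounded_clinear_Rop] Xop_spec[OF g]])
      (use g in \<open>auto simp: wmul_Rop[OF fin_deg_one_particle] sqint1_l2fun\<close>)
  then show ?thesis
    by (auto simp: commutant_def bdd_op_lift_op[OF bounded_clinear_Rop])
qed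

text \<open>An element of \<open>Salg\<close> is determined by its vacuum vector: commuting with
  right multiplications, X sends g = 1 * g to the product of its vacuum vector with g for g of
  finite degree, and density does the rest.\<close>

lemma Salg_wmul:
  assumes X: "X \<in> Salg" and f: "fvec (X vacuum) = f" "fin_deg N f" and \<psi>: "fock \<psi>"
  shows "fvec (X \<psi>) = wmul f (fvec \<psi>)"
proof -
  have bX: "bdd_op X" using X by (simp add: Salg_def commutant_def)
  have comm: "hat_op X (Rop i a) = Rop i (hat_op X a)" for i a
  proof (rule hat_op_commute[OF bX lift_op_spec])
    show "opeq (X \<circ> lift_op (Rop i)) (lift_op (Rop i) \<circ> X)"
      using X lift_Rop_commutant unfolding Salg_def commutant_def[of "commutant _"] by blast
  qed
  have lX: "bounded_clinear (hat_op X)" by (rule bounded_clinear_hat_op[OF bX])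
  have lf: "bounded_clinear (wmul f)" by (rule bounded_clinear_wmul[OF f(2)])
  have vac: "hat_op X (unit []) = f"
    using fvec_hat_op[OF bX fock_vacuum(1)] f(1) by (simp add: fock_vacuum)
  have fin: "hat_op X g = wmul f g" if "fin_deg M g" for g M
    using Rop_commutant_wmul[OF lX comm that, of "unit []"] by (simp add: vac)
  obtain K where K: "\<And>a. norm (hat_op X a - wmul f a) \<le> K * norm a"
    using bounded_clinear_bound[OF bounded_clinear_diff[OF lX lf]] by blast
  have "hat_op X (fvec \<psi>) - wmul f (fvec \<psi>) = 0"
    by (rule additive_bounded_eq_0[where S = UNIV and \<Phi> = "\<lambda>a. hat_op X a - wmul f a", OF _ K])
      (auto simp: bounded_clinearD[OF lX] bounded_clinearD[OF lf] fin[OF fin_deg_unit])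
  then show ?thesis using fvec_hat_op[OF bX \<psi>] by simp
qed

lemma flip_letter: "flip (letter i) = letter i"
  by (intro ell2_eqI) (auto simp: letter_def rev_swap)

lemma flip_add: "flip (a + b) = flip a + flip b" and flip_cscale: "flip (cscale c a) = cscale c (flip a)"
  by (auto intro: ell2_eqI)

text \<open>Conjugation by \<open>flip\<close> turns left multiplication by a letter into
  \<open>Rop i\<close>, so this is the mirror image of \<open>Rop_commutant_wmul\<close>.\<close>

lemma letter_commutant_wmul:
  assumes T: "bounded_clinear T" and comm: "\<And>i a. T (wmul (letter i) a) = wmul (letter i) (T a)" and f: "fin_deg N f"
  shows "T (wmul f a) = wmul f (T a)"
proof -
  have R: "Rop i a = flip (wmul (letter i) (flip a))" for i and a :: "'a word_ell2"
    using wmul_right(1)[OF fin_deg_letter, of a i] by (simp add: Rop_def flip_letter)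
  obtain K where K: "\<And>a. norm (T a) \<le> K * norm a" using bounded_clinear_bound[OF T] by blast
  have "norm (flip (T (flip a))) \<le> K * norm a" for a using K[of "flip a"] by simp
  then have "bounded_clinear (\<lambda>a. flip (T (flip a)))"
    by (intro bounded_clinearI) (auto simp: flip_add flip_cscale bounded_clinearD[OF T])
  moreover have "flip (T (flip (Rop i a))) = Rop i (flip (T (flip a)))" for i a
    by (simp add: R comm)
  ultimately have "flip (T (flip (wmul (flip a) (flip f)))) = wmul (flip (T (flip (flip a)))) (flip f)"
    by (rule Rop_commutant_wmul) (use f in simp)
  moreover have "wmul b (flip f) = flip (wmul f (flip b))" for b
    using wmul_right(1)[of N "flip f" b] f by simp
  ultimately show ?thesis by (metis flip_flip)
qed

text \<open>An element of the commutant commutes with X(e_i), that is, with left multiplication by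
  each letter, and therefore with left multiplication by every f of finite degree.\<close>

lemma lift_wmul_Salg:
  assumes f: "fin_deg N f"
  shows "lift_op (wmul f) \<in> Salg"
  unfolding Salg_def commutant_def[of "commutant _"]
proof (intro CollectI conjI ballI)
  show b: "bdd_op (lift_op (wmul f))" by (rule bdd_op_lift_op[OF bounded_clinear_wmul[OF f]])
  fix T assume T: "T \<in> commutant Xops"
  then have bT: "bdd_op T" by (simp add: commutant_def)
  have comm: "hat_op T (wmul (letter i) a) = wmul (letter i) (hat_op T a)" for i a
  proof -
    have g: "sqint1 (\<lambda>s. complex_of_real (bas i s))"
      using onb_l2fun[OF onb_bas, of i] by (simp add: sqint1_l2fun)
    then have "opeq (T \<circ> Xop (bas i)) (Xop (bas i) \<circ> T)" using T by (auto simp: commutant_def)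
    from hat_op_commute[OF bT Xop_spec[OF g] this] show ?thesis by (simp add: one_particle_bas)
  qed
  have T': "fock \<psi> \<Longrightarrow> fock (T \<psi>) \<and> fvec (T \<psi>) = hat_op T (fvec \<psi>)" for \<psi>
    by (simp add: bdd_op_fock[OF bT] fvec_hat_op[OF bT])
  show "opeq (lift_op (wmul f) \<circ> T) (T \<circ> lift_op (wmul f))"
    by (rule opeq_commuteI[where U = T and T = "hat_op T", OF b T'])
      (simp_all add: letter_commutant_wmul[OF bounded_clinear_hat_op[OF bT] comm f])
qed

text \<open>\<open>lift_wmul_Salg\<close> provides a witness for the choice in \<open>IS\<close>,
  and \<open>Salg_wmul\<close> shows that whichever element is chosen acts as the same left
  multiplication.\<close>

lemma IS_spec:
  assumes f: "sqint n f"
  shows "IS n f \<in> Salg" "fock \<psi> \<Longrightarrow> fvec (IS n f \<psi>) = wmul (fvec (emb n f)) (fvec \<psi>)"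
proof -
  note e = fock_emb[OF f]
  have "lift_op (wmul (fvec (emb n f))) \<in> Salg \<and> feq (lift_op (wmul (fvec (emb n f))) vacuum) (emb n f)"
    by (simp add: lift_wmul_Salg[OF e(2)] feq_iff_fvec e(1) fock_lift_op fock_vacuum)
  then have IS: "IS n f \<in> Salg \<and> feq (IS n f vacuum) (emb n f)"
    unfolding IS_def by (rule someI[where P = "\<lambda>X. X \<in> Salg \<and> feq (X vacuum) (emb n f)"])
  then show "IS n f \<in> Salg" by blast
  then have "bdd_op (IS n f)" by (simp add: Salg_def commutant_def)
  then have "fvec (IS n f vacuum) = fvec (emb n f)"
    using IS by (simp add: feq_iff_fvec e(1) bdd_op_fock fock_vacuum)
  then show "fock \<psi> \<Longrightarrow> fvec (IS n f \<psi>) = wmul (fvec (emb n f)) (fvec \<psi>)"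
    by (rule Salg_wmul[OF \<open>IS n f \<in> Salg\<close> _ e(2)])
qed

lemma feq_trans:
  assumes "feq \<psi> \<phi>" "feq \<phi> \<xi>"
  shows "feq \<psi> \<xi>"
  unfolding feq_def
proof
  fix n
  have "AE t in Mn n. \<psi> n t = \<phi> n t" "AE t in Mn n. \<phi> n t = \<xi> n t"
    using assms by (auto simp: feq_def)
  then show "AE t in Mn n. \<psi> n t = \<xi> n t" by eventually_elim simp
qed

lemma feq_sym: "feq \<psi> \<phi> \<Longrightarrow> feq \<phi> \<psi>"
  by (simp add: feq_def eq_commute)

text \<open>Y is given only up to \<open>opeq\<close>, so \<open>Y \<psi>\<close> is known merely up
  to null sets and \<open>fvec (Y \<psi>)\<close> is not at hand. The kernel of Y is therefore
  expressed through \<open>feq\<close>.\<close>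

lemma Sfin_wmul:
  assumes "Y \<in> Sfin"
  obtains N F where "fin_deg N F" "\<And>\<psi>. fock \<psi> \<Longrightarrow> feq (Y \<psi>) fzero \<longleftrightarrow> wmul F (fvec \<psi>) = 0"
proof -
  obtain N f where f: "\<And>n. n \<le> N \<Longrightarrow> sqint n (f n)"
    and Y: "opeq Y (\<lambda>\<psi> m t. \<Sum>n\<le>N. IS n (f n) \<psi> m t)"
    using assms unfolding Sfin_def by blast
  define F where "F n = fvec (emb n (f n))" for n
  have F: "fin_deg N (F n)" if "n \<le> N" for n
    using fock_emb(2)[OF f[OF that]] that by (auto simp: F_def fin_deg_def)
  have sumF: "fin_deg N (sum F A) \<and> wmul (sum F A) a = (\<Sum>n\<in>A. wmul (F n) a)" if "A \<subseteq> {..N}" for A a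
    using finite_subset[OF that finite_atMost] that
  proof (induction A rule: finite_induct)
    case empty
    have "fin_deg N (0 :: nat word_ell2)" by (simp add: fin_deg_def)
    then show ?case by (auto intro!: ell2_eqI simp: wmul_eq_parts(2))
  next
    case (insert n A)
    then show ?case using F[of n] by (auto simp: fin_deg_add wmul_add_left[of N])
  qed
  have "feq (Y \<psi>) fzero \<longleftrightarrow> wmul (sum F {..N}) (fvec \<psi>) = 0" if \<psi>: "fock \<psi>" for \<psi>
  proof -
    let ?S = "\<lambda>m t. \<Sum>n\<le>N. IS n (f n) \<psi> m t"
    have IS: "fock (IS n (f n) \<psi>)" if "n \<le> N" for n
      using IS_spec(1)[OF f[OF that]] \<psi> by (auto simp: Salg_def commutant_def bdd_op_fock)
    have S: "fock ?S" "fvec ?S = wmul (sum F {..N}) (fvec \<psi>)"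
      using fock_sum[of "{..N}" "\<lambda>n. IS n (f n) \<psi>"] IS IS_spec(2)[OF f \<psi>] sumF[of "{..N}" "fvec \<psi>"]
      by (auto simp: F_def)
    have "feq (Y \<psi>) ?S" using Y \<psi> by (simp add: opeq_def)
    then have "feq (Y \<psi>) fzero \<longleftrightarrow> feq ?S fzero" using feq_trans feq_sym by blast
    also have "\<dots> \<longleftrightarrow> wmul (sum F {..N}) (fvec \<psi>) = 0"
      by (simp add: feq_iff_fvec S fock_fzero)
    finally show ?thesis .
  qed
  then show ?thesis
    using sumF[of "{..N}"] by (intro that[of N "sum F {..N}"]) simp_all
qed

theorem theorem5p11:
  fixes Y u :: "fockv \<Rightarrow> fockv"
  assumes "Y \<in> Sfin"
    and "\<not> opeq Y zero_op"
    and "u \<in> Salg"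
    and "opeq (Y \<circ> u) zero_op"
  shows "opeq u zero_op"
proof -
  obtain N F where F: "fin_deg N F" "\<And>\<psi>. fock \<psi> \<Longrightarrow> feq (Y \<psi>) fzero \<longleftrightarrow> wmul F (fvec \<psi>) = 0"
    using Sfin_wmul[OF assms(1)] by blast
  have "F \<noteq> 0"
  proof
    assume "F = 0"
    then have "wmul F a = 0" for a using F(1) by (intro ell2_eqI) (simp add: wmul_eq_parts(2))
    then show False using assms(2) F(2) by (simp add: opeq_def zero_op_def)
  qed
  have u: "bdd_op u" using assms(3) by (simp add: Salg_def commutant_def)
  show ?thesis
    unfolding opeq_def zero_op_def
  proof (intro allI impI)
    fix \<psi> assume \<psi>: "fock \<psi>"
    then have "fock (u \<psi>)" by (rule bdd_op_fock[OF u])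
    moreover have "feq (Y (u \<psi>)) fzero" using assms(4) \<psi> by (simp add: opeq_def zero_op_def)
    ultimately have "wmul F (fvec (u \<psi>)) = 0" using F(2) by blast
    then have "fvec (u \<psi>) = 0" by (rule wmul_no_zero_divisors[OF F(1) \<open>F \<noteq> 0\<close>])
    then show "feq (u \<psi>) fzero" using \<open>fock (u \<psi>)\<close> by (simp add: feq_iff_fvec fock_fzero)
  qed
qed

end
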